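(* Let $H_2\subset H_1$ be separable Hilbert spaces with a dense inclusion of $H_2$ into $H_1$. Let $O_1$ be an open subset of $\mathbb R\times H_1$ and let $\phi\colon O_1\to H_1$ be asymptotically constant parametrized tame. Let $$\mathcal U:=\{\xi\in W^{1,2}(\mathbb R,H_1)\cap L^2(\mathbb R,H_2)\mid(s,\xi(s))\in O_1\ \forall s\in\mathbb R\}.$$ Then the map $$\Phi\colon\mathcal U\to W^{1,2}(\mathbb R,H_1)\cap L^2(\mathbb R,H_2),\qquad\Phi(\xi)(s):=\phi_s(\xi(s)),$$ where $\phi_s(x):=\phi(s,x)$, is well defined and continuously differentiable.
   Context: Norms are $|\cdot|_1:=\|\cdot\|_{H_1}$, $|\cdot|_2:=\|\cdot\|_{H_2}$, normalized so that $|\cdot|_1\le|\cdot|_2$ on $H_2$. The inclusion is not assumed compact. **Parametrized tame.** Let $O_1\subset\mathbb R\times H_1$ be open and $O_2:=O_1\cap(\mathbb R\times H_2)$. A $C^2$ map $\phi\colon O_1\to H_1$ is *parametrized tame* if (1) $\phi(O_2)\subset H_2$ and $\phi|_{O_2}\colon O_2\to H_2$ is $C^2$; (2) for every $(s,x)\in O_1$ there are an open neighborhood $W_{s,x}$ of $(s,x)$ in $O_1$ and a constant $\kappa_{s,x}>0$ such that for all $(t,y)\in W_{s,x}\cap(\mathbb R\times H_2)$ and all $\xi,\eta\in H_2$: $|d^2\phi_t|_y(\xi,\eta)|_2\le\kappa_{s,x}\big(|\xi|_1|\eta|_2+|\xi|_2|\eta|_1+|y|_2|\xi|_1|\eta|_1\big)$.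 Here $\phi_t:=\phi(t,\cdot)$ and $d^2\phi_t$ is its second derivative in the $H_1$-variable. **Asymptotically constant.** Let $U_1^s:=\{x\in H_1\mid(s,x)\in O_1\}$. A parametrized tame map $\phi$ is *asymptotically constant* if there exists $T>0$ such that the map $\phi_s\colon U_1^s\to H_1$ (including its domain) is independent of $s$ for $s\ge T$, and independent of $s$ for $s\le-T$, and moreover $0\in U_1^s$ and $\phi_s(0)=0$ whenever $|s|\ge T$. $W^{1,2}(\mathbb R,H_1)\cap L^2(\mathbb R,H_2)$ is a Hilbert space with inner product $\int_{\mathbb R}\langle\dot\xi,\dot\eta\rangle_{H_1}ds+\int_{\mathbb R}\langle\xi,\eta\rangle_{H_2}ds$. Elements of $W^{1,2}(\mathbb R,H_1)$ are identified with their continuous representatives. *)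

theory Defs
  imports "HOL-Analysis.Analysis"
begin

section \<open>Continuous differentiability in normed spaces\<close>

definition fderiv ::
    "('a::real_normed_vector \<Rightarrow> 'b::real_normed_vector) \<Rightarrow> 'a \<Rightarrow> 'a \<Rightarrow>\<^sub>L 'b" where
  "fderiv f x = Blinfun (frechet_derivative f (at x))"

text \<open>The following two notions are meant for open \<open>S\<close>; continuity of the derivatives is
  with respect to the operator norm.\<close>

definition C1_on ::
    "'a set \<Rightarrow> ('a::real_normed_vector \<Rightarrow> 'b::real_normed_vector) \<Rightarrow> bool" where
  "C1_on S f \<longleftrightarrow> (\<forall>x\<in>S. f differentiable (at x)) \<and> continuous_on S (fderiv f)"

definition C2_on ::
    "'a set \<Rightarrow> ('a::real_normed_vector \<Rightarrow> 'b::real_normed_vector) \<Rightarrow> bool" where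
  "C2_on S f \<longleftrightarrow> C1_on S f \<and> C1_on S (fderiv f)"

definition second_fderiv ::
    "('a::real_normed_vector \<Rightarrow> 'b::real_normed_vector) \<Rightarrow> 'a \<Rightarrow> 'a \<Rightarrow> 'a \<Rightarrow> 'b" where
  "second_fderiv f x \<xi> \<eta> = blinfun_apply (blinfun_apply (fderiv (fderiv f) x) \<xi>) \<eta>"

section \<open>Parametrized tame maps\<close>

text \<open>The spaces \<open>H\<^sub>1\<close> and \<open>H\<^sub>2\<close> are the types \<open>'a\<close> and \<open>'b\<close>; the inclusion of \<open>H\<^sub>2\<close>
  into \<open>H\<^sub>1\<close> is an injective map \<open>\<iota> :: 'b \<Rightarrow> 'a\<close>. Thus \<open>x \<in> H\<^sub>2\<close> reads \<open>x \<in> range \<iota>\<close>, and for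
  such \<open>x\<close> the corresponding element of \<open>'b\<close> is \<open>inv \<iota> x\<close>. Maps defined on \<open>O1\<close> are total
  functions whose values outside \<open>O1\<close> are irrelevant.\<close>

definition restr_dom :: "('b \<Rightarrow> 'a) \<Rightarrow> (real \<times> 'a) set \<Rightarrow> (real \<times> 'b) set" where
  "restr_dom \<iota> O1 = {(s, x). (s, \<iota> x) \<in> O1}"

definition restr_map :: "('b \<Rightarrow> 'a) \<Rightarrow> (real \<times> 'a \<Rightarrow> 'a) \<Rightarrow> real \<times> 'b \<Rightarrow> 'b" where
  "restr_map \<iota> \<phi> = (\<lambda>(s, x). inv \<iota> (\<phi> (s, \<iota> x)))"

text \<open>In the last condition, the argument of \<open>inv \<iota>\<close> lies in \<open>range \<iota>\<close> as a consequence of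
  the preceding ones: differentiate \<open>\<phi>\<^sub>t \<circ> \<iota> = \<iota> \<circ> \<phi>\<^sub>t|\<^sub>H\<^sub>2\<close> twice.\<close>

definition parametrized_tame ::
    "('b::real_normed_vector \<Rightarrow> 'a::real_normed_vector) \<Rightarrow> (real \<times> 'a) set
      \<Rightarrow> (real \<times> 'a \<Rightarrow> 'a) \<Rightarrow> bool" where
  "parametrized_tame \<iota> O1 \<phi> \<longleftrightarrow>
     C2_on O1 \<phi> \<and>
     (\<forall>(s, x) \<in> restr_dom \<iota> O1. \<phi> (s, \<iota> x) \<in> range \<iota>) \<and>
     C2_on (restr_dom \<iota> O1) (restr_map \<iota> \<phi>) \<and>
     (\<forall>p\<in>O1. \<exists>W \<kappa>. open W \<and> p \<in> W \<and> W \<subseteq> O1 \<and> \<kappa> > 0 \<and>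
        (\<forall>(t, y) \<in> restr_dom \<iota> W. \<forall>\<xi> \<eta>.
           norm (inv \<iota> (second_fderiv (\<lambda>x. \<phi> (t, x)) (\<iota> y) (\<iota> \<xi>) (\<iota> \<eta>)))
             \<le> \<kappa> * (norm (\<iota> \<xi>) * norm \<eta> + norm \<xi> * norm (\<iota> \<eta>)
                    + norm y * norm (\<iota> \<xi>) * norm (\<iota> \<eta>))))"

definition slice :: "(real \<times> 'a) set \<Rightarrow> real \<Rightarrow> 'a set" where
  "slice O1 s = {x. (s, x) \<in> O1}"

definition asymptotically_constant ::
    "(real \<times> 'a) set \<Rightarrow> (real \<times> 'a \<Rightarrow> 'a::zero) \<Rightarrow> bool" where
  "asymptotically_constant O1 \<phi> \<longleftrightarrow>
     (\<exists>T>0.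
        (\<forall>s t. (T \<le> s \<and> T \<le> t \<or> s \<le> - T \<and> t \<le> - T) \<longrightarrow>
           slice O1 s = slice O1 t \<and> (\<forall>x\<in>slice O1 s. \<phi> (s, x) = \<phi> (t, x))) \<and>
        (\<forall>s. T \<le> \<bar>s\<bar> \<longrightarrow> 0 \<in> slice O1 s \<and> \<phi> (s, 0) = 0))"

section \<open>The path space\<close>

definition square_integrable ::
    "(real \<Rightarrow> 'h::{real_normed_vector, second_countable_topology}) \<Rightarrow> bool" where
  "square_integrable f \<longleftrightarrow> f \<in> borel_measurable lborel \<and> integrable lborel (\<lambda>s. (norm (f s))\<^sup>2)"

definition test_function :: "(real \<Rightarrow> real) \<Rightarrow> bool" where
  "test_function \<psi> \<longleftrightarrow>
     (\<forall>n. (deriv ^^ n) \<psi> differentiable_on UNIV) \<and> compact (closure {s. \<psi> s \<noteq> 0})"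

definition weak_derivative ::
    "(real \<Rightarrow> 'h::{banach, second_countable_topology}) \<Rightarrow> (real \<Rightarrow> 'h) \<Rightarrow> bool" where
  "weak_derivative \<xi> v \<longleftrightarrow>
     (\<forall>\<psi>. test_function \<psi> \<longrightarrow>
        (LINT s|lborel. deriv \<psi> s *\<^sub>R \<xi> s) = - (LINT s|lborel. \<psi> s *\<^sub>R v s))"

text \<open>Elements of \<open>W\<^sup>1\<^sup>,\<^sup>2\<close> are represented by their continuous representatives, so that
  equality in the space is equality of functions.\<close>

definition W12 :: "(real \<Rightarrow> 'h::{banach, second_countable_topology}) set" where
  "W12 = {\<xi>. continuous_on UNIV \<xi> \<and> square_integrable \<xi> \<and>
              (\<exists>v. square_integrable v \<and> weak_derivative \<xi> v)}"

text \<open>An element of \<open>W\<^sup>1\<^sup>,\<^sup>2(\<real>, H\<^sub>1)\<close> lies in \<open>L\<^sup>2(\<real>, H\<^sub>2)\<close> if it agrees almost everywhere with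
  (the image of) a measurable square integrable \<open>H\<^sub>2\<close>-valued function; at the remaining times
  its values need not lie in \<open>H\<^sub>2\<close>.\<close>

definition L2_lift ::
    "('b::{banach, second_countable_topology} \<Rightarrow> 'a) \<Rightarrow> (real \<Rightarrow> 'a) \<Rightarrow> (real \<Rightarrow> 'b) \<Rightarrow> bool" where
  "L2_lift \<iota> \<xi> f \<longleftrightarrow> square_integrable f \<and> (AE s in lborel. \<iota> (f s) = \<xi> s)"

definition path_space ::
    "('b::{banach, second_countable_topology} \<Rightarrow> 'a::{banach, second_countable_topology})
      \<Rightarrow> (real \<Rightarrow> 'a) set" where
  "path_space \<iota> = {\<xi> \<in> W12. \<exists>f. L2_lift \<iota> \<xi> f}"

text \<open>Both choices below are unique up to null sets (the second one for injective \<open>\<iota>\<close>), hence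
  do not affect the inner product.\<close>

definition wderiv ::
    "(real \<Rightarrow> 'h::{banach, second_countable_topology}) \<Rightarrow> real \<Rightarrow> 'h" where
  "wderiv \<xi> = (SOME v. square_integrable v \<and> weak_derivative \<xi> v)"

definition H2_version ::
    "('b::{banach, second_countable_topology} \<Rightarrow> 'a) \<Rightarrow> (real \<Rightarrow> 'a) \<Rightarrow> real \<Rightarrow> 'b" where
  "H2_version \<iota> \<xi> = (SOME f. L2_lift \<iota> \<xi> f)"

definition path_inner ::
    "('b::{real_inner, banach, second_countable_topology}
        \<Rightarrow> 'a::{real_inner, banach, second_countable_topology})
      \<Rightarrow> (real \<Rightarrow> 'a) \<Rightarrow> (real \<Rightarrow> 'a) \<Rightarrow> real" where
  "path_inner \<iota> \<xi> \<eta> =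
     (LINT s|lborel. wderiv \<xi> s \<bullet> wderiv \<eta> s)
     + (LINT s|lborel. H2_version \<iota> \<xi> s \<bullet> H2_version \<iota> \<eta> s)"

definition path_norm ::
    "('b::{real_inner, banach, second_countable_topology}
        \<Rightarrow> 'a::{real_inner, banach, second_countable_topology})
      \<Rightarrow> (real \<Rightarrow> 'a) \<Rightarrow> real" where
  "path_norm \<iota> \<xi> = sqrt (path_inner \<iota> \<xi> \<xi>)"

section \<open>Continuously differentiable maps on a space of functions\<close>

text \<open>The path space depends on the inclusion \<open>\<iota>\<close> and hence is a set, not a type, so Frechet
  differentiability is spelled out for a vector space \<open>E\<close> of functions (with pointwise
  operations) normed by \<open>N\<close>.\<close>

definition bounded_operator ::
    "('s \<Rightarrow> 'a::real_vector) set \<Rightarrow> (('s \<Rightarrow> 'a) \<Rightarrow> real)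
      \<Rightarrow> (('s \<Rightarrow> 'a) \<Rightarrow> ('s \<Rightarrow> 'a)) \<Rightarrow> bool" where
  "bounded_operator E N A \<longleftrightarrow>
     (\<forall>h\<in>E. A h \<in> E) \<and>
     (\<forall>h\<in>E. \<forall>k\<in>E. A (\<lambda>s. h s + k s) = (\<lambda>s. A h s + A k s)) \<and>
     (\<forall>c. \<forall>h\<in>E. A (\<lambda>s. c *\<^sub>R h s) = (\<lambda>s. c *\<^sub>R A h s)) \<and>
     (\<exists>K. \<forall>h\<in>E. N (A h) \<le> K * N h)"

definition open_subset ::
    "('s \<Rightarrow> 'a::real_vector) set \<Rightarrow> (('s \<Rightarrow> 'a) \<Rightarrow> real) \<Rightarrow> ('s \<Rightarrow> 'a) set \<Rightarrow> bool" where
  "open_subset E N U \<longleftrightarrow>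
     U \<subseteq> E \<and> (\<forall>u\<in>U. \<exists>r>0. \<forall>v\<in>E. N (\<lambda>s. v s - u s) < r \<longrightarrow> v \<in> U)"

definition has_derivative_within_space ::
    "('s \<Rightarrow> 'a::real_vector) set \<Rightarrow> (('s \<Rightarrow> 'a) \<Rightarrow> real) \<Rightarrow> ('s \<Rightarrow> 'a) set
      \<Rightarrow> (('s \<Rightarrow> 'a) \<Rightarrow> ('s \<Rightarrow> 'a)) \<Rightarrow> (('s \<Rightarrow> 'a) \<Rightarrow> ('s \<Rightarrow> 'a)) \<Rightarrow> ('s \<Rightarrow> 'a) \<Rightarrow> bool" where
  "has_derivative_within_space E N U F A u \<longleftrightarrow>
     bounded_operator E N A \<and>
     (\<forall>\<epsilon>>0. \<exists>\<delta>>0. \<forall>v\<in>U. N (\<lambda>s. v s - u s) < \<delta> \<longrightarrow>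
        N (\<lambda>s. F v s - F u s - A (\<lambda>s. v s - u s) s) \<le> \<epsilon> * N (\<lambda>s. v s - u s))"

text \<open>The last condition is continuity of \<open>u \<mapsto> DF u\<close> in the operator norm.\<close>

definition C1_map ::
    "('s \<Rightarrow> 'a::real_vector) set \<Rightarrow> (('s \<Rightarrow> 'a) \<Rightarrow> real) \<Rightarrow> ('s \<Rightarrow> 'a) set
      \<Rightarrow> (('s \<Rightarrow> 'a) \<Rightarrow> ('s \<Rightarrow> 'a)) \<Rightarrow> bool" where
  "C1_map E N U F \<longleftrightarrow>
     open_subset E N U \<and> (\<forall>u\<in>U. F u \<in> E) \<and>
     (\<exists>DF. (\<forall>u\<in>U. has_derivative_within_space E N U F (DF u) u) \<and>
        (\<forall>u\<in>U. \<forall>\<epsilon>>0. \<exists>\<delta>>0. \<forall>v\<in>U. N (\<lambda>s. v s - u s) < \<delta> \<longrightarrow>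
           (\<forall>h\<in>E. N (\<lambda>s. DF v h s - DF u h s) \<le> \<epsilon> * N h)))"

section \<open>The induced map on paths\<close>

definition admissible_paths ::
    "('b::{banach, second_countable_topology} \<Rightarrow> 'a::{banach, second_countable_topology})
      \<Rightarrow> (real \<times> 'a) set \<Rightarrow> (real \<Rightarrow> 'a) set" where
  "admissible_paths \<iota> O1 = {\<xi> \<in> path_space \<iota>. \<forall>s. (s, \<xi> s) \<in> O1}"

definition path_map :: "(real \<times> 'a \<Rightarrow> 'a) \<Rightarrow> (real \<Rightarrow> 'a) \<Rightarrow> real \<Rightarrow> 'a" where
  "path_map \<phi> \<xi> = (\<lambda>s. \<phi> (s, \<xi> s))"

end

theory Submission imports Defs begin

text \<open>The derivative of \<open>\<Phi>\<close> at \<open>u\<close> is \<open>h \<mapsto> (s \<mapsto> d\<phi>\<^sub>s(u s) h(s))\<close>. A path tends to \<open>0\<close> at both ends, where \<open>\<phi>\<^sub>s\<close>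
  does not depend on \<open>s\<close>, so compactness makes all local bounds for \<open>\<phi>\<close> (the tame estimate and
  the continuity of the second derivative on \<open>H\<^sub>1\<close>) uniform in a tube around the path. In
  \<open>L\<^sup>2(H\<^sub>2)\<close>, integrating the tame estimate along segments bounds the Taylor remainder by products
  in which the sup norm of the increment in \<open>H\<^sub>1\<close>, which is controlled by the norm of the path
  space, multiplies \<open>L\<^sup>2\<close>-norms. In \<open>W\<^sup>1\<^sup>,\<^sup>2(H\<^sub>1)\<close>, the chain rule expresses the weak derivative of the
  remainder through the second derivative of \<open>\<phi>\<close>, whose variation in a thin tube is small; the
  terms without a factor in \<open>L\<^sup>2\<close> come from the time derivative of \<open>\<phi>\<close> and live on a bounded interval.\<close>

section \<open>A smooth step function\<close>

text \<open>Chain and product rules are awkward for derivatives tested against test functions, as in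
  \<open>W12\<close>. All calculus is therefore done with primitives of locally integrable
  functions; for continuous paths and square integrable derivatives the two notions agree, and the
  smooth step supplies the test functions for the harder direction. The obstacle is that a path is
  bounded in H1 only: its H2 version is merely square integrable. Constants must hold on sets that
  are small in H1 but unbounded in H2, and each product may contain at most one explicit H2 norm.
  The tame estimate gives this for second derivatives. For values and first derivatives, density
  puts a point of H2 into every H1 ball, and one integrates from there. A growth bound such as
  \<open>1 + norm y\<close> is not square integrable on the line; at the ends
  \<open>\<phi> (s, 0) = 0\<close> improves it to a linear bound. The velocity of the derivative of
  the induced map contains a mixed second derivative. Symmetry of the second derivative turns it
  into the linear term of the Taylor expansion of \<open>D\<close>, which is why the remainder is
  small although the second derivative is only continuous.\<close>

definition smooth_upto :: "nat \<Rightarrow> (real \<Rightarrow> real) \<Rightarrow> bool" where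
  "smooth_upto n f \<longleftrightarrow> (\<forall>k\<le>n. (deriv ^^ k) f differentiable_on UNIV)"

lemma smooth_upto_0: "smooth_upto 0 f \<longleftrightarrow> f differentiable_on UNIV"
  by (simp add: smooth_upto_def)

text \<open>Peels off the first derivative, whereas \<open>funpow\<close> unfolds at the last one.
  In this form the closure properties follow by induction on the order with the function left
  arbitrary.\<close>

lemma smooth_upto_Suc:
  "smooth_upto (Suc n) f \<longleftrightarrow> f differentiable_on UNIV \<and> smooth_upto n (deriv f)"
proof
  assume *: "smooth_upto (Suc n) f"
  have "(deriv ^^ Suc k) f differentiable_on UNIV" if "k \<le> n" for k
    using * that unfolding smooth_upto_def by (meson Suc_le_mono)
  then have "(deriv ^^ k) (deriv f) differentiable_on UNIV" if "k \<le> n" for k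
    using that by (simp add: funpow_Suc_right del: funpow.simps)
  moreover have "f differentiable_on UNIV"
    using *[unfolded smooth_upto_def, rule_format, of 0] by simp
  ultimately show "f differentiable_on UNIV \<and> smooth_upto n (deriv f)"
    by (simp add: smooth_upto_def)
next
  assume *: "f differentiable_on UNIV \<and> smooth_upto n (deriv f)"
  show "smooth_upto (Suc n) f"
    unfolding smooth_upto_def
  proof (intro allI impI)
    fix k assume "k \<le> Suc n"
    then show "(deriv ^^ k) f differentiable_on UNIV"
      using * by (cases k) (auto simp: smooth_upto_def funpow_Suc_right simp del: funpow.simps)
  qed
qed

lemma smooth_upto_SucI:
  assumes "\<And>x. (f has_real_derivative g x) (at x)" "smooth_upto n g"
  shows "smooth_upto (Suc n) f"
proof -
  have "deriv f = g" using assms(1) by (auto intro: DERIV_imp_deriv)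
  then show ?thesis
    using assms by (auto simp: smooth_upto_Suc differentiable_on_def real_differentiable_def)
qed

lemma smooth_uptoD: "smooth_upto n f \<Longrightarrow> (f has_real_derivative deriv f x) (at x)"
  by (cases n) (auto simp: smooth_upto_0 smooth_upto_Suc differentiable_on_def
      DERIV_deriv_iff_real_differentiable)

lemma smooth_upto_SucD: "smooth_upto (Suc n) f \<Longrightarrow> smooth_upto n f"
  by (auto simp: smooth_upto_def)

lemma smooth_upto_const: "smooth_upto n (\<lambda>_. c)"
proof (induction n arbitrary: c)
  case (Suc n)
  then show ?case by (intro smooth_upto_SucI[where g="\<lambda>_. 0"]) auto
qed (auto simp: smooth_upto_0)

lemma smooth_upto_add:
  "smooth_upto n f \<Longrightarrow> smooth_upto n g \<Longrightarrow> smooth_upto n (\<lambda>x. f x + g x)"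
proof (induction n arbitrary: f g)
  case (Suc n)
  have "((\<lambda>x. f x + g x) has_real_derivative deriv f x + deriv g x) (at x)" for x
    by (intro derivative_intros smooth_uptoD[OF Suc.prems(1)] smooth_uptoD[OF Suc.prems(2)])
  then show ?case
    using Suc.prems
    by (intro smooth_upto_SucI[where g="\<lambda>x. deriv f x + deriv g x"] Suc.IH)
       (auto simp: smooth_upto_Suc)
qed (auto simp: smooth_upto_0)

lemma smooth_upto_mult:
  "smooth_upto n f \<Longrightarrow> smooth_upto n g \<Longrightarrow> smooth_upto n (\<lambda>x. f x * g x)"
proof (induction n arbitrary: f g)
  case (Suc n)
  have "((\<lambda>x. f x * g x) has_real_derivative deriv f x * g x + f x * deriv g x) (at x)" for x
    by (rule DERIV_mult'[THEN DERIV_cong])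
      (use smooth_uptoD[OF Suc.prems(1)] smooth_uptoD[OF Suc.prems(2)] in auto)
  moreover have "smooth_upto n (deriv f)" "smooth_upto n (deriv g)"
    using Suc.prems by (auto simp: smooth_upto_Suc)
  ultimately show ?case
    using Suc.prems[THEN smooth_upto_SucD]
    by (intro smooth_upto_SucI[where g="\<lambda>x. deriv f x * g x + f x * deriv g x"]
         smooth_upto_add Suc.IH)
qed (auto simp: smooth_upto_0)

lemma smooth_upto_inverse:
  assumes "\<And>x. f x \<noteq> 0"
  shows "smooth_upto n f \<Longrightarrow> smooth_upto n (\<lambda>x. inverse (f x))"
proof (induction n)
  case 0
  then show ?case using assms by (auto simp: smooth_upto_0 differentiable_on_def)
next
  case (Suc n)
  \<comment> \<open>Written as a product of reciprocals of \<open>f\<close> itself, so that the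
    induction hypothesis, one order lower, covers every factor.\<close>
  have "((\<lambda>x. inverse (f x)) has_real_derivative
      (-1) * deriv f x * (inverse (f x) * inverse (f x))) (at x)" for x
    by (rule DERIV_inverse_fun[OF smooth_uptoD[OF Suc.prems] assms, THEN DERIV_cong])
      (simp add: power2_eq_square)
  moreover have "smooth_upto n (deriv f)"
    using Suc.prems by (auto simp: smooth_upto_Suc)
  ultimately show ?case
    using Suc.prems[THEN smooth_upto_SucD]
    by (intro smooth_upto_SucI[where g="\<lambda>x. (-1) * deriv f x * (inverse (f x) * inverse (f x))"]
         smooth_upto_mult Suc.IH smooth_upto_const)
qed

lemma smooth_upto_affine: "smooth_upto n f \<Longrightarrow> smooth_upto n (\<lambda>x. f (c * x + d))"
proof (induction n arbitrary: f)
  case 0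
  have "(\<lambda>x. f (c * x + d)) differentiable (at x)" for x
    using 0 by (intro differentiable_compose[of f "\<lambda>x. c * x + d"])
      (auto simp: smooth_upto_0 differentiable_on_def)
  then show ?case by (simp add: smooth_upto_0 differentiable_on_def)
next
  case (Suc n)
  have "((\<lambda>x. f (c * x + d)) has_real_derivative deriv f (c * x + d) * c) (at x)" for x
    by (rule DERIV_chain2[OF smooth_uptoD[OF Suc.prems]]) (auto intro!: derivative_eq_intros)
  then show ?case
    by (rule smooth_upto_SucI, intro smooth_upto_mult[OF Suc.IH smooth_upto_const])
      (use Suc.prems in \<open>simp add: smooth_upto_Suc\<close>)
qed

lemma poly_times_exp_minus_tendsto_0: "((\<lambda>y::real. poly p y * exp (- y)) \<longlongrightarrow> 0) at_top"
proof -
  have "((\<lambda>y. \<Sum>i\<le>degree p. coeff p i * (y ^ i / exp y)) \<longlongrightarrow> (\<Sum>i\<le>degree p. coeff p i * 0)) at_top"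
    by (intro tendsto_sum tendsto_mult tendsto_const tendsto_power_div_exp_0)
  then show ?thesis
    by (simp add: poly_altdef sum_distrib_right exp_minus divide_inverse mult.assoc)
qed

text \<open>The classical flat function is the case \<open>p = 1\<close>. The polynomial in
  \<open>inverse x\<close> is carried along because the resulting family is closed under
  differentiation, so smoothness of all members is a single induction.\<close>

definition flat_exp :: "real poly \<Rightarrow> real \<Rightarrow> real" where
  "flat_exp p x = (if x > 0 then poly p (inverse x) * exp (- inverse x) else 0)"

text \<open>For positive \<open>x\<close> the inner derivative of \<open>inverse x\<close> produces
  a factor \<open>- inverse x ^ 2\<close>, which is the \<open>monom 1 2\<close>; differentiating
  the exponential contributes \<open>p\<close> and differentiating the polynomial contributes
  \<open>- pderiv p\<close>. At 0 the exponential beats the difference quotient.\<close>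

lemma flat_exp_has_derivative:
  "(flat_exp p has_real_derivative flat_exp (monom 1 2 * (p - pderiv p)) x) (at x)"
proof -
  consider "x < 0" | "x = 0" | "x > 0" by linarith
  then show ?thesis
  proof cases
    case 1
    have "((\<lambda>_. 0) has_real_derivative 0) (at x)" by simp
    then have "(flat_exp p has_real_derivative 0) (at x)"
      by (rule has_field_derivative_transform_within_open[where S="{..<0}"])
        (use 1 in \<open>auto simp: flat_exp_def\<close>)
    then show ?thesis using 1 by (simp add: flat_exp_def)
  next
    case 2
    have "((\<lambda>h. flat_exp p h / h) \<longlongrightarrow> 0) (at 0)"
      unfolding filterlim_at_split
    proof
      show "((\<lambda>h. flat_exp p h / h) \<longlongrightarrow> 0) (at_left 0)"
        by (rule tendsto_eventually) (simp add: eventually_at_filter flat_exp_def)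
      \<comment> \<open>Dividing by \<open>h\<close> multiplies the polynomial by its variable; with
        \<open>y = inverse h\<close> tending to infinity this is again a polynomial times
        \<open>exp (- y)\<close>.\<close>
      have "((\<lambda>h. poly (monom 1 1 * p) (inverse h) * exp (- inverse h)) \<longlongrightarrow> 0) (at_right (0::real))"
        by (rule filterlim_compose[OF poly_times_exp_minus_tendsto_0 filterlim_inverse_at_top_right])
      then show "((\<lambda>h. flat_exp p h / h) \<longlongrightarrow> 0) (at_right 0)"
        by (rule Lim_transform_eventually)
          (simp add: eventually_at_filter flat_exp_def poly_monom divide_inverse)
    qed
    then show ?thesis using 2 by (simp add: DERIV_def flat_exp_def)
  next
    case 3
    have "((\<lambda>x. poly p (inverse x) * exp (- inverse x)) has_real_derivative
      flat_exp (monom 1 2 * (p - pderiv p)) x) (at x)"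
      by (rule DERIV_cong[OF DERIV_mult[OF DERIV_chain2[OF poly_DERIV DERIV_inverse]
        DERIV_chain2[OF DERIV_exp DERIV_minus[OF DERIV_inverse]]]])
        (use 3 in \<open>simp_all add: flat_exp_def poly_monom power2_eq_square algebra_simps\<close>)
    then show ?thesis
      by (rule has_field_derivative_transform_within_open[where S="{0<..}"])
        (use 3 in \<open>auto simp: flat_exp_def\<close>)
  qed
qed

lemma smooth_upto_flat_exp: "smooth_upto n (flat_exp p)"
proof (induction n arbitrary: p)
  case 0
  show ?case using flat_exp_has_derivative
    by (auto simp: smooth_upto_0 differentiable_on_def real_differentiable_def)
next
  case (Suc n)
  show ?case by (rule smooth_upto_SucI[OF flat_exp_has_derivative Suc.IH])
qed

text \<open>The quotient is smooth because \<open>x\<close> and \<open>1 - x\<close> are never both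
  nonpositive, so the denominator is positive everywhere.\<close>

definition smooth_step :: "real \<Rightarrow> real" where
  "smooth_step x = flat_exp 1 x * inverse (flat_exp 1 x + flat_exp 1 (1 - x))"

lemma smooth_upto_smooth_step: "smooth_upto n smooth_step"
proof -
  have "flat_exp 1 x + flat_exp 1 (1 - x) > 0" for x
    by (auto simp: flat_exp_def intro: add_pos_pos)
  then have "flat_exp 1 x + flat_exp 1 (1 - x) \<noteq> 0" for x
    by (metis less_irrefl)
  moreover have "smooth_upto n (\<lambda>x. flat_exp 1 (1 - x))"
    using smooth_upto_affine[OF smooth_upto_flat_exp, of n 1 "-1" 1] by simp
  ultimately show ?thesis
    unfolding smooth_step_def
    by (intro smooth_upto_mult smooth_upto_inverse smooth_upto_add smooth_upto_flat_exp) auto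
qed

lemma smooth_step_0: "x \<le> 0 \<Longrightarrow> smooth_step x = 0"
  and smooth_step_1: "x \<ge> 1 \<Longrightarrow> smooth_step x = 1"
  by (auto simp: smooth_step_def flat_exp_def)

lemma smooth_step_bounds: "0 \<le> smooth_step x" "smooth_step x \<le> 1"
proof -
  have nn: "0 \<le> flat_exp 1 x" for x by (auto simp: flat_exp_def)
  show "0 \<le> smooth_step x" by (simp add: smooth_step_def nn)
  show "smooth_step x \<le> 1"
    using nn[of x] nn[of "1 - x"] by (auto simp: smooth_step_def divide_simps)
qed

section \<open>Primitives and the chain rule\<close>

text \<open>Local absolute continuity with prescribed density, the working substitute for
  \<open>weak_derivative\<close>. Borel measurability of \<open>q\<close> is recorded globally so
  that compositions with continuous maps remain measurable.\<close>

definition primitive_of ::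
    "(real \<Rightarrow> 'x::{banach, second_countable_topology}) \<Rightarrow> (real \<Rightarrow> 'x) \<Rightarrow> bool" where
  "primitive_of p q \<longleftrightarrow> continuous_on UNIV p \<and> q \<in> borel_measurable borel \<and>
     (\<forall>a b. a \<le> b \<longrightarrow> set_integrable lborel {a..b} q \<and>
        p b - p a = (LINT s:{a..b}|lborel. q s))"

lemma primitive_ofD:
  assumes "primitive_of p q"
  shows "continuous_on UNIV p" "q \<in> borel_measurable borel" "set_integrable lborel {a..b} q"
    "a \<le> b \<Longrightarrow> p b - p a = (LINT s:{a..b}|lborel. q s)"
  using assms by (cases "a \<le> b"; auto simp: primitive_of_def)+

lemma set_integral_Icc_combine:
  fixes g :: "real \<Rightarrow> 'x::{banach, second_countable_topology}"
  assumes "set_integrable lborel {a..c} g" "a \<le> b" "b \<le> c"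
  shows "(LINT s:{a..c}|lborel. g s) = (LINT s:{a..b}|lborel. g s) + (LINT s:{b..c}|lborel. g s)"
proof -
  have *: "{a..c} = {a..b} \<union> {b..c}" using assms by auto
  have "AE x in lborel. \<not> (x \<in> {a..b} \<and> x \<in> {b..c})"
    by (rule AE_mp[OF AE_lborel_singleton[of b]]) auto
  then show ?thesis
    unfolding *
    by (intro set_integral_Un_AE) (use assms in \<open>auto intro: set_integrable_subset[of _ "{a..c}"]\<close>)
qed

lemma norm_set_integral_le:
  fixes g :: "real \<Rightarrow> 'x::{banach, second_countable_topology}"
  assumes "set_integrable lborel A h" "\<And>s. s \<in> A \<Longrightarrow> norm (g s) \<le> h s"
  shows "norm (LINT s:A|lborel. g s) \<le> (LINT s:A|lborel. h s)"
proof (cases "set_integrable lborel A g")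
  case True
  have "norm (indicator A s *\<^sub>R g s) \<le> indicator A s *\<^sub>R h s" for s
    using assms(2) by (cases "s \<in> A") auto
  then show ?thesis
    using True assms(1) unfolding set_lebesgue_integral_def set_integrable_def
    by (intro Bochner_Integration.integral_norm_bound_integral)
next
  case False
  \<comment> \<open>The integral of a non-integrable function is 0 by convention, so here it
    suffices that the right side is nonnegative.\<close>
  have "0 \<le> indicator A s *\<^sub>R h s" for s
    using order_trans[OF norm_ge_zero assms(2)] by (cases "s \<in> A") auto
  then have "0 \<le> (LINT s:A|lborel. h s)"
    unfolding set_lebesgue_integral_def by (intro integral_nonneg_AE AE_I2)
  then show ?thesis
    using False unfolding set_lebesgue_integral_def set_integrable_def
    by (simp add: not_integrable_integral_eq)
qed

lemma set_integral_bounded_linear: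
  assumes "bounded_linear T" "set_integrable M A f"
  shows "set_integrable M A (\<lambda>x. T (f x))"
    and "(LINT x:A|M. T (f x)) = T (LINT x:A|M. f x)"
proof -
  interpret bounded_linear T by fact
  have *: "(\<lambda>x. indicator A x *\<^sub>R T (f x)) = (\<lambda>x. T (indicator A x *\<^sub>R f x))"
    by (auto simp: scaleR)
  show "set_integrable M A (\<lambda>x. T (f x))"
    using integrable_bounded_linear[OF assms(1)] assms(2)
    unfolding set_integrable_def * by blast
  show "(LINT x:A|M. T (f x)) = T (LINT x:A|M. f x)"
    using integral_bounded_linear[OF assms(1)] assms(2)
    unfolding set_integrable_def set_lebesgue_integral_def * by blast
qed

text \<open>The mean value inequality for \<open>f - L\<close>. With \<open>L\<close> a derivative
  frozen at one point it bounds a Taylor remainder; with \<open>L\<close> zero it is a Lipschitz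
  bound.\<close>

lemma strict_linear_approximation:
  fixes f :: "'x::real_normed_vector \<Rightarrow> 'y::real_normed_vector"
  assumes "convex B" "y \<in> B" "z \<in> B" "0 \<le> e"
    and der: "\<And>w. w \<in> B \<Longrightarrow> (f has_derivative f' w) (at w)"
    and L: "bounded_linear L"
    and le: "\<And>w h. w \<in> B \<Longrightarrow> norm (f' w h - L h) \<le> e * norm h"
  shows "norm (f y - f z - L (y - z)) \<le> e * norm (y - z)"
proof -
  interpret L: bounded_linear L by fact
  have "norm ((f y - L y) - (f z - L z)) \<le> e * norm (y - z)"
  proof (rule differentiable_bound[OF assms(1) _ _ assms(2,3), where f'="\<lambda>w h. f' w h - L h"])
    show "((\<lambda>w. f w - L w) has_derivative (\<lambda>h. f' w h - L h)) (at w within B)" if "w \<in> B" for w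
      using der[OF that, THEN has_derivative_at_withinI] bounded_linear_imp_has_derivative[OF L]
      by (intro derivative_intros)
    show "onorm (\<lambda>h. f' w h - L h) \<le> e" if "w \<in> B" for w
      using le[OF that] \<open>0 \<le> e\<close> by (intro onorm_bound)
  qed
  then show ?thesis by (simp add: L.diff algebra_simps)
qed

text \<open>Since \<open>q\<close> is only integrable, \<open>p\<close> need not be differentiable
  at a given time. The proof instead shows that the defect of the formula, which is additive over
  intervals, is at most \<open>e\<close> times the integral of \<open>norm (q s)\<close>. On a short
  interval the derivative is frozen at one time; half of \<open>e\<close> pays for the increment of
  \<open>f\<close>, half for the integrand. The continuity hypothesis is operator norm continuity
  phrased for plain functions.\<close>

lemma primitive_of_compose:
  fixes p :: "real \<Rightarrow> 'x::{banach, second_countable_topology}"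
    and f :: "'x \<Rightarrow> 'y::{banach, second_countable_topology}"
  assumes p: "primitive_of p q"
    and S: "open S" and pS: "\<And>s. p s \<in> S"
    and der: "\<And>x. x \<in> S \<Longrightarrow> (f has_derivative f' x) (at x)"
    and cont: "\<And>x e. x \<in> S \<Longrightarrow> e > 0 \<Longrightarrow>
      \<exists>d>0. \<forall>y\<in>S. dist y x < d \<longrightarrow> (\<forall>h. norm (f' y h - f' x h) \<le> e * norm h)"
  shows "primitive_of (\<lambda>s. f (p s)) (\<lambda>s. f' (p s) (q s))"
proof -
  note pc = primitive_ofD(1)[OF p] and qm [measurable] = primitive_ofD(2)[OF p]
    and qi = primitive_ofD(3)[OF p] and qint = primitive_ofD(4)[OF p]
  have bl: "bounded_linear (f' (p s))" for s
    using der[OF pS] has_derivative_bounded_linear by blast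
  have fpc: "continuous_on UNIV (\<lambda>s. f (p s))"
    using continuous_on_compose2[of S f UNIV p] pc pS der
    by (meson has_derivative_continuous_on has_derivative_at_withinI image_subsetI)
  have loc: "\<exists>d>0. \<forall>s. \<bar>s - x\<bar> < d \<longrightarrow> p s \<in> ball (p x) r" if "r > 0" for x r
    using pc that unfolding continuous_on_iff mem_ball dist_real_def by (metis UNIV_I dist_commute)
  have close: "\<exists>d>0. \<forall>s. \<bar>s - x\<bar> < d \<longrightarrow> (\<forall>h. norm (f' (p s) h - f' (p x) h) \<le> e * norm h)"
    if e: "e > 0" for x e
  proof -
    obtain d where d: "d > 0"
      "\<And>y h. y \<in> S \<Longrightarrow> dist y (p x) < d \<Longrightarrow> norm (f' y h - f' (p x) h) \<le> e * norm h"
      using cont[OF pS e] by metis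
    obtain d' where "d' > 0" "\<And>s. \<bar>s - x\<bar> < d' \<Longrightarrow> p s \<in> ball (p x) d"
      using loc[OF d(1)] by metis
    then show ?thesis using d pS by (intro exI[of _ d']) (auto simp: dist_commute)
  qed
  \<comment> \<open>Joint continuity is what makes \<open>f' (p s) (q s)\<close> measurable in
    \<open>s\<close> for a \<open>q\<close> that is merely measurable.\<close>
  have "continuous_on UNIV (\<lambda>(s, h). f' (p s) h)"
    unfolding continuous_on_def
  proof
    fix z0 :: "real \<times> 'x"
    obtain s0 h0 where z0: "z0 = (s0, h0)" by (cases z0)
    have 1: "((\<lambda>(s, h). f' (p s) h - f' (p s0) h) \<longlongrightarrow> 0) (at (s0, h0))"
    proof (rule tendstoI)
      fix e :: real assume e: "e > 0"
      \<comment> \<open>Vectors \<open>h\<close> within distance 1 of \<open>h0\<close> have norm at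
        most \<open>norm h0 + 1\<close>, so the error \<open>c * norm h\<close> is at most
        \<open>e / 2\<close>.\<close>
      define c where "c = e / 2 / (norm h0 + 1)"
      have c: "c > 0" using e by (auto simp: c_def add_nonneg_pos)
      obtain d where d: "d > 0"
        "\<And>s h. \<bar>s - s0\<bar> < d \<Longrightarrow> norm (f' (p s) h - f' (p s0) h) \<le> c * norm h"
        using close[OF c] by metis
      have "\<forall>\<^sub>F z in at (s0, h0). dist z (s0, h0) < min d 1"
        unfolding eventually_at using d(1) by (intro exI[of _ "min d 1"]) auto
      then show "\<forall>\<^sub>F z in at (s0, h0). dist (case z of (s, h) \<Rightarrow> f' (p s) h - f' (p s0) h) 0 < e"
      proof eventually_elim
        case (elim z)
        obtain s h where z: "z = (s, h)" by (cases z)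
        have 1: "\<bar>s - s0\<bar> < d" "norm (h - h0) < 1"
          using elim dist_fst_le[of z "(s0, h0)"] dist_snd_le[of z "(s0, h0)"]
          by (auto simp: z dist_norm)
        have "norm h \<le> norm h0 + 1"
          using 1(2) norm_triangle_ineq2[of h h0] by linarith
        then have "c * norm h \<le> c * (norm h0 + 1)"
          using c by (intro mult_left_mono) auto
        also have "\<dots> = e / 2" using add_nonneg_pos[OF norm_ge_zero[of h0] zero_less_one] unfolding c_def by (metis less_irrefl nonzero_eq_divide_eq)
        finally show ?case using d(2)[OF 1(1), of h] e by (auto simp: z)
      qed
    qed
    have 2: "((\<lambda>z. f' (p s0) (snd z)) \<longlongrightarrow> f' (p s0) h0) (at (s0, h0))"
      by (intro bounded_linear.tendsto[OF bl] tendsto_eq_intros) auto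
    show "((\<lambda>(s, h). f' (p s) h) \<longlongrightarrow> (case z0 of (s, h) \<Rightarrow> f' (p s) h)) (at z0)"
      using tendsto_add[OF 1 2] by (simp add: case_prod_unfold z0)
  qed
  then have [measurable]: "(\<lambda>(s, h). f' (p s) h) \<in> borel_measurable borel"
    by (rule borel_measurable_continuous_onI)
  have "(\<lambda>s. (\<lambda>(s, h). f' (p s) h) (s, q s)) \<in> borel_measurable borel"
    by measurable
  then have meas [measurable]: "(\<lambda>s. f' (p s) (q s)) \<in> borel_measurable borel" by simp
  have int: "set_integrable lborel {a..b} (\<lambda>s. f' (p s) (q s))" for a b
  proof (cases "a \<le> b")
    case True
    \<comment> \<open>A bound on the operators that is uniform over the compact interval, obtained
      by bisection from local bounds; it reduces integrability to that of \<open>q\<close>.\<close>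
    then have "\<exists>K. \<forall>s\<in>{a..b}. \<forall>h. norm (f' (p s) h) \<le> K * norm h"
    proof (induction rule: Bolzano)
      case (trans a b c)
      then obtain K L where KL: "\<forall>s\<in>{a..b}. \<forall>h. norm (f' (p s) h) \<le> K * norm h"
        "\<forall>s\<in>{b..c}. \<forall>h. norm (f' (p s) h) \<le> L * norm h" by auto
      show ?case
      proof (intro exI ballI allI)
        fix s h assume "s \<in> {a..c}"
        then consider "s \<in> {a..b}" | "s \<in> {b..c}" by fastforce
        then show "norm (f' (p s) h) \<le> max K L * norm h"
          using KL by cases (meson max.cobounded1 max.cobounded2 mult_right_mono norm_ge_zero order_trans)+
      qed
    next
      case (local x)
      obtain K where K: "\<And>h. norm (f' (p x) h) \<le> norm h * K"
        using bounded_linear.bounded[OF bl] by blast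
      obtain d where d: "d > 0"
        "\<And>s h. \<bar>s - x\<bar> < d \<Longrightarrow> norm (f' (p s) h - f' (p x) h) \<le> 1 * norm h"
        using close[of 1 x] by auto
      have "norm (f' (p s) h) \<le> (K + 1) * norm h" if "\<bar>s - x\<bar> < d" for s h
        using d(2)[OF that, of h] K[of h] norm_triangle_ineq2[of "f' (p s) h" "f' (p x) h"]
        by (simp add: algebra_simps)
      then have "\<forall>s\<in>{u..w}. \<forall>h. norm (f' (p s) h) \<le> (K + 1) * norm h"
        if "u \<le> x \<and> x \<le> w \<and> w - u < d" for u w
        using that by auto
      then show ?case using d(1) by blast
    qed
    then obtain K where K: "\<And>s h. s \<in> {a..b} \<Longrightarrow> norm (f' (p s) h) \<le> K * norm h" by blast
    show ?thesis
      by (rule set_integrable_bound[of _ _ "\<lambda>s. K * norm (q s)"])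
        (use K qi[of a b, THEN set_integrable_norm] in
          \<open>auto simp: set_borel_measurable_def intro: order_trans[OF _ abs_ge_self]\<close>)
  qed simp
  have "f (p b) - f (p a) = (LINT s:{a..b}|lborel. f' (p s) (q s))" if ab: "a \<le> b" for a b
  proof -
    \<comment> \<open>Both the defect \<open>E\<close> and its majorant \<open>N\<close> are
      additive over adjacent intervals, so the inequality between them passes from short intervals
      to \<open>{a..b}\<close> by bisection.\<close>
    define E where "E c d = f (p d) - f (p c) - (LINT s:{c..d}|lborel. f' (p s) (q s))" for c d
    define N where "N c d = (LINT s:{c..d}|lborel. norm (q s))" for c d
    have "norm (E a b) \<le> e * N a b" if e: "e > 0" for e
      using ab
    proof (induction rule: Bolzano)
      case (trans a b c)
      have "E a c = E a b + E b c"
        unfolding E_def using set_integral_Icc_combine[OF int trans(3,4)] by simp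
      moreover have "N a c = N a b + N b c"
        unfolding N_def using set_integral_Icc_combine[OF qi[THEN set_integrable_norm] trans(3,4)] .
      ultimately show ?case
        using trans(1,2) norm_triangle_ineq[of "E a b" "E b c"] by (simp add: algebra_simps)
    next
      case (local x)
      let ?L = "f' (p x)"
      interpret L: bounded_linear ?L by (rule bl)
      have e2: "e / 2 > 0" using e by simp
      obtain r1 where r1: "r1 > 0" "ball (p x) r1 \<subseteq> S"
        using S pS openE by blast
      obtain r2 where r2: "r2 > 0"
        "\<And>y h. y \<in> S \<Longrightarrow> dist y (p x) < r2 \<Longrightarrow> norm (f' y h - ?L h) \<le> e / 2 * norm h"
        using cont[OF pS e2] by metis
      define r where "r = min r1 r2"
      have r: "r > 0" "ball (p x) r \<subseteq> S"
        "\<And>y h. y \<in> ball (p x) r \<Longrightarrow> norm (f' y h - ?L h) \<le> e / 2 * norm h"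
        using r1 r2 by (auto simp: r_def subset_iff dist_commute)
      obtain d where d: "d > 0" "\<And>s. \<bar>s - x\<bar> < d \<Longrightarrow> p s \<in> ball (p x) r"
        using loc[OF r(1)] by metis
      have "norm (E u v) \<le> e * N u v" if uv: "u \<le> x" "x \<le> v" "v - u < d" for u v
      proof -
        have in_ball: "p s \<in> ball (p x) r" if "s \<in> {u..v}" for s
          using that uv by (intro d(2)) auto
        have uv': "u \<le> v" using uv by simp
        have Lq: "set_integrable lborel {u..v} (\<lambda>s. ?L (q s))"
          and Lint: "?L (p v - p u) = (LINT s:{u..v}|lborel. ?L (q s))"
          using set_integral_bounded_linear[OF bl qi] qint[OF uv'] by auto
        have "norm (f (p v) - f (p u) - ?L (p v - p u)) \<le> e / 2 * norm (p v - p u)"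
          by (rule strict_linear_approximation[where B="ball (p x) r" and f'=f'])
            (use in_ball uv' r der bl e in auto)
        moreover have "norm (p v - p u) \<le> N u v"
          unfolding N_def qint[OF uv']
          by (rule norm_set_integral_le) (use qi[THEN set_integrable_norm] in auto)
        ultimately have 1: "norm (f (p v) - f (p u) - ?L (p v - p u)) \<le> e / 2 * N u v"
          using e2 by (meson mult_left_mono less_imp_le order_trans)
        have 2: "norm (LINT s:{u..v}|lborel. ?L (q s) - f' (p s) (q s)) \<le>
          (LINT s:{u..v}|lborel. e / 2 * norm (q s))"
          by (rule norm_set_integral_le)
            (use r(3)[OF in_ball] qi[THEN set_integrable_norm] in \<open>auto simp: norm_minus_commute\<close>)
        have "E u v = (f (p v) - f (p u) - ?L (p v - p u)) +
          (LINT s:{u..v}|lborel. ?L (q s) - f' (p s) (q s))"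
          unfolding set_integral_diff(2)[OF Lq int] Lint[symmetric] E_def by (simp only: diff_add_cancel diff_diff_eq2 add_diff_eq)
        also have "norm \<dots> \<le> e / 2 * N u v + (LINT s:{u..v}|lborel. e / 2 * norm (q s))"
          using 1 2 by (rule norm_triangle_mono)
        also have "\<dots> = e * N u v"
          unfolding N_def set_integral_mult_right by simp
        finally have "norm (E u v) \<le> e * N u v" .
        then show ?thesis by simp
      qed
      then show ?case using d(1) by blast
    qed
    moreover have "((\<lambda>e. e * N a b) \<longlongrightarrow> 0 * N a b) (at_right 0)"
      by (intro tendsto_intros)
    ultimately have "norm (E a b) \<le> 0"
      by (intro tendsto_lowerbound[of "\<lambda>e. e * N a b" 0 "at_right 0"])
        (auto simp: eventually_at_filter)
    then show ?thesis by (simp add: E_def)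
  qed
  then show ?thesis
    using fpc meas int by (auto simp: primitive_of_def)
qed

section \<open>Primitives and weak derivatives\<close>

lemma set_integral_eq_integral:
  assumes "\<And>s. s \<notin> A \<Longrightarrow> g s = 0"
  shows "(LINT s:A|M. g s) = (LINT s|M. g s)"
  unfolding set_lebesgue_integral_def
  by (rule Bochner_Integration.integral_cong) (use assms in \<open>auto simp: indicator_def\<close>)

lemma integrable_compact_support:
  fixes g :: "real \<Rightarrow> 'x::{banach, second_countable_topology}"
  assumes "continuous_on UNIV g" "\<And>s. s \<notin> {a..b} \<Longrightarrow> g s = 0"
  shows "integrable lborel g"
proof -
  have "integrable lborel (\<lambda>s. indicator {a..b} s *\<^sub>R g s)"
    by (rule borel_integrable_compact) (use assms(1) continuous_on_subset in auto)
  moreover have "(\<lambda>s. indicator {a..b} s *\<^sub>R g s) = g"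
    using assms(2) by (force simp: indicator_def)
  ultimately show ?thesis by simp
qed

lemma primitive_of_C1:
  assumes "\<And>s. (\<psi> has_real_derivative \<psi>' s) (at s)" "continuous_on UNIV \<psi>'"
  shows "primitive_of \<psi> \<psi>'"
  unfolding primitive_of_def
proof (intro conjI allI impI)
  show "continuous_on UNIV \<psi>"
    by (rule DERIV_continuous_on) (use assms in auto)
  show "\<psi>' \<in> borel_measurable borel"
    by (rule borel_measurable_continuous_onI[OF assms(2)])
  fix a b :: real assume ab: "a \<le> b"
  have c: "continuous_on {a..b} \<psi>'" using assms(2) continuous_on_subset by blast
  show "set_integrable lborel {a..b} \<psi>'"
    by (rule borel_integrable_atLeastAtMost'[OF c])
  show "\<psi> b - \<psi> a = (LINT s:{a..b}|lborel. \<psi>' s)"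
    unfolding set_lebesgue_integral_def
    by (rule integral_FTC_atLeastAtMost[OF ab _ c, symmetric])
      (use assms(1) in \<open>auto simp flip: has_real_derivative_iff_has_vector_derivative
        intro: has_field_derivative_at_within\<close>)
qed

lemma primitive_of_bounded_linear:
  assumes "bounded_linear T" "primitive_of p q"
  shows "primitive_of (\<lambda>s. T (p s)) (\<lambda>s. T (q s))"
proof (rule primitive_of_compose[OF assms(2), of UNIV T "\<lambda>_. T"])
  show "(T has_derivative T) (at x)" for x
    using assms(1) by (rule bounded_linear_imp_has_derivative)
qed (auto intro: exI[of _ 1])

lemma primitive_of_add:
  assumes "primitive_of p q" "primitive_of p' q'"
  shows "primitive_of (\<lambda>s. p s + p' s) (\<lambda>s. q s + q' s)"
  unfolding primitive_of_def
proof (intro conjI allI impI)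
  note [measurable] = assms[THEN primitive_ofD(2)]
  note i = assms[THEN primitive_ofD(3)]
  show "continuous_on UNIV (\<lambda>s. p s + p' s)"
    using assms[THEN primitive_ofD(1)] by (intro continuous_intros)
  show "(\<lambda>s. q s + q' s) \<in> borel_measurable borel" by measurable
  fix a b :: real assume "a \<le> b"
  show "set_integrable lborel {a..b} (\<lambda>s. q s + q' s)"
    using set_integral_add(1)[OF i] .
  show "p b + p' b - (p a + p' a) = (LINT s:{a..b}|lborel. q s + q' s)"
    unfolding set_integral_add(2)[OF i] assms[THEN primitive_ofD(4), OF \<open>a \<le> b\<close>, symmetric]
    by (simp only: add_diff_add)
qed

lemma primitive_of_Pair:
  assumes "primitive_of p q" "primitive_of p' q'"
  shows "primitive_of (\<lambda>s. (p s, p' s)) (\<lambda>s. (q s, q' s))"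
proof -
  have "bounded_linear (\<lambda>h. (h, 0))" "bounded_linear (\<lambda>h. (0, h))"
    by (intro bounded_linear_Pair bounded_linear_ident bounded_linear_zero)+
  from primitive_of_add[OF primitive_of_bounded_linear[OF this(1) assms(1)]
      primitive_of_bounded_linear[OF this(2) assms(2)]]
  show ?thesis by simp
qed

lemma norm_component_le:
  "norm (fst z) \<le> norm z" "norm (snd z) \<le> norm z"
  by (cases z; simp add: norm_fst_le norm_snd_le)+

text \<open>The product rule is the chain rule for scalar multiplication, applied to the pair of
  paths. The derivative varies in two terms, each bounded by \<open>norm (y - x) * norm h\<close>,
  whence the radius \<open>e / 2\<close>.\<close>

lemma primitive_of_scaleR:
  assumes "primitive_of \<psi> \<psi>'" "primitive_of \<xi> v"
  shows "primitive_of (\<lambda>s. \<psi> s *\<^sub>R \<xi> s) (\<lambda>s. \<psi> s *\<^sub>R v s + \<psi>' s *\<^sub>R \<xi> s)"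
proof -
  have "primitive_of (\<lambda>s. fst (\<psi> s, \<xi> s) *\<^sub>R snd (\<psi> s, \<xi> s))
    (\<lambda>s. (\<lambda>x h. fst x *\<^sub>R snd h + fst h *\<^sub>R snd x) (\<psi> s, \<xi> s) (\<psi>' s, v s))"
  proof (rule primitive_of_compose[OF primitive_of_Pair[OF assms], of UNIV])
    show "((\<lambda>x. fst x *\<^sub>R snd x) has_derivative (\<lambda>h. fst x *\<^sub>R snd h + fst h *\<^sub>R snd x)) (at x)"
      for x :: "real \<times> 'a"
      by (auto intro!: derivative_eq_intros)
    fix x :: "real \<times> 'a" and e :: real assume e: "e > 0"
    have "norm (fst y *\<^sub>R snd h + fst h *\<^sub>R snd y - (fst x *\<^sub>R snd h + fst h *\<^sub>R snd x)) \<le> e * norm h"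
      if "dist y x < e / 2" for y h
    proof -
      have "fst y *\<^sub>R snd h + fst h *\<^sub>R snd y - (fst x *\<^sub>R snd h + fst h *\<^sub>R snd x)
          = fst (y - x) *\<^sub>R snd h + fst h *\<^sub>R snd (y - x)"
        by (simp add: algebra_simps)
      also have "norm \<dots> \<le> norm (fst (y - x)) * norm (snd h) + norm (fst h) * norm (snd (y - x))"
        by (rule norm_triangle_le) simp
      also have "\<dots> \<le> norm (y - x) * norm h + norm h * norm (y - x)"
        by (intro add_mono mult_mono norm_component_le) auto
      also have "\<dots> \<le> e * norm h"
        using mult_right_mono[of "norm (y - x)" "e / 2" "norm h"] that by (simp add: dist_norm mult.commute)
      finally show ?thesis .
    qed
    then show "\<exists>d>0. \<forall>y\<in>UNIV. dist y x < d \<longrightarrow> (\<forall>h. norm (fst y *\<^sub>R snd h + fst h *\<^sub>R snd y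
        - (fst x *\<^sub>R snd h + fst h *\<^sub>R snd x)) \<le> e * norm h)"
      using e by (intro exI[of _ "e / 2"]) auto
  qed auto
  then show ?thesis by simp
qed

text \<open>Integration by parts: the product with a test function is a primitive, and over an
  interval containing the support its boundary values vanish.\<close>

lemma primitive_imp_weak_derivative:
  assumes "primitive_of \<xi> v"
  shows "weak_derivative \<xi> v"
  unfolding weak_derivative_def
proof (intro allI impI)
  fix \<psi> assume \<psi>: "test_function \<psi>"
  have d: "((deriv ^^ n) \<psi>) differentiable (at s)" for n s
    using \<psi> by (auto simp: test_function_def differentiable_on_def)
  have D: "(\<psi> has_real_derivative deriv \<psi> s) (at s)" for s
    using d[of 0 s] by (simp add: DERIV_deriv_iff_real_differentiable)
  have "continuous_on UNIV (deriv \<psi>)"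
    using d[of 1] by (auto intro!: differentiable_imp_continuous_on simp: differentiable_on_def)
  then have pr: "primitive_of \<psi> (deriv \<psi>)" and dc: "continuous_on UNIV (deriv \<psi>)"
    using primitive_of_C1 D by auto
  have "bounded {s. \<psi> s \<noteq> 0}"
    by (rule bounded_subset[OF compact_imp_bounded closure_subset])
      (use \<psi> in \<open>simp add: test_function_def\<close>)
  then obtain R where R: "R > 0" "\<And>s. \<psi> s \<noteq> 0 \<Longrightarrow> \<bar>s\<bar> \<le> R"
    unfolding bounded_pos by (auto simp: real_norm_def)
  have z: "\<psi> s = 0" if "\<bar>s\<bar> > R" for s using R(2)[of s] that by force
  have dz: "deriv \<psi> s = 0" if "\<bar>s\<bar> > R" for s
  proof -
    have op: "open {s::real. \<bar>s\<bar> > R}"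
      by (intro open_Collect_less continuous_intros)
    have "(\<psi> has_real_derivative 0) (at s)"
      by (rule has_field_derivative_transform_within_open[OF DERIV_const op])
        (use that z in simp_all)
    then show ?thesis by (rule DERIV_imp_deriv)
  qed
  \<comment> \<open>One unit beyond the support bound \<open>R\<close>, because the test function is
    known to vanish only where the absolute value strictly exceeds \<open>R\<close>, and it must
    vanish at both end points.\<close>
  define I where "I = {-(R+1)..R+1}"
  note prod = primitive_of_scaleR[OF pr assms]
  have sub: "\<bar>s\<bar> > R" if "s \<notin> I" for s using that by (auto simp: I_def)
  have "0 = (LINT s:I|lborel. \<psi> s *\<^sub>R v s + deriv \<psi> s *\<^sub>R \<xi> s)"
    using primitive_ofD(4)[OF prod, of "-(R+1)" "R+1"] z R(1) by (simp add: I_def)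
  moreover have i1: "set_integrable lborel I (\<lambda>s. deriv \<psi> s *\<^sub>R \<xi> s)"
    unfolding I_def using dc primitive_ofD(1)[OF assms]
    by (intro borel_integrable_atLeastAtMost' continuous_intros) (auto intro: continuous_on_subset)
  moreover have "set_integrable lborel I (\<lambda>s. \<psi> s *\<^sub>R v s)"
    using set_integral_diff(1)[OF primitive_ofD(3)[OF prod] i1[unfolded I_def]] by (simp add: I_def)
  ultimately have "(LINT s:I|lborel. \<psi> s *\<^sub>R v s) + (LINT s:I|lborel. deriv \<psi> s *\<^sub>R \<xi> s) = 0"
    by (simp add: set_integral_add)
  then show "(LINT s|lborel. deriv \<psi> s *\<^sub>R \<xi> s) = - (LINT s|lborel. \<psi> s *\<^sub>R v s)"
    by (subst (asm) (1 2) set_integral_eq_integral) (auto simp: z dz sub add_eq_0_iff)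
qed

lemma square_integrable_set_integrable:
  fixes v :: "real \<Rightarrow> 'x::{banach, second_countable_topology}"
  assumes "square_integrable v"
  shows "set_integrable lborel {a..b} v"
proof (rule set_integrable_bound)
  have [measurable]: "v \<in> borel_measurable borel" using assms by (simp add: square_integrable_def)
  have "integrable lborel (\<lambda>s. indicator {a..b} s *\<^sub>R (norm (v s))\<^sup>2)"
    using assms by (intro integrable_mult_indicator) (auto simp: square_integrable_def)
  then show "set_integrable lborel {a..b} (\<lambda>s. 1 + (norm (v s))\<^sup>2)"
    by (intro set_integral_add(1)[OF borel_integrable_atLeastAtMost'[OF continuous_on_const]])
      (simp add: set_integrable_def)
  show "set_borel_measurable lborel {a..b} v" unfolding set_borel_measurable_def by measurable
  have "x \<le> 1 + x\<^sup>2" for x :: real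
    using zero_le_power2[of "x - 1/2"] by (simp add: power2_eq_square algebra_simps)
  then show "AE x in lborel. x \<in> {a..b} \<longrightarrow> norm (v x) \<le> norm (1 + (norm (v x))\<^sup>2)"
    by (intro AE_I2 impI) (metis abs_ge_self order_trans real_norm_def)
qed

lemma smooth_step_deriv:
  shows "(smooth_step has_real_derivative deriv smooth_step x) (at x)"
    and "continuous_on UNIV (deriv smooth_step)"
    and "x \<notin> {0..1} \<Longrightarrow> deriv smooth_step x = 0"
proof -
  show *: "(smooth_step has_real_derivative deriv smooth_step x) (at x)" for x
    by (rule smooth_uptoD[OF smooth_upto_smooth_step[of 0]])
  show "continuous_on UNIV (deriv smooth_step)"
    using smooth_upto_smooth_step[of 1, unfolded One_nat_def smooth_upto_Suc]
    by (auto intro: differentiable_imp_continuous_on simp: smooth_upto_0)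
  assume "x \<notin> {0..1}"
  then consider "x \<in> {..<0}" | "x \<in> {1<..}" by fastforce
  then have "(smooth_step has_real_derivative 0) (at x)"
  proof cases
    case 1
    show ?thesis
      by (rule has_field_derivative_transform_within_open[of "\<lambda>_. 0" _ _ "{..<0}"])
        (use 1 smooth_step_0 in auto)
  next
    case 2
    show ?thesis
      by (rule has_field_derivative_transform_within_open[of "\<lambda>_. 1" _ _ "{1<..}"])
        (use 2 smooth_step_1 in auto)
  qed
  then show "deriv smooth_step x = 0" by (rule DERIV_imp_deriv)
qed

text \<open>The rescaled derivatives of the step form a one-sided approximate identity at
  \<open>a\<close>: they live on shrinking intervals to the right of \<open>a\<close> and have total
  mass 1. After substitution the scale sits inside \<open>\<xi>\<close>, and dominated convergence
  applies.\<close>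

lemma smooth_step_mollifies:
  fixes \<xi> :: "real \<Rightarrow> 'x::{banach, second_countable_topology}"
  assumes "continuous_on UNIV \<xi>"
  shows "(\<lambda>n. LINT x|lborel. (real (Suc n) * deriv smooth_step (real (Suc n) * (x - a))) *\<^sub>R \<xi> x)
    \<longlonglongrightarrow> \<xi> a"
proof -
  let ?R = "deriv smooth_step"
  have [measurable]: "\<xi> \<in> borel_measurable borel" "?R \<in> borel_measurable borel"
    using assms smooth_step_deriv(2) by (auto intro: borel_measurable_continuous_onI)
  have aff: "(LINT x|lborel. (N * ?R (N * (x - a))) *\<^sub>R \<xi> x) =
    (LINT y|lborel. ?R y *\<^sub>R \<xi> (a + 1 / N * y))" if N: "N > 0" for N
  proof -
    have "(LINT x|lborel. (N * ?R (N * (x - a))) *\<^sub>R \<xi> x) =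
      \<bar>1 / N\<bar> *\<^sub>R (LINT y|lborel. (N * ?R (N * ((a + 1 / N * y) - a))) *\<^sub>R \<xi> (a + 1 / N * y))"
      by (rule lborel_integral_real_affine) (use N in simp)
    also have "(\<lambda>y. (N * ?R (N * ((a + 1 / N * y) - a))) *\<^sub>R \<xi> (a + 1 / N * y)) =
      (\<lambda>y. N *\<^sub>R (?R y *\<^sub>R \<xi> (a + 1 / N * y)))"
      using N by auto
    also have "\<bar>1 / N\<bar> *\<^sub>R (LINT y|lborel. N *\<^sub>R (?R y *\<^sub>R \<xi> (a + 1 / N * y))) =
      (LINT y|lborel. ?R y *\<^sub>R \<xi> (a + 1 / N * y))"
      unfolding integral_scaleR_right using N by (simp only: scaleR_scaleR) simp
    finally show ?thesis .
  qed
  have "(LINT x|lborel. (real (Suc n) * ?R (real (Suc n) * (x - a))) *\<^sub>R \<xi> x) =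
    (LINT y|lborel. ?R y *\<^sub>R \<xi> (a + 1 / real (Suc n) * y))" for n
    by (rule aff) simp
  moreover have "(\<lambda>n. LINT y|lborel. ?R y *\<^sub>R \<xi> (a + 1 / real (Suc n) * y)) \<longlonglongrightarrow>
    (LINT y|lborel. ?R y *\<^sub>R \<xi> a)"
  proof -
    have "compact (?R ` {0..1})" "compact (\<xi> ` {a..a+1})"
      using continuous_on_subset[OF assms] continuous_on_subset[OF smooth_step_deriv(2)]
      by (simp_all add: compact_continuous_image)
    then obtain A B where A: "\<And>y. y \<in> {0..1} \<Longrightarrow> \<bar>?R y\<bar> \<le> A"
      and B: "\<And>x. x \<in> {a..a+1} \<Longrightarrow> norm (\<xi> x) \<le> B"
      by (metis bounded_iff compact_imp_bounded imageI real_norm_def)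
    show ?thesis
    proof (rule integral_dominated_convergence[where w="\<lambda>y. indicator {0..1} y *\<^sub>R (A * B)"])
      show "integrable lborel (\<lambda>y. indicator {0..1::real} y *\<^sub>R (A * B))" by simp
      show "AE y in lborel. norm (?R y *\<^sub>R \<xi> (a + 1 / real (Suc n) * y)) \<le> indicator {0..1} y *\<^sub>R (A * B)" for n
      proof (rule AE_I2)
        fix y :: real
        show "norm (?R y *\<^sub>R \<xi> (a + 1 / real (Suc n) * y)) \<le> indicator {0..1} y *\<^sub>R (A * B)"
        proof (cases "y \<in> {0..1}")
          case True
          then have "a + 1 / real (Suc n) * y \<in> {a..a+1}"
            using mult_mono[of "1 / real (Suc n)" 1 y 1] by simp
          then show ?thesis
            using A[OF True] B mult_mono[OF A[OF True] B, of "a + 1 / real (Suc n) * y"] True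
              order_trans[OF abs_ge_zero A[OF True]] by simp
        qed (simp add: smooth_step_deriv(3))
      qed
      show "AE y in lborel. (\<lambda>n. ?R y *\<^sub>R \<xi> (a + 1 / real (Suc n) * y)) \<longlonglongrightarrow> ?R y *\<^sub>R \<xi> a"
      proof (rule AE_I2)
        fix y :: real
        have "(\<lambda>n. 1 / real (Suc n)) \<longlonglongrightarrow> 0"
          using LIMSEQ_inverse_real_of_nat by (simp add: inverse_eq_divide)
        then have "(\<lambda>n. a + 1 / real (Suc n) * y) \<longlonglongrightarrow> a + 0 * y" by (intro tendsto_intros)
        then have "(\<lambda>n. \<xi> (a + 1 / real (Suc n) * y)) \<longlonglongrightarrow> \<xi> a"
          using continuous_on_tendsto_compose[OF assms] by auto
        then show "(\<lambda>n. ?R y *\<^sub>R \<xi> (a + 1 / real (Suc n) * y)) \<longlonglongrightarrow> ?R y *\<^sub>R \<xi> a"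
          by (intro tendsto_intros)
      qed
    qed measurable
  qed
  \<comment> \<open>The mass is the total rise of \<open>smooth_step\<close>, from 0 to 1.\<close>
  moreover have "(LINT y|lborel. ?R y) = 1"
    using primitive_ofD(4)[OF primitive_of_C1[OF smooth_step_deriv(1,2)], of 0 1]
      set_integral_eq_integral[of "{0..1}" ?R lborel] smooth_step_deriv(3)
    by (simp add: smooth_step_0 smooth_step_1)
  moreover have "integrable lborel ?R"
    using smooth_step_deriv(2,3) by (rule integrable_compact_support[where a=0 and b=1])
  ultimately show ?thesis by simp
qed

text \<open>Test against a smooth step up at \<open>a\<close> followed by a step down at
  \<open>b\<close>, both increasingly steep. The test functions tend to the indicator of the
  interval, while their derivatives mollify at \<open>a\<close> and, with the opposite sign, at
  \<open>b\<close>; the limit of the weak identity is the fundamental theorem.\<close>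

lemma weak_derivative_imp_primitive:
  fixes \<xi> :: "real \<Rightarrow> 'x::{banach, second_countable_topology}"
  assumes c: "continuous_on UNIV \<xi>" and v: "square_integrable v" and w: "weak_derivative \<xi> v"
  shows "primitive_of \<xi> v"
proof -
  let ?R = "smooth_step"
  have [measurable]: "v \<in> borel_measurable borel" using v by (simp add: square_integrable_def)
  have "continuous_on UNIV ?R"
    using smooth_step_deriv(1) by (auto intro: DERIV_continuous_on)
  then have [measurable]: "?R \<in> borel_measurable borel"
    by (rule borel_measurable_continuous_onI)
  have main: "\<xi> b - \<xi> a = (LINT s:{a..b}|lborel. v s)" if ab: "a < b" for a b
  proof -
    define \<psi> where "\<psi> n x = ?R (real (Suc n) * (x - a)) - ?R (real (Suc n) * (x - b))" for n x
    have sm: "smooth_upto k (\<psi> n)" for k n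
    proof -
      have "smooth_upto k (\<lambda>x. ?R (real (Suc n) * x + - real (Suc n) * a)
        + (-1) * ?R (real (Suc n) * x + - real (Suc n) * b))"
        by (intro smooth_upto_add smooth_upto_mult smooth_upto_const smooth_upto_affine
          smooth_upto_smooth_step)
      moreover have "(\<lambda>x. ?R (real (Suc n) * x + - real (Suc n) * a)
        + (-1) * ?R (real (Suc n) * x + - real (Suc n) * b)) = \<psi> n"
        unfolding \<psi>_def fun_eq_iff right_diff_distrib by (simp del: of_nat_Suc)
      ultimately show ?thesis by simp
    qed
    have [measurable]: "\<psi> n \<in> borel_measurable lborel" "v \<in> borel_measurable lborel" for n
      unfolding \<psi>_def[abs_def] by simp_all
    \<comment> \<open>The step at \<open>b\<close> has width at most 1, so \<open>b + 1\<close>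
      bounds the supports for all \<open>n\<close> at once and gives one dominating
      function.\<close>
    have supp: "\<psi> n x = 0" if "x \<notin> {a..b+1}" for n x
    proof (cases "x < a")
      case True
      then show ?thesis using ab by (simp add: \<psi>_def smooth_step_0 mult_nonneg_nonpos)
    next
      case False
      then have "1 \<le> real (Suc n) * (x - b)" "1 \<le> real (Suc n) * (x - a)"
        using that ab mult_mono[of 1 "real (Suc n)" 1 "x - b"] mult_mono[of 1 "real (Suc n)" 1 "x - a"]
        by simp_all
      then show ?thesis by (simp add: \<psi>_def smooth_step_1)
    qed
    have "test_function (\<psi> n)" for n
      unfolding test_function_def
    proof
      show "\<forall>k. (deriv ^^ k) (\<psi> n) differentiable_on UNIV"
        using sm[of _ n] by (auto simp: smooth_upto_def)
      have "closure {s. \<psi> n s \<noteq> 0} \<subseteq> {a..b+1}"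
        using supp by (intro closure_minimal subsetI) (blast, simp)
      then show "compact (closure {s. \<psi> n s \<noteq> 0})"
        by (metis closed_closure compact_Icc compact_Int_closed inf.absorb_iff2)
    qed
    then have eq: "(LINT s|lborel. deriv (\<psi> n) s *\<^sub>R \<xi> s) = - (LINT s|lborel. \<psi> n s *\<^sub>R v s)" for n
      using w by (simp add: weak_derivative_def)
    have der: "deriv (\<psi> n) x = real (Suc n) * deriv ?R (real (Suc n) * (x - a))
        - real (Suc n) * deriv ?R (real (Suc n) * (x - b))" for n x
      unfolding \<psi>_def
      by (rule DERIV_imp_deriv)
        (auto intro!: derivative_eq_intros DERIV_chain2[OF smooth_step_deriv(1)] simp del: of_nat_Suc)
    have int: "integrable lborel (\<lambda>x. (real (Suc n) * deriv ?R (real (Suc n) * (x - a))) *\<^sub>R \<xi> x)" for n a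
    proof (rule integrable_compact_support[where a=a and b="a+1"])
      show "continuous_on UNIV (\<lambda>x. (real (Suc n) * deriv ?R (real (Suc n) * (x - a))) *\<^sub>R \<xi> x)"
        by (intro continuous_intros c continuous_on_compose2[OF smooth_step_deriv(2)]) auto
      fix x assume x: "x \<notin> {a..a+1}"
      have "real (Suc n) * (x - a) \<notin> {0..1}"
      proof (cases "x < a")
        case True
        then show ?thesis by (simp add: mult_pos_neg not_le)
      next
        case False
        then have "1 < x - a" using x by auto
        then have "1 * 1 < real (Suc n) * (x - a)" by (intro mult_le_less_imp_less) auto
        then show ?thesis by simp
      qed
      then show "(real (Suc n) * deriv ?R (real (Suc n) * (x - a))) *\<^sub>R \<xi> x = 0"
        by (simp add: smooth_step_deriv(3))
    qed
    have "(\<lambda>n. LINT s|lborel. deriv (\<psi> n) s *\<^sub>R \<xi> s) \<longlonglongrightarrow> \<xi> a - \<xi> b"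
      using tendsto_diff[OF smooth_step_mollifies[OF c, of a] smooth_step_mollifies[OF c, of b]]
      unfolding der scaleR_left_diff_distrib Bochner_Integration.integral_diff[OF int int] .
    moreover have "(\<lambda>n. LINT s|lborel. \<psi> n s *\<^sub>R v s) \<longlonglongrightarrow> (LINT s|lborel. indicator {a..b} s *\<^sub>R v s)"
    proof (rule integral_dominated_convergence[where w="\<lambda>s. indicator {a..b+1} s *\<^sub>R norm (v s)"])
      show "integrable lborel (\<lambda>s. indicator {a..b+1} s *\<^sub>R norm (v s))"
        using set_integrable_norm[OF square_integrable_set_integrable[OF v]]
        by (simp add: set_integrable_def)
      have "\<bar>\<psi> n s\<bar> \<le> 1" for n s
        using smooth_step_bounds[of "real (Suc n) * (s - a)"] smooth_step_bounds[of "real (Suc n) * (s - b)"]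
        unfolding \<psi>_def by linarith
      then show "AE s in lborel. norm (\<psi> n s *\<^sub>R v s) \<le> indicator {a..b+1} s *\<^sub>R norm (v s)" for n
        by (intro AE_I2) (auto simp: indicator_def supp mult_left_le_one_le)
      have ev: "\<forall>\<^sub>F n in sequentially. ?R (real (Suc n) * y) = 1" if "y > 0" for y
      proof -
        obtain N where "inverse y < real N" using reals_Archimedean2 by blast
        then have "1 \<le> real (Suc n) * y" if "n \<ge> N" for n
          using \<open>y > 0\<close> that by (simp add: field_simps) (smt (verit) mult_left_mono of_nat_le_iff)
        then show ?thesis unfolding eventually_sequentially using smooth_step_1 by blast
      qed
      have z: "?R (real (Suc n) * y) = 0" if "y \<le> 0" for y n
        using that by (simp add: smooth_step_0 mult_nonneg_nonpos)
      \<comment> \<open>At \<open>s = a\<close> every test function is 0, so the pointwise limit is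
        the indicator of the interval without its left end point. The single exceptional point is
        discarded as a null set.\<close>
      show "AE s in lborel. (\<lambda>n. \<psi> n s *\<^sub>R v s) \<longlonglongrightarrow> indicator {a..b} s *\<^sub>R v s"
      proof (rule AE_mp[OF AE_lborel_singleton[of a]], intro AE_I2 impI)
        fix s assume "s \<noteq> a"
        consider "s < a" | "a < s" "s \<le> b" | "b < s" using \<open>s \<noteq> a\<close> by linarith
        then have "\<forall>\<^sub>F n in sequentially. \<psi> n s = indicator {a..b} s"
        proof cases
          case 1
          then show ?thesis using z[of "s - a"] z[of "s - b"] ab by (simp add: \<psi>_def)
        next
          case 2
          then show ?thesis using ev[of "s - a"] z[of "s - b"]
            by (simp add: \<psi>_def)
        next
          case 3
          have "\<forall>\<^sub>F n in sequentially. ?R (real (Suc n) * (s - a)) = 1 \<and> ?R (real (Suc n) * (s - b)) = 1"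
            using 3 ab by (intro eventually_conj ev) auto
          then show ?thesis by eventually_elim (use 3 in \<open>simp add: \<psi>_def\<close>)
        qed
        then show "(\<lambda>n. \<psi> n s *\<^sub>R v s) \<longlonglongrightarrow> indicator {a..b} s *\<^sub>R v s"
          by (intro tendsto_eventually) (auto elim: eventually_mono)
      qed
    qed measurable
    ultimately have "\<xi> a - \<xi> b = - (LINT s|lborel. indicator {a..b} s *\<^sub>R v s)"
      unfolding eq using tendsto_minus LIMSEQ_unique by blast
    then show ?thesis by (simp add: set_lebesgue_integral_def algebra_simps)
  qed
  have "\<xi> b - \<xi> a = (LINT s:{a..b}|lborel. v s)" if "a \<le> b" for a b
  proof (cases "a = b")
    case True
    have "(LINT s:{a..a}|lborel. v s) = 0"
      unfolding set_lebesgue_integral_def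
      by (rule integral_eq_zero_AE, rule AE_mp[OF AE_lborel_singleton[of a]]) simp
    then show ?thesis using True by simp
  qed (use main that in auto)
  then show ?thesis
    using c square_integrable_set_integrable[OF v] by (auto simp: primitive_of_def)
qed

section \<open>The path space\<close>

text \<open>Closed intervals generate the Borel sets, so vanishing of the integrals spreads from
  intervals to all Borel sets, and a density with this property is zero almost everywhere. Cutting
  down to \<open>{- real n..real n}\<close> makes the function integrable; its total integral 0
  handles complements.\<close>

lemma AE_zero_of_interval_integrals:
  fixes u :: "real \<Rightarrow> 'x::{banach, second_countable_topology}"
  assumes int: "\<And>a b. set_integrable lborel {a..b} u"
    and zero: "\<And>a b. a \<le> b \<Longrightarrow> (LINT s:{a..b}|lborel. u s) = 0"
  shows "AE s in lborel. u s = 0"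
proof -
  have "AE s in lborel. indicator {- real n..real n} s *\<^sub>R u s = 0" for n
  proof (rule sigma_finite_measure.density_zero[OF sigma_finite_lborel])
    define g where "g s = indicator {- real n..real n} s *\<^sub>R u s" for s
    show gi: "integrable lborel (\<lambda>s. indicator {- real n..real n} s *\<^sub>R u s)"
      using int by (simp add: set_integrable_def)
    then have g: "integrable lborel g" by (simp add: g_def[abs_def])
    have si: "set_integrable lborel A g" if "A \<in> sets borel" for A
      using that g unfolding set_integrable_def by (intro integrable_mult_indicator) auto
    have tot: "integral\<^sup>L lborel g = 0"
      using zero[of "- real n" "real n"] by (simp add: g_def[abs_def] set_lebesgue_integral_def)
    fix A :: "real set" assume "A \<in> sets lborel"
    then have "A \<in> sets borel" by simp
    then have "(LINT s:A|lborel. g s) = 0"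
    proof (induction rule: borel_set_induct)
      case empty
      show ?case by (simp add: set_lebesgue_integral_def)
    next
      case (interval a b)
      let ?a = "max a (- real n)" and ?b = "min b (real n)"
      have "(LINT s:{a..b}|lborel. g s) = (LINT s:{?a..?b}|lborel. u s)"
        unfolding set_lebesgue_integral_def g_def
        by (rule Bochner_Integration.integral_cong) (auto simp: indicator_def)
      also have "\<dots> = 0"
      proof (cases "?a \<le> ?b")
        case False
        then have "{?a..?b} = {}" by simp
        then show ?thesis by (simp only: set_lebesgue_integral_def) simp
      qed (rule zero)
      finally show ?case .
    next
      case (compl A)
      have "(LINT s:(A \<union> - A)|lborel. g s) = (LINT s:A|lborel. g s) + (LINT s:-A|lborel. g s)"
        using compl by (intro set_integral_Un si) auto
      moreover have "(LINT s:(A \<union> - A)|lborel. g s) = integral\<^sup>L lborel g"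
        by (simp add: set_lebesgue_integral_def)
      ultimately show ?case using compl tot by simp
    next
      case (union f)
      have "(LINT s:(\<Union>i. f i)|lborel. g s) = (\<Sum>i. LINT s:f i|lborel. g s)"
        using union by (intro lebesgue_integral_countable_add si)
          (auto simp: disjoint_family_on_def)
      then show ?case using union by simp
    qed
    then show "(LINT s:A|lborel. indicator {- real n..real n} s *\<^sub>R u s) = 0"
      by (simp add: g_def)
  qed
  then have "AE s in lborel. \<forall>n. indicator {- real n..real n} s *\<^sub>R u s = 0"
    by (subst AE_all_countable) blast
  then show ?thesis
  proof (rule AE_mp, intro AE_I2 impI)
    fix s :: real assume *: "\<forall>n. indicator {- real n..real n} s *\<^sub>R u s = 0"
    obtain n where "\<bar>s\<bar> \<le> real n" using real_arch_simple by blast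
    then show "u s = 0" using *[rule_format, of n] by (auto simp: indicator_def split: if_splits)
  qed
qed

lemma primitive_of_unique:
  assumes "primitive_of \<xi> v" "primitive_of \<xi> w"
  shows "AE s in lborel. v s = w s"
proof -
  note i = assms[THEN primitive_ofD(3)]
  have "AE s in lborel. v s - w s = 0"
  proof (rule AE_zero_of_interval_integrals)
    show "set_integrable lborel {a..b} (\<lambda>s. v s - w s)" for a b
      by (rule set_integral_diff(1)[OF i])
    show "(LINT s:{a..b}|lborel. v s - w s) = 0" if "a \<le> b" for a b
      unfolding set_integral_diff(2)[OF i] using assms[THEN primitive_ofD(4), OF that] by simp
  qed
  then show ?thesis by simp
qed

lemma square_integrable_bound:
  fixes f :: "real \<Rightarrow> 'x::{banach, second_countable_topology}"
  assumes "f \<in> borel_measurable borel" "integrable lborel G"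
    and "AE s in lborel. (norm (f s))\<^sup>2 \<le> G s"
  shows "square_integrable f"
  unfolding square_integrable_def
proof
  have [measurable]: "f \<in> borel_measurable borel" by fact
  show "f \<in> borel_measurable lborel" by simp
  show "integrable lborel (\<lambda>s. (norm (f s))\<^sup>2)"
    by (rule Bochner_Integration.integrable_bound[OF assms(2)])
      (use assms(3) in \<open>auto elim!: eventually_mono\<close>)
qed

lemma power2_norm_add_le:
  "(norm (x + y :: 'x::real_normed_vector))\<^sup>2 \<le> 2 * (norm x)\<^sup>2 + 2 * (norm y)\<^sup>2"
proof -
  have "(norm (x + y))\<^sup>2 \<le> (norm x + norm y)\<^sup>2" by (intro power_mono norm_triangle_ineq) simp
  also have "\<dots> \<le> 2 * (norm x)\<^sup>2 + 2 * (norm y)\<^sup>2"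
    using zero_le_power2[of "norm x - norm y"] by (simp add: power2_eq_square algebra_simps)
  finally show ?thesis .
qed

lemma square_integrable_add:
  fixes f g :: "real \<Rightarrow> 'x::{banach, second_countable_topology}"
  assumes "square_integrable f" "square_integrable g"
  shows "square_integrable (\<lambda>s. f s + g s)"
  by (rule square_integrable_bound[where G="\<lambda>s. 2 * (norm (f s))\<^sup>2 + 2 * (norm (g s))\<^sup>2"])
    (use assms power2_norm_add_le in \<open>auto simp: square_integrable_def\<close>)

lemma square_integrable_scaleR:
  fixes f :: "real \<Rightarrow> 'x::{banach, second_countable_topology}"
  assumes "square_integrable f"
  shows "square_integrable (\<lambda>s. c *\<^sub>R f s)"
  by (rule square_integrable_bound[where G="\<lambda>s. c\<^sup>2 * (norm (f s))\<^sup>2"])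
    (use assms in \<open>auto simp: square_integrable_def power_mult_distrib\<close>)

text \<open>Membership in the path space with the derivative \<open>v\<close> and the H2-valued
  version \<open>f\<close> exhibited. Estimates can then be made on concrete representatives instead
  of the choices behind \<open>wderiv\<close> and \<open>H2_version\<close>.\<close>

definition is_path ::
    "('b::{banach, second_countable_topology} \<Rightarrow> 'a::{banach, second_countable_topology})
      \<Rightarrow> (real \<Rightarrow> 'a) \<Rightarrow> (real \<Rightarrow> 'a) \<Rightarrow> (real \<Rightarrow> 'b) \<Rightarrow> bool" where
  "is_path \<iota> \<xi> v f \<longleftrightarrow> primitive_of \<xi> v \<and> square_integrable v \<and> square_integrable f \<and>
     (AE s in lborel. \<iota> (f s) = \<xi> s)"

locale contractive_inclusion =
  fixes \<iota> :: "'b::{real_inner, banach, second_countable_topology}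
                \<Rightarrow> 'a::{real_inner, banach, second_countable_topology}"
  assumes bounded_linear_incl: "bounded_linear \<iota>"
    and inj_incl: "inj \<iota>"
    and norm_incl_le: "norm (\<iota> x) \<le> norm x"
begin

sublocale incl: bounded_linear \<iota> by (rule bounded_linear_incl)

abbreviation "pnorm \<equiv> path_norm \<iota>"

lemma is_path_square_integrable:
  assumes "is_path \<iota> \<xi> v f"
  shows "AE s in lborel. norm (\<xi> s) \<le> norm (f s)" "square_integrable \<xi>"
proof -
  have "AE s in lborel. \<iota> (f s) = \<xi> s" using assms by (simp add: is_path_def)
  then show *: "AE s in lborel. norm (\<xi> s) \<le> norm (f s)"
    by eventually_elim (metis norm_incl_le)
  have "continuous_on UNIV \<xi>" using assms by (auto simp: is_path_def dest: primitive_ofD)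
  then show "square_integrable \<xi>"
    by (intro square_integrable_bound[where G="\<lambda>s. (norm (f s))\<^sup>2"] borel_measurable_continuous_onI)
      (use assms * in \<open>auto simp: is_path_def square_integrable_def elim!: eventually_mono\<close>)
qed

lemma path_space_iff: "\<xi> \<in> path_space \<iota> \<longleftrightarrow> (\<exists>v f. is_path \<iota> \<xi> v f)"
proof
  assume "\<xi> \<in> path_space \<iota>"
  then obtain v f where "continuous_on UNIV \<xi>" "square_integrable v" "weak_derivative \<xi> v" "L2_lift \<iota> \<xi> f"
    by (auto simp: path_space_def W12_def)
  then show "\<exists>v f. is_path \<iota> \<xi> v f"
    using weak_derivative_imp_primitive by (auto simp: is_path_def L2_lift_def)
next
  assume "\<exists>v f. is_path \<iota> \<xi> v f"
  then obtain v f where p: "is_path \<iota> \<xi> v f" by blast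
  then show "\<xi> \<in> path_space \<iota>"
    using is_path_square_integrable(2)[OF p] primitive_imp_weak_derivative
    by (auto simp: path_space_def W12_def L2_lift_def is_path_def dest: primitive_ofD)
qed

text \<open>The chosen representatives agree almost everywhere with the exhibited ones: the
  derivatives by uniqueness of the density of a primitive, the H2 versions by injectivity of the
  inclusion.\<close>

lemma path_norm_eq:
  assumes p: "is_path \<iota> \<xi> v f"
  shows "pnorm \<xi> = sqrt ((LINT s|lborel. (norm (v s))\<^sup>2) + (LINT s|lborel. (norm (f s))\<^sup>2))"
proof -
  have "square_integrable v \<and> weak_derivative \<xi> v"
    using p primitive_imp_weak_derivative by (auto simp: is_path_def)
  then have w: "square_integrable (wderiv \<xi>) \<and> weak_derivative \<xi> (wderiv \<xi>)"
    unfolding wderiv_def by (rule someI[of "\<lambda>v. square_integrable v \<and> weak_derivative \<xi> v"])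
  have "primitive_of \<xi> (wderiv \<xi>)"
    using p w by (intro weak_derivative_imp_primitive) (auto simp: is_path_def dest: primitive_ofD)
  then have vw: "AE s in lborel. v s = wderiv \<xi> s"
    using p by (intro primitive_of_unique) (auto simp: is_path_def)
  have "L2_lift \<iota> \<xi> f" using p by (simp add: is_path_def L2_lift_def)
  then have h: "L2_lift \<iota> \<xi> (H2_version \<iota> \<xi>)"
    unfolding H2_version_def by (rule someI[of "L2_lift \<iota> \<xi>"])
  have "AE s in lborel. \<iota> (f s) = \<xi> s" "AE s in lborel. \<iota> (H2_version \<iota> \<xi> s) = \<xi> s"
    using p h by (auto simp: is_path_def L2_lift_def)
  then have fh: "AE s in lborel. f s = H2_version \<iota> \<xi> s"
    by eventually_elim (metis inj_incl injD)
  have [measurable]: "v \<in> borel_measurable lborel" "f \<in> borel_measurable lborel"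
    "wderiv \<xi> \<in> borel_measurable lborel" "H2_version \<iota> \<xi> \<in> borel_measurable lborel"
    using p w h by (auto simp: is_path_def L2_lift_def square_integrable_def)
  have "(LINT s|lborel. wderiv \<xi> s \<bullet> wderiv \<xi> s) = (LINT s|lborel. (norm (v s))\<^sup>2)"
    by (rule integral_cong_AE) (use vw in \<open>auto elim!: eventually_mono simp: power2_norm_eq_inner\<close>)
  moreover have "(LINT s|lborel. H2_version \<iota> \<xi> s \<bullet> H2_version \<iota> \<xi> s) = (LINT s|lborel. (norm (f s))\<^sup>2)"
    by (rule integral_cong_AE) (use fh in \<open>auto elim!: eventually_mono simp: power2_norm_eq_inner\<close>)
  ultimately show ?thesis by (simp add: path_norm_def path_inner_def)
qed

lemma path_norm_bounds:
  assumes "is_path \<iota> \<xi> v f"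
  shows "0 \<le> pnorm \<xi>"
    and "(LINT s|lborel. (norm (v s))\<^sup>2) \<le> (pnorm \<xi>)\<^sup>2"
    and "(LINT s|lborel. (norm (f s))\<^sup>2) \<le> (pnorm \<xi>)\<^sup>2"
proof -
  have "0 \<le> (LINT s|lborel. (norm (v s))\<^sup>2)" "0 \<le> (LINT s|lborel. (norm (f s))\<^sup>2)"
    by (auto intro!: integral_nonneg_AE)
  then show "0 \<le> pnorm \<xi>"
    "(LINT s|lborel. (norm (v s))\<^sup>2) \<le> (pnorm \<xi>)\<^sup>2"
    "(LINT s|lborel. (norm (f s))\<^sup>2) \<le> (pnorm \<xi>)\<^sup>2"
    unfolding path_norm_eq[OF assms] by auto
qed

lemma path_norm_le:
  assumes p: "is_path \<iota> \<xi> v f" and G: "integrable lborel G"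
    and le: "AE s in lborel. (norm (v s))\<^sup>2 + (norm (f s))\<^sup>2 \<le> G s"
    and M: "integral\<^sup>L lborel G \<le> M\<^sup>2" "0 \<le> M"
  shows "pnorm \<xi> \<le> M"
proof -
  have i: "integrable lborel (\<lambda>s. (norm (v s))\<^sup>2)" "integrable lborel (\<lambda>s. (norm (f s))\<^sup>2)"
    using p by (auto simp: is_path_def square_integrable_def)
  have "(LINT s|lborel. (norm (v s))\<^sup>2) + (LINT s|lborel. (norm (f s))\<^sup>2)
      = (LINT s|lborel. (norm (v s))\<^sup>2 + (norm (f s))\<^sup>2)"
    using i by simp
  also have "\<dots> \<le> integral\<^sup>L lborel G"
    using i by (intro integral_mono_AE G le) auto
  also have "\<dots> \<le> M\<^sup>2" by fact
  finally show ?thesis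
    unfolding path_norm_eq[OF p] using M(2) by (simp add: real_le_lsqrt)
qed

lemma is_path_add:
  assumes "is_path \<iota> \<xi> v f" "is_path \<iota> \<eta> w g"
  shows "is_path \<iota> (\<lambda>s. \<xi> s + \<eta> s) (\<lambda>s. v s + w s) (\<lambda>s. f s + g s)"
proof -
  have "AE s in lborel. \<iota> (f s) = \<xi> s" "AE s in lborel. \<iota> (g s) = \<eta> s"
    using assms by (auto simp: is_path_def)
  then have "AE s in lborel. \<iota> (f s + g s) = \<xi> s + \<eta> s"
    by eventually_elim (simp add: incl.add)
  then show ?thesis
    using assms by (auto simp: is_path_def intro: primitive_of_add square_integrable_add)
qed

lemma is_path_scaleR:
  assumes "is_path \<iota> \<xi> v f"
  shows "is_path \<iota> (\<lambda>s. c *\<^sub>R \<xi> s) (\<lambda>s. c *\<^sub>R v s) (\<lambda>s. c *\<^sub>R f s)"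
proof -
  have "AE s in lborel. \<iota> (f s) = \<xi> s" using assms by (auto simp: is_path_def)
  then have "AE s in lborel. \<iota> (c *\<^sub>R f s) = c *\<^sub>R \<xi> s"
    by eventually_elim (simp add: incl.scaleR)
  then show ?thesis
    using assms by (auto simp: is_path_def intro: square_integrable_scaleR
      primitive_of_bounded_linear[OF bounded_linear_scaleR_right])
qed

lemma is_path_diff:
  assumes "is_path \<iota> \<xi> v f" "is_path \<iota> \<eta> w g"
  shows "is_path \<iota> (\<lambda>s. \<xi> s - \<eta> s) (\<lambda>s. v s - w s) (\<lambda>s. f s - g s)"
  using is_path_add[OF assms(1) is_path_scaleR[OF assms(2), of "-1"]] by simp

text \<open>Comparing \<open>\<xi> s\<close> with \<open>\<xi> a\<close> and averaging over \<open>a\<close> in the unit interval starting at \<open>s\<close>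
  controls \<open>\<xi> s\<close> by local \<open>L\<^sup>2\<close>-norms.\<close>

lemma is_path_pointwise:
  assumes p: "is_path \<iota> \<xi> v f"
  shows "(norm (\<xi> s))\<^sup>2 \<le> (LINT t:{s..s+1}|lborel. 2 * (norm (f t))\<^sup>2 + (norm (v t))\<^sup>2)"
proof -
  define n where "n t = (norm (\<xi> t))\<^sup>2" for t
  define e where "e t = (norm (\<xi> t))\<^sup>2 + (norm (v t))\<^sup>2" for t
  have pr: "primitive_of \<xi> v" using p by (simp add: is_path_def)
  have sq: "integrable lborel (\<lambda>s. (norm (v s))\<^sup>2)" "integrable lborel (\<lambda>s. (norm (f s))\<^sup>2)"
    "integrable lborel n"
    using p is_path_square_integrable(2)[OF p] by (auto simp: is_path_def square_integrable_def n_def[abs_def])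
  have e: "integrable lborel e"
    using sq by (simp add: e_def[abs_def] n_def[abs_def])
  have si: "set_integrable lborel {a..b} g" if "integrable lborel g" for a b and g :: "real \<Rightarrow> real"
    using that unfolding set_integrable_def by (intro integrable_mult_indicator) auto
  have prn: "primitive_of n (\<lambda>t. 2 * (\<xi> t \<bullet> v t))"
  proof -
    have "primitive_of (\<lambda>t. \<xi> t \<bullet> \<xi> t) (\<lambda>t. (\<lambda>x h. 2 * (x \<bullet> h)) (\<xi> t) (v t))"
    proof (rule primitive_of_compose[OF pr, of UNIV "\<lambda>x. x \<bullet> x"])
      show "((\<lambda>x. x \<bullet> x) has_derivative (\<lambda>h. 2 * (x \<bullet> h))) (at x)" for x :: 'a
        by (auto intro!: derivative_eq_intros simp: inner_commute)
      fix x :: 'a and r :: real assume r: "r > 0"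
      have "norm (2 * (y \<bullet> h) - 2 * (x \<bullet> h)) \<le> r * norm h" if "dist y x < r / 2" for y h
      proof -
        have "2 * (y \<bullet> h) - 2 * (x \<bullet> h) = 2 * ((y - x) \<bullet> h)"
          by (simp add: inner_diff_left)
        then have "norm (2 * (y \<bullet> h) - 2 * (x \<bullet> h)) = 2 * \<bar>(y - x) \<bullet> h\<bar>"
          by (simp add: abs_mult)
        also have "\<dots> \<le> 2 * (norm (y - x) * norm h)"
          by (intro mult_left_mono Cauchy_Schwarz_ineq2) simp
        also have "\<dots> \<le> r * norm h"
          using mult_right_mono[of "norm (y - x)" "r / 2" "norm h"] that by (simp add: dist_norm)
        finally show ?thesis .
      qed
      then show "\<exists>d>0. \<forall>y\<in>UNIV. dist y x < d \<longrightarrow>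
          (\<forall>h. norm (2 * (y \<bullet> h) - 2 * (x \<bullet> h)) \<le> r * norm h)"
        using r by (intro exI[of _ "r / 2"]) auto
    qed auto
    then show ?thesis by (simp add: n_def[abs_def] power2_norm_eq_inner)
  qed
  define E where "E = (LINT t:{s..s+1}|lborel. e t)"
  have e_nn: "0 \<le> e t" for t by (simp add: e_def)
  have n_le: "n s \<le> n a + E" if a: "a \<in> {s..s+1}" for a
  proof -
    have "n a - n s = (LINT t:{s..a}|lborel. 2 * (\<xi> t \<bullet> v t))"
      using primitive_ofD(4)[OF prn] a by auto
    moreover have "norm (LINT t:{s..a}|lborel. 2 * (\<xi> t \<bullet> v t)) \<le> (LINT t:{s..a}|lborel. e t)"
    proof (rule norm_set_integral_le[OF si[OF e]])
      fix t
      have "norm (2 * (\<xi> t \<bullet> v t)) \<le> 2 * (norm (\<xi> t) * norm (v t))"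
        using Cauchy_Schwarz_ineq2[of "\<xi> t" "v t"] by (simp add: abs_mult)
      also have "\<dots> \<le> e t"
        using zero_le_power2[of "norm (\<xi> t) - norm (v t)"]
        by (simp add: e_def power2_eq_square algebra_simps)
      finally show "norm (2 * (\<xi> t \<bullet> v t)) \<le> e t" .
    qed
    moreover have "(LINT t:{s..a}|lborel. e t) \<le> E"
      unfolding E_def set_lebesgue_integral_def
      by (rule integral_mono) (use si[OF e] a e_nn in \<open>auto simp: set_integrable_def indicator_def\<close>)
    ultimately show ?thesis by (simp add: abs_le_iff)
  qed
  have const: "(LINT a:{s..s+1}|lborel. c) = c" for c :: real
    by (simp add: set_lebesgue_integral_def)
  have ci: "set_integrable lborel {s..s+1} (\<lambda>_. c)" for c :: real
    by (rule borel_integrable_atLeastAtMost'[OF continuous_on_const])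
  have "n s = (LINT a:{s..s+1}|lborel. n s)" by (simp add: const)
  also have "\<dots> \<le> (LINT a:{s..s+1}|lborel. n a + E)"
    using n_le by (intro set_integral_mono set_integral_add(1)[OF si[OF sq(3)] ci] ci)
  also have "\<dots> = (LINT a:{s..s+1}|lborel. n a) + E"
    by (simp add: set_integral_add(2)[OF si[OF sq(3)] ci] const)
  also have "\<dots> = (LINT t:{s..s+1}|lborel. n t + e t)"
    unfolding E_def by (rule set_integral_add(2)[OF si[OF sq(3)] si[OF e], symmetric])
  also have "\<dots> \<le> (LINT t:{s..s+1}|lborel. 2 * (norm (f t))\<^sup>2 + (norm (v t))\<^sup>2)"
  proof (rule set_integral_mono_AE)
    show "set_integrable lborel {s..s+1} (\<lambda>t. n t + e t)"
      "set_integrable lborel {s..s+1} (\<lambda>t. 2 * (norm (f t))\<^sup>2 + (norm (v t))\<^sup>2)"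
      using sq e by (auto intro!: si)
    show "AE t \<in> {s..s+1} in lborel. n t + e t \<le> 2 * (norm (f t))\<^sup>2 + (norm (v t))\<^sup>2"
      using is_path_square_integrable(1)[OF p]
    proof eventually_elim
      case (elim t)
      then have "(norm (\<xi> t))\<^sup>2 \<le> (norm (f t))\<^sup>2" by (intro power_mono) auto
      then show ?case by (simp add: n_def e_def)
    qed
  qed
  finally show ?thesis by (simp add: n_def)
qed

text \<open>The Sobolev bound through which the H1 sup norm of an increment becomes small. The local
  estimate yields three times the squared norm, rounded up to four to have the constant 2.\<close>

lemma is_path_sup_le:
  assumes p: "is_path \<iota> \<xi> v f"
  shows "norm (\<xi> s) \<le> 2 * pnorm \<xi>"
proof -
  let ?g = "\<lambda>t. 2 * (norm (f t))\<^sup>2 + (norm (v t))\<^sup>2"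
  have sq: "integrable lborel (\<lambda>s. (norm (v s))\<^sup>2)" "integrable lborel (\<lambda>s. (norm (f s))\<^sup>2)"
    using p by (auto simp: is_path_def square_integrable_def)
  have "(norm (\<xi> s))\<^sup>2 \<le> (LINT t:{s..s+1}|lborel. ?g t)" by (rule is_path_pointwise[OF p])
  also have "\<dots> \<le> (LINT t|lborel. ?g t)"
    unfolding set_lebesgue_integral_def
  proof (rule integral_mono)
    show g: "integrable lborel ?g" using sq by simp
    show "integrable lborel (\<lambda>t. indicat_real {s..s+1} t *\<^sub>R ?g t)"
      using g by (intro integrable_mult_indicator) simp_all
  qed (simp add: indicator_def)
  also have "\<dots> = 2 * (LINT t|lborel. (norm (f t))\<^sup>2) + (LINT t|lborel. (norm (v t))\<^sup>2)"
    using sq by simp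
  also have "\<dots> \<le> 2 * (pnorm \<xi>)\<^sup>2 + (pnorm \<xi>)\<^sup>2"
    using path_norm_bounds(2,3)[OF p] by simp
  also have "\<dots> \<le> (2 * pnorm \<xi>)\<^sup>2" by (simp add: power_mult_distrib)
  finally show ?thesis
    by (rule power2_le_imp_le) (use path_norm_bounds(1)[OF p] in simp)
qed

text \<open>The value at \<open>s\<close> is controlled by an integral over a unit interval, hence
  by the tail of a fixed integrable function, and tails tend to 0 by dominated convergence.\<close>

lemma is_path_vanishes_at_infinity:
  assumes p: "is_path \<iota> \<xi> v f" and r: "r > 0"
  shows "\<exists>S>0. \<forall>s. S \<le> \<bar>s\<bar> \<longrightarrow> norm (\<xi> s) < r"
proof -
  let ?g = "\<lambda>t. 2 * (norm (f t))\<^sup>2 + (norm (v t))\<^sup>2"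
  have g: "integrable lborel ?g"
    using p by (auto simp: is_path_def square_integrable_def)
  then have [measurable]: "?g \<in> borel_measurable lborel" by auto
  have "(\<lambda>n. LINT t|lborel. indicator {t. real n \<le> \<bar>t\<bar>} t * ?g t) \<longlonglongrightarrow> integral\<^sup>L lborel (\<lambda>t::real. 0::real)"
  proof (rule integral_dominated_convergence[where w="?g"])
    show "AE t in lborel. (\<lambda>n. indicator {t. real n \<le> \<bar>t\<bar>} t * ?g t) \<longlonglongrightarrow> (0::real)"
    proof (rule AE_I2)
      fix t :: real
      have "\<forall>\<^sub>F n in sequentially. \<bar>t\<bar> < real n"
        using filterlim_real_sequentially by (auto simp: filterlim_at_top_dense)
      then have "\<forall>\<^sub>F n in sequentially. indicator {t. real n \<le> \<bar>t\<bar>} t * ?g t = (0::real)"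
        by eventually_elim (simp add: indicator_def)
      then show "(\<lambda>n. indicator {t. real n \<le> \<bar>t\<bar>} t * ?g t) \<longlonglongrightarrow> (0::real)"
        by (rule tendsto_eventually)
    qed
  qed (use g in \<open>auto simp: indicator_def\<close>)
  then have "\<forall>\<^sub>F n in sequentially. (LINT t|lborel. indicator {t. real n \<le> \<bar>t\<bar>} t * ?g t) < r\<^sup>2"
    using r by (intro order_tendstoD(2)) auto
  then obtain n where n: "(LINT t|lborel. indicator {t. real n \<le> \<bar>t\<bar>} t * ?g t) < r\<^sup>2"
    by (auto simp: eventually_sequentially)
  \<comment> \<open>The extra 1 keeps all of \<open>{s..s+1}\<close> in the tail: for negative
    \<open>s\<close> the interval reaches back towards 0.\<close>
  have "norm (\<xi> s) < r" if s: "real n + 1 \<le> \<bar>s\<bar>" for s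
  proof -
    have "(norm (\<xi> s))\<^sup>2 \<le> (LINT t:{s..s+1}|lborel. ?g t)" by (rule is_path_pointwise[OF p])
    also have "\<dots> \<le> (LINT t|lborel. indicator {t. real n \<le> \<bar>t\<bar>} t * ?g t)"
      unfolding set_lebesgue_integral_def
    proof (rule integral_mono)
      show "integrable lborel (\<lambda>t. indicat_real {s..s+1} t *\<^sub>R ?g t)"
        using g by (intro integrable_mult_indicator) auto
      show "integrable lborel (\<lambda>t. indicat_real {t. real n \<le> \<bar>t\<bar>} t * ?g t)"
        using integrable_mult_indicator[of "{t. real n \<le> \<bar>t\<bar>}" lborel ?g] g by auto
      show "indicat_real {s..s+1} t *\<^sub>R ?g t \<le> indicat_real {t. real n \<le> \<bar>t\<bar>} t * ?g t" for t
        using s by (auto simp: indicator_def)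
    qed
    also note n
    finally show ?thesis by (rule power2_less_imp_less) (use r in simp)
  qed
  then show ?thesis by (intro exI[of _ "real n + 1"]) auto
qed

end

section \<open>First and second derivatives\<close>

lemma blinfun_apply_fderiv:
  assumes "(f has_derivative f') (at x)"
  shows "blinfun_apply (fderiv f x) = f'"
  unfolding fderiv_def frechet_derivative_at[OF assms, symmetric]
  using has_derivative_bounded_linear[OF assms] by (rule bounded_linear_Blinfun_apply)

lemma fderiv_eqI: "(f has_derivative blinfun_apply A) (at x) \<Longrightarrow> fderiv f x = A"
  by (rule blinfun_eqI) (simp add: blinfun_apply_fderiv)

lemma C1_onD:
  assumes "C1_on S f" "x \<in> S"
  shows "(f has_derivative blinfun_apply (fderiv f x)) (at x)"
proof -
  obtain f' where "(f has_derivative f') (at x)"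
    using assms by (auto simp: C1_on_def differentiable_def)
  then show ?thesis using blinfun_apply_fderiv by metis
qed

lemma C1_on_fderiv_near:
  assumes "C1_on S f" "open S" "x \<in> S" "e > 0"
  shows "\<exists>r>0. ball x r \<subseteq> S \<and> (\<forall>y\<in>ball x r. norm (fderiv f y - fderiv f x) < e)"
proof -
  have "isCont (fderiv f) x"
    using assms by (auto simp: C1_on_def continuous_on_eq_continuous_at)
  then obtain r1 where r1: "r1 > 0" "\<And>y. dist y x < r1 \<Longrightarrow> norm (fderiv f y - fderiv f x) < e"
    using assms(4) unfolding continuous_at_eps_delta by (metis dist_norm)
  obtain r2 where r2: "r2 > 0" "ball x r2 \<subseteq> S"
    using assms openE by metis
  show ?thesis
    using r1 r2 by (intro exI[of _ "min r1 r2"]) (auto simp: dist_commute subset_iff)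
qed

text \<open>The derivative is bounded only in the direction \<open>y - z\<close>, not in operator
  norm. Tame bounds involve both norms of that direction, and this form preserves them.\<close>

lemma norm_diff_le_segment:
  fixes f :: "'x::real_normed_vector \<Rightarrow> 'y::real_normed_vector"
  assumes der: "\<And>w. w \<in> closed_segment z y \<Longrightarrow> (f has_derivative f' w) (at w)"
    and le: "\<And>w. w \<in> closed_segment z y \<Longrightarrow> norm (f' w (y - z)) \<le> M"
  shows "norm (f y - f z) \<le> M"
proof -
  let ?g = "\<lambda>r. z + r *\<^sub>R (y - z)"
  have seg: "?g r \<in> closed_segment z y" if "r \<in> {0..1}" for r
    using that by (auto simp: closed_segment_def algebra_simps intro!: exI[of _ r])
  have M: "0 \<le> M" using le[of z] norm_ge_zero order_trans by blast
  have "norm (f (?g 1) - f (?g 0)) \<le> M * norm (1 - 0 :: real)"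
  proof (rule differentiable_bound[where f="\<lambda>r. f (?g r)" and f'="\<lambda>r h. f' (?g r) (h *\<^sub>R (y - z))" and S="{0..1}"])
    fix r :: real assume r: "r \<in> {0..1}"
    have bl: "bounded_linear (f' (?g r))"
      using der[OF seg[OF r]] by (rule has_derivative_bounded_linear)
    have "(?g has_derivative (\<lambda>h. h *\<^sub>R (y - z))) (at r within {0..1})"
      by (auto intro!: derivative_eq_intros)
    then show "((\<lambda>r. f (?g r)) has_derivative (\<lambda>h. f' (?g r) (h *\<^sub>R (y - z)))) (at r within {0..1})"
      by (rule has_derivative_compose[where f="?g" and g=f, OF _ der[OF seg[OF r]]])
    show "onorm (\<lambda>h. f' (?g r) (h *\<^sub>R (y - z))) \<le> M"
    proof (rule onorm_bound[OF M])
      fix h :: real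
      have "norm (f' (?g r) (h *\<^sub>R (y - z))) = \<bar>h\<bar> * norm (f' (?g r) (y - z))"
        by (simp add: linear_cmul[OF bounded_linear.linear[OF bl]])
      also have "\<dots> \<le> \<bar>h\<bar> * M" using le[OF seg[OF r]] by (rule mult_left_mono) simp
      finally show "norm (f' (?g r) (h *\<^sub>R (y - z))) \<le> M * norm h" by (simp add: mult.commute)
    qed
  qed auto
  then show ?thesis by simp
qed

text \<open>Both orders of differentiation are approximated by the same second difference quotient.\<close>

lemma second_derivative_symmetric:
  assumes C2: "C2_on S f" and S: "open S" and x: "x \<in> S"
  shows "fderiv (fderiv f) x a b = fderiv (fderiv f) x b a"
proof -
  define B where "B = fderiv (fderiv f) x"
  have C1: "C1_on S f" "C1_on S (fderiv f)" using C2 by (auto simp: C2_on_def)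
  have "norm (B b a - B a b) \<le> e * (2 * norm a * norm b)" if e: "e > 0" for e
  proof -
    obtain r where r: "r > 0" "ball x r \<subseteq> S"
      "\<And>y. y \<in> ball x r \<Longrightarrow> norm (fderiv (fderiv f) y - B) < e"
      using C1_on_fderiv_near[OF C1(2) S x e] by (auto simp: B_def)
    define t where "t = r / 2 / (norm a + norm b + 1)"
    have pos: "norm a + norm b + 1 > 0" by (simp add: add_nonneg_pos)
    have t: "t > 0" using r pos by (simp add: t_def)
    have "t * (norm a + norm b + 1) = r / 2"
      using pos unfolding t_def by (metis less_irrefl nonzero_eq_divide_eq)
    then have tr: "t * norm a + t * norm b < r" using t r by (simp add: algebra_simps)
    have *: "norm ((f (x + t *\<^sub>R a + t *\<^sub>R b) - f (x + t *\<^sub>R a)) - (f (x + t *\<^sub>R b) - f x)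
      - t\<^sup>2 *\<^sub>R B b a) \<le> e * t\<^sup>2 * (norm a * norm b)"
      if tr: "t * norm a + t * norm b < r" for a b
    proof -
      have in_ball: "w + c *\<^sub>R b \<in> ball x r" if w: "w \<in> closed_segment x (x + t *\<^sub>R a)" and "c \<in> {0, t}" for w c
      proof -
        obtain u where u: "0 \<le> u" "u \<le> 1" "w = x + (u * t) *\<^sub>R a"
          using w by (auto simp: closed_segment_def algebra_simps)
        have "norm ((u * t) *\<^sub>R a + c *\<^sub>R b) \<le> u * t * norm a + c * norm b"
          using u t \<open>c \<in> {0, t}\<close> by (intro norm_triangle_le) auto
        also have "\<dots> \<le> t * norm a + t * norm b"
          using u t \<open>c \<in> {0, t}\<close> by (intro add_mono mult_right_mono) (auto intro: mult_left_le_one_le)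
        also note tr
        finally have "norm ((u * t) *\<^sub>R a + c *\<^sub>R b) < r" .
        moreover have "x - (w + c *\<^sub>R b) = - ((u * t) *\<^sub>R a + c *\<^sub>R b)" by (simp add: u(3))
        ultimately show ?thesis by (simp only: mem_ball dist_norm norm_minus_cancel)
      qed
      have "norm ((\<lambda>z. f (z + t *\<^sub>R b) - f z) (x + t *\<^sub>R a) - (\<lambda>z. f (z + t *\<^sub>R b) - f z) x
         - blinfun_apply (B (t *\<^sub>R b)) (x + t *\<^sub>R a - x)) \<le> (e * (t * norm b)) * norm (x + t *\<^sub>R a - x)"
      proof (rule strict_linear_approximation[where B="closed_segment x (x + t *\<^sub>R a)"
            and f'="\<lambda>z h. fderiv f (z + t *\<^sub>R b) h - fderiv f z h"])
        fix w assume w: "w \<in> closed_segment x (x + t *\<^sub>R a)"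
        have wS: "w + t *\<^sub>R b \<in> S" "w \<in> S"
          using in_ball[OF w, of t] in_ball[OF w, of 0] r(2) by auto
        show "((\<lambda>z. f (z + t *\<^sub>R b) - f z) has_derivative
            (\<lambda>h. fderiv f (w + t *\<^sub>R b) h - fderiv f w h)) (at w)"
        proof (rule has_derivative_diff[OF _ C1_onD[OF C1(1) wS(2)]])
          have "((\<lambda>z. z + t *\<^sub>R b) has_derivative (\<lambda>h. h)) (at w)"
            by (auto intro!: derivative_eq_intros)
          then show "((\<lambda>z. f (z + t *\<^sub>R b)) has_derivative blinfun_apply (fderiv f (w + t *\<^sub>R b))) (at w)"
            using C1_onD[OF C1(1) wS(1)] by (rule has_derivative_compose)
        qed
        fix h :: 'a
        have "norm (fderiv f (w + t *\<^sub>R b) - fderiv f w - B (w + t *\<^sub>R b - w)) \<le> e * norm (w + t *\<^sub>R b - w)"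
        proof (rule strict_linear_approximation[where B="ball x r"
              and f'="\<lambda>z. blinfun_apply (fderiv (fderiv f) z)"])
          fix z k assume z: "z \<in> ball x r"
          have "norm (blinfun_apply (fderiv (fderiv f) z - B) k) \<le> norm (fderiv (fderiv f) z - B) * norm k"
            by (rule norm_blinfun)
          also have "\<dots> \<le> e * norm k" using r(3)[OF z] by (intro mult_right_mono) auto
          finally show "norm (fderiv (fderiv f) z k - B k) \<le> e * norm k"
            by (simp add: blinfun.diff_left)
        qed (use in_ball[OF w, of t] in_ball[OF w, of 0] r(2) C1_onD[OF C1(2)] e
            in \<open>auto intro: blinfun.bounded_linear_right\<close>)
        then have "norm (fderiv f (w + t *\<^sub>R b) - fderiv f w - B (t *\<^sub>R b)) \<le> e * (t * norm b)"
          using t by simp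
        then have "norm (fderiv f (w + t *\<^sub>R b) - fderiv f w - B (t *\<^sub>R b)) * norm h \<le> e * (t * norm b) * norm h"
          by (rule mult_right_mono) simp
        then show "norm (fderiv f (w + t *\<^sub>R b) h - fderiv f w h - B (t *\<^sub>R b) h) \<le> e * (t * norm b) * norm h"
          using norm_blinfun[of "fderiv f (w + t *\<^sub>R b) - fderiv f w - B (t *\<^sub>R b)" h]
          by (simp add: blinfun.diff_left)
      qed (use e t in \<open>auto intro: blinfun.bounded_linear_right\<close>)
      then show ?thesis
        using t by (simp add: blinfun.scaleR_left blinfun.scaleR_right power2_eq_square add.commute
            add.left_commute mult.commute mult.left_commute)
    qed
    have "norm (t\<^sup>2 *\<^sub>R (B b a - B a b)) \<le> e * t\<^sup>2 * (norm a * norm b) + e * t\<^sup>2 * (norm b * norm a)"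
      using norm_triangle_le_diff[OF add_mono[OF *[of b a] *[of a b]]] tr
      by (simp add: algebra_simps)
    also have "\<dots> = t\<^sup>2 * (e * (2 * norm a * norm b))"
      by simp
    finally have "t\<^sup>2 * norm (B b a - B a b) \<le> t\<^sup>2 * (e * (2 * norm a * norm b))"
      unfolding norm_scaleR by simp
    then show ?thesis using t by simp
  qed
  moreover have "((\<lambda>e. e * (2 * norm a * norm b)) \<longlongrightarrow> 0 * (2 * norm a * norm b)) (at_right 0)"
    by (intro tendsto_intros)
  ultimately have "norm (B b a - B a b) \<le> 0"
    by (intro tendsto_lowerbound[of "\<lambda>e. e * (2 * norm a * norm b)" 0 "at_right 0"])
      (auto simp: eventually_at_filter)
  then show ?thesis by (simp add: B_def)
qed

lemma fderiv_translate:
  assumes "open S" "x \<in> S" "\<And>y. y \<in> S \<Longrightarrow> f (y + c) = f y" "f differentiable (at x)"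
  shows "fderiv f (x + c) = fderiv f x"
proof -
  have D: "(f has_derivative blinfun_apply (fderiv f x)) (at x)"
    using assms(4) blinfun_apply_fderiv unfolding differentiable_def by metis
  have "((\<lambda>y. y - c) has_derivative (\<lambda>h. h)) (at (x + c))"
    by (auto intro!: derivative_eq_intros)
  from has_derivative_compose[OF this, of f] D
  have "((\<lambda>y. f (y - c)) has_derivative blinfun_apply (fderiv f x)) (at (x + c))" by simp
  moreover have "open ((\<lambda>y. y + c) ` S)"
    using open_translation[OF assms(1), of c] by (simp add: add.commute)
  ultimately have "(f has_derivative blinfun_apply (fderiv f x)) (at (x + c))"
    by (rule has_derivative_transform_within_open) (use assms(2,3) in auto)
  then show ?thesis by (rule fderiv_eqI)
qed

text \<open>The tame estimate speaks of the slices at fixed time, the calculus of the map on the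
  product. Composing with the embedding \<open>J\<close> of space vectors, once per order,
  identifies the two second derivatives.\<close>

lemma second_fderiv_slice:
  fixes \<phi> :: "real \<times> 'x::real_normed_vector \<Rightarrow> 'y::real_normed_vector"
  assumes C2: "C2_on U \<phi>" and U: "open U" and x: "(t, x) \<in> U"
  shows "second_fderiv (\<lambda>x. \<phi> (t, x)) x a b = fderiv (fderiv \<phi>) (t, x) (0, a) (0, b)"
proof -
  define J :: "'x \<Rightarrow>\<^sub>L (real \<times> 'x)" where "J = Blinfun (\<lambda>h. (0, h))"
  have J: "blinfun_apply J h = (0, h)" for h
    unfolding J_def
    by (subst bounded_linear_Blinfun_apply)
      (auto intro!: bounded_linear_Pair bounded_linear_ident bounded_linear_zero)
  have C1: "C1_on U \<phi>" "C1_on U (fderiv \<phi>)" using C2 by (auto simp: C2_on_def)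
  have op: "open (Pair t -` U)" by (intro continuous_open_vimage U continuous_intros)
  have inner: "((\<lambda>y. (t, y)) has_derivative (\<lambda>h. (0, h))) (at y)" for y :: 'x
    by (auto intro!: derivative_eq_intros)
  have d1: "fderiv \<phi> (t, y) o\<^sub>L J = fderiv (\<lambda>x. \<phi> (t, x)) y" if "y \<in> Pair t -` U" for y
  proof -
    have "(t, y) \<in> U" using that by simp
    from has_derivative_compose[OF inner C1_onD[OF C1(1) this]]
    have "((\<lambda>x. \<phi> (t, x)) has_derivative blinfun_apply (fderiv \<phi> (t, y) o\<^sub>L J)) (at y)"
      by (simp add: J blinfun_apply_blinfun_compose[abs_def] comp_def)
    then show ?thesis by (rule fderiv_eqI[symmetric])
  qed
  have "((\<lambda>y. fderiv \<phi> (t, y) o\<^sub>L J) has_derivative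
      (\<lambda>h. fderiv (fderiv \<phi>) (t, x) (0, h) o\<^sub>L J)) (at x)"
    by (intro bounded_linear.has_derivative[OF bounded_bilinear.bounded_linear_left[OF bounded_bilinear_blinfun_compose]]
      has_derivative_compose[OF inner C1_onD[OF C1(2) x]])
  then have "(fderiv (\<lambda>x. \<phi> (t, x)) has_derivative
      (\<lambda>h. fderiv (fderiv \<phi>) (t, x) (0, h) o\<^sub>L J)) (at x)"
    by (rule has_derivative_transform_within_open[OF _ op]) (use x d1 in auto)
  from blinfun_apply_fderiv[OF this] show ?thesis by (simp add: second_fderiv_def J)
qed

text \<open>Both sides of \<open>j (\<psi> z) = \<phi> (k z)\<close> are differentiated; the
  resulting first order identity holds on all of the open set \<open>V\<close> and can be
  differentiated again. It will be used with \<open>j\<close> the inclusion of H2 and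
  \<open>k\<close> the same inclusion at fixed time.\<close>

lemma fderiv_intertwine:
  assumes j: "bounded_linear j" and k: "bounded_linear k" and V: "open V"
    and jk: "\<And>z. z \<in> V \<Longrightarrow> k z \<in> U \<and> j (\<psi> z) = \<phi> (k z)"
    and C2: "C2_on V \<psi>" "C2_on U \<phi>" and z: "z \<in> V"
  shows "j (fderiv \<psi> z h) = fderiv \<phi> (k z) (k h)"
    and "j (fderiv (fderiv \<psi>) z h' h) = fderiv (fderiv \<phi>) (k z) (k h') (k h)"
proof -
  have C1: "C1_on V \<psi>" "C1_on V (fderiv \<psi>)" "C1_on U \<phi>" "C1_on U (fderiv \<phi>)"
    using C2 by (auto simp: C2_on_def)
  have kd: "(k has_derivative k) (at z)" for z using k by (rule bounded_linear_imp_has_derivative)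
  have 1: "j (fderiv \<psi> z h) = fderiv \<phi> (k z) (k h)" if z: "z \<in> V" for z h
  proof -
    have "((\<lambda>z. j (\<psi> z)) has_derivative (\<lambda>h. j (fderiv \<psi> z h))) (at z)"
      by (rule bounded_linear.has_derivative[OF j C1_onD[OF C1(1) z]])
    moreover have "((\<lambda>z. \<phi> (k z)) has_derivative (\<lambda>h. fderiv \<phi> (k z) (k h))) (at z)"
      using jk[OF z] by (intro has_derivative_compose[OF kd C1_onD[OF C1(3)]]) auto
    then have "((\<lambda>z. j (\<psi> z)) has_derivative (\<lambda>h. fderiv \<phi> (k z) (k h))) (at z)"
      by (rule has_derivative_transform_within_open[OF _ V z]) (use jk in auto)
    ultimately show ?thesis by (metis has_derivative_unique)
  qed
  show "j (fderiv \<psi> z h) = fderiv \<phi> (k z) (k h)" by (rule 1[OF z])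
  have "((\<lambda>z. j (fderiv \<psi> z h)) has_derivative (\<lambda>h'. j (fderiv (fderiv \<psi>) z h' h))) (at z)"
    by (intro bounded_linear.has_derivative[OF j] bounded_linear.has_derivative[OF blinfun.bounded_linear_left]
      C1_onD[OF C1(2) z])
  moreover have "((\<lambda>z. fderiv \<phi> (k z) (k h)) has_derivative
      (\<lambda>h'. fderiv (fderiv \<phi>) (k z) (k h') (k h))) (at z)"
    using jk[OF z]
    by (intro bounded_linear.has_derivative[OF blinfun.bounded_linear_left]
      has_derivative_compose[OF kd C1_onD[OF C1(4)]]) auto
  then have "((\<lambda>z. j (fderiv \<psi> z h)) has_derivative
      (\<lambda>h'. fderiv (fderiv \<phi>) (k z) (k h') (k h))) (at z)"
    by (rule has_derivative_transform_within_open[OF _ V z]) (use 1 in auto)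
  ultimately show "j (fderiv (fderiv \<psi>) z h' h) = fderiv (fderiv \<phi>) (k z) (k h') (k h)"
    by (metis has_derivative_unique)
qed

section \<open>Tame maps\<close>

lemma norm_le_on_segment:
  assumes "w \<in> closed_segment z y"
  shows "norm (w :: 'x::real_normed_vector) \<le> norm y + norm z"
proof -
  obtain u where u: "0 \<le> u" "u \<le> 1" "w = (1 - u) *\<^sub>R z + u *\<^sub>R y"
    using assms by (auto simp: closed_segment_def)
  have "norm w \<le> (1 - u) * norm z + u * norm y"
    unfolding u(3) using u(1,2) by (intro norm_triangle_le) auto
  also have "\<dots> \<le> 1 * norm z + 1 * norm y"
    using u by (intro add_mono mult_right_mono) auto
  finally show ?thesis by simp
qed

lemma box_in_open:
  fixes p :: "real \<times> 'x::real_normed_vector"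
  assumes "open W" "(t0, x0) \<in> W"
  shows "\<exists>d>0. \<forall>t y. \<bar>t - t0\<bar> < d \<longrightarrow> norm (y - x0) < d \<longrightarrow> (t, y) \<in> W"
proof -
  obtain A B where AB: "open A" "open B" "(t0, x0) \<in> A \<times> B" "A \<times> B \<subseteq> W"
    using open_prod_elim[OF assms] by metis
  obtain r1 where r1: "r1 > 0" "ball t0 r1 \<subseteq> A" using AB openE by blast
  obtain r2 where r2: "r2 > 0" "ball x0 r2 \<subseteq> B" using AB openE by blast
  have "(t, y) \<in> W" if "\<bar>t - t0\<bar> < min r1 r2" "norm (y - x0) < min r1 r2" for t y
  proof -
    have "t \<in> ball t0 r1" "y \<in> ball x0 r2"
      using that by (auto simp: dist_norm norm_minus_commute)
    then have "(t, y) \<in> A \<times> B" using r1(2) r2(2) by blast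
    then show ?thesis using AB(4) by blast
  qed
  then show ?thesis using r1 r2 by (intro exI[of _ "min r1 r2"]) auto
qed

lemma derivative_zero_of_locally_constant:
  assumes der: "(f has_derivative f') (at p)" and r: "r > 0"
    and const: "\<And>h::real. \<bar>h\<bar> < r \<Longrightarrow> f (p + h *\<^sub>R e) = f p"
  shows "f' e = 0"
proof -
  have "((\<lambda>h. p + h *\<^sub>R e) has_derivative (\<lambda>h. h *\<^sub>R e)) (at 0)"
    by (auto intro!: derivative_eq_intros)
  from has_derivative_compose[OF this, of f f'] der
  have 1: "((\<lambda>h. f (p + h *\<^sub>R e)) has_derivative (\<lambda>h. f' (h *\<^sub>R e))) (at 0)" by simp
  have "((\<lambda>h. f (p + h *\<^sub>R e)) has_derivative (\<lambda>h. 0)) (at 0)"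
    by (rule has_derivative_transform_within_open[OF has_derivative_const open_ball[of 0 r]])
      (use r const in auto)
  from has_derivative_unique[OF 1 this] show ?thesis by (metis scaleR_one)
qed

locale tame_path_map = contractive_inclusion \<iota>
  for \<iota> :: "'b::{real_inner, banach, second_countable_topology}
                \<Rightarrow> 'a::{real_inner, banach, second_countable_topology}" +
  fixes O1 :: "(real \<times> 'a) set" and \<phi> :: "real \<times> 'a \<Rightarrow> 'a" and T :: real
  assumes dense_incl: "closure (range \<iota>) = UNIV"
    and open_O1: "open O1"
    and tame: "parametrized_tame \<iota> O1 \<phi>"
    and T_pos: "T > 0"
    and constant_ends: "T \<le> s \<and> T \<le> t \<or> s \<le> - T \<and> t \<le> - T \<Longrightarrow>
      slice O1 s = slice O1 t \<and> (\<forall>x\<in>slice O1 s. \<phi> (s, x) = \<phi> (t, x))"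
    and zero_ends: "T \<le> \<bar>s\<bar> \<Longrightarrow> 0 \<in> slice O1 s \<and> \<phi> (s, 0) = 0"
begin

abbreviation "D \<equiv> fderiv \<phi>"
abbreviation "D2 \<equiv> fderiv (fderiv \<phi>)"
abbreviation "O2 \<equiv> restr_dom \<iota> O1"
abbreviation "\<psi> \<equiv> restr_map \<iota> \<phi>"

lemma C2_\<phi>: "C2_on O1 \<phi>" and C2_\<psi>: "C2_on O2 \<psi>"
  using tame by (auto simp: parametrized_tame_def)

lemma C1: "C1_on O1 \<phi>" "C1_on O1 D" "C1_on O2 \<psi>" "C1_on O2 (fderiv \<psi>)"
  using C2_\<phi> C2_\<psi> by (auto simp: C2_on_def)

lemma mem_O2 [simp]: "(s, y) \<in> O2 \<longleftrightarrow> (s, \<iota> y) \<in> O1"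
  by (simp add: restr_dom_def)

abbreviation (input) "incl2 \<equiv> \<lambda>z::real \<times> 'b. (fst z, \<iota> (snd z))"

lemma bounded_linear_incl2: "bounded_linear incl2"
  by (intro bounded_linear_Pair bounded_linear_fst
      bounded_linear_compose[OF bounded_linear_incl bounded_linear_snd])

lemma open_O2: "open O2"
proof -
  have "O2 = incl2 -` O1" by (auto simp: restr_dom_def)
  then show ?thesis
    using continuous_open_vimage[OF open_O1 linear_continuous_at[OF bounded_linear_incl2]] by simp
qed

lemma incl_\<psi>: "(s, \<iota> y) \<in> O1 \<Longrightarrow> \<iota> (\<psi> (s, y)) = \<phi> (s, \<iota> y)"
  using tame by (auto simp: parametrized_tame_def restr_map_def restr_dom_def f_inv_into_f)

lemma incl_fderiv_\<psi>:
  assumes "(s, \<iota> y) \<in> O1"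
  shows "\<iota> (fderiv \<psi> (s, y) h) = D (s, \<iota> y) (incl2 h)"
    and "\<iota> (fderiv (fderiv \<psi>) (s, y) h h') = D2 (s, \<iota> y) (incl2 h) (incl2 h')"
  using fderiv_intertwine[OF bounded_linear_incl bounded_linear_incl2 open_O2 _ C2_\<psi> C2_\<phi>, of "(s, y)"]
    assms incl_\<psi> by (cases h; cases h'; auto simp: restr_dom_def)+

text \<open>The inequalities are strict so that the condition is open in time, which allows
  derivatives, and not only values, to be compared between two times.\<close>

definition same_end :: "real \<Rightarrow> real \<Rightarrow> bool" where
  "same_end s s' \<longleftrightarrow> T < s \<and> T < s' \<or> s < - T \<and> s' < - T"

lemma same_end_shift:
  assumes "same_end s s'" "(s, x) \<in> O1"
  shows "(s', x) \<in> O1" "\<phi> (s', x) = \<phi> (s, x)"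
  using constant_ends[of s s'] assms by (auto simp: same_end_def slice_def)

text \<open>The translation by \<open>c\<close> leaves \<open>\<phi>\<close> invariant on the open
  set \<open>V\<close>, hence also \<open>D\<close> on \<open>V\<close>; the same argument applied
  to \<open>D\<close> gives the second derivative.\<close>

lemma same_end_fderiv:
  assumes "same_end s s'" "(s, x) \<in> O1"
  shows "D (s', x) = D (s, x)" "D2 (s', x) = D2 (s, x)"
proof -
  define c :: "real \<times> 'a" where "c = (s' - s, 0)"
  define V where "V = O1 \<inter> {p. same_end (fst p) (fst p + (s' - s))}"
  have V: "open V"
    unfolding V_def same_end_def
    by (intro open_Int open_O1 open_Collect_disj open_Collect_conj open_Collect_less continuous_intros)
  have sV: "(s, x) \<in> V" using assms by (auto simp: V_def)
  have shift: "\<phi> (p + c) = \<phi> p" if "p \<in> V" for p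
    using same_end_shift[of "fst p" "fst p + (s' - s)" "snd p"] that
    by (cases p) (auto simp: V_def c_def)
  have Dshift: "D (p + c) = D p" if "p \<in> V" for p
    by (rule fderiv_translate[OF V that])
      (use shift C1(1) that in \<open>auto simp: C1_on_def V_def\<close>)
  show "D (s', x) = D (s, x)" using Dshift[OF sV] by (simp add: c_def)
  have "D2 ((s, x) + c) = D2 (s, x)"
    by (rule fderiv_translate[OF V sV])
      (use Dshift C1(2) assms in \<open>auto simp: C1_on_def\<close>)
  then show "D2 (s', x) = D2 (s, x)" by (simp add: c_def)
qed

lemma same_end_\<psi>:
  assumes "same_end s s'" "(s, \<iota> y) \<in> O1"
  shows "\<psi> (s', y) = \<psi> (s, y)" "fderiv \<psi> (s', y) (0, \<eta>) = fderiv \<psi> (s, y) (0, \<eta>)"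
proof -
  have O1: "(s', \<iota> y) \<in> O1" using same_end_shift(1)[OF assms] .
  have "\<iota> (\<psi> (s', y)) = \<iota> (\<psi> (s, y))"
    unfolding incl_\<psi>[OF O1] incl_\<psi>[OF assms(2)] by (rule same_end_shift(2)[OF assms])
  then show "\<psi> (s', y) = \<psi> (s, y)" using inj_incl by (rule injD[rotated])
  have "\<iota> (fderiv \<psi> (s', y) (0, \<eta>)) = \<iota> (fderiv \<psi> (s, y) (0, \<eta>))"
    unfolding incl_fderiv_\<psi>(1)[OF O1] incl_fderiv_\<psi>(1)[OF assms(2)] same_end_fderiv(1)[OF assms] ..
  then show "fderiv \<psi> (s', y) (0, \<eta>) = fderiv \<psi> (s, y) (0, \<eta>)" using inj_incl by (rule injD[rotated])
qed

text \<open>\<open>\<phi>\<close> and \<open>D\<close> are locally constant in time at the ends,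
  which kills a time vector in the first slot; symmetry of the second derivative moves it to the
  second slot. This is what makes velocities square integrable although the graph
  \<open>(s, u s)\<close> moves with unit speed in time.\<close>

lemma ends_time_derivative:
  assumes s: "T < \<bar>s\<bar>" and x: "(s, x) \<in> O1"
  shows "D (s, x) (1, 0) = 0" "D2 (s, x) (1, 0) = 0" "D2 (s, x) h (1, 0) = 0"
proof -
  have r: "\<bar>s\<bar> - T > 0" using s by simp
  have same: "same_end s (s + h)" if "\<bar>h\<bar> < \<bar>s\<bar> - T" for h
    using that T_pos by (auto simp: same_end_def abs_if split: if_splits)
  show "D (s, x) (1, 0) = 0"
    by (rule derivative_zero_of_locally_constant[OF C1_onD[OF C1(1) x] r])
      (use same_end_shift(2)[OF same x] in simp)
  show *: "D2 (s, x) (1, 0) = 0"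
    by (rule derivative_zero_of_locally_constant[OF C1_onD[OF C1(2) x] r])
      (use same_end_fderiv(1)[OF same x] in simp)
  show "D2 (s, x) h (1, 0) = 0"
    using second_derivative_symmetric[OF C2_\<phi> open_O1 x, of h "(1, 0)"] * by simp
qed

text \<open>The bracket of the tame estimate with the H2 norm of the base point replaced by a
  parameter, which can be enlarged to cover a whole segment.\<close>

definition tame_bound :: "real \<Rightarrow> 'b \<Rightarrow> 'b \<Rightarrow> real" where
  "tame_bound c \<xi> \<eta> = norm (\<iota> \<xi>) * norm \<eta> + norm \<xi> * norm (\<iota> \<eta>) + c * norm (\<iota> \<xi>) * norm (\<iota> \<eta>)"

lemma tame_bound_nonneg: "0 \<le> c \<Longrightarrow> 0 \<le> tame_bound c \<xi> \<eta>"
  by (auto simp: tame_bound_def)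

lemma tame_bound_mono: "c \<le> c' \<Longrightarrow> tame_bound c \<xi> \<eta> \<le> tame_bound c' \<xi> \<eta>"
  unfolding tame_bound_def by (intro add_mono mult_right_mono) auto

text \<open>Moves the tame hypothesis from \<open>inv \<iota>\<close> of a derivative on H1 to the
  derivative of the restricted map: the two agree because the inclusion intertwines second
  derivatives and is injective. The neighbourhood is shrunk to a product box in time and H1.\<close>

lemma tame_local:
  assumes "(t0, x0) \<in> O1"
  shows "\<exists>d>0. \<exists>\<kappa>>0. \<forall>t y. \<bar>t - t0\<bar> < d \<longrightarrow> norm (\<iota> y - x0) < d \<longrightarrow> (t, \<iota> y) \<in> O1 \<and>
    (\<forall>\<xi> \<eta>. norm (fderiv (fderiv \<psi>) (t, y) (0, \<xi>) (0, \<eta>)) \<le> \<kappa> * tame_bound (norm y) \<xi> \<eta>)"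
proof -
  obtain W \<kappa> where W: "open W" "(t0, x0) \<in> W" "W \<subseteq> O1" and \<kappa>: "\<kappa> > 0"
    and est: "\<forall>(t, y) \<in> restr_dom \<iota> W. \<forall>\<xi> \<eta>.
           norm (inv \<iota> (second_fderiv (\<lambda>x. \<phi> (t, x)) (\<iota> y) (\<iota> \<xi>) (\<iota> \<eta>)))
             \<le> \<kappa> * (norm (\<iota> \<xi>) * norm \<eta> + norm \<xi> * norm (\<iota> \<eta>)
                    + norm y * norm (\<iota> \<xi>) * norm (\<iota> \<eta>))"
    using tame assms unfolding parametrized_tame_def by meson
  obtain d where d: "d > 0" "\<And>t y. \<bar>t - t0\<bar> < d \<Longrightarrow> norm (y - x0) < d \<Longrightarrow> (t, y) \<in> W"
    using box_in_open[OF W(1,2)] by metis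
  have "(t, \<iota> y) \<in> O1 \<and>
    (\<forall>\<xi> \<eta>. norm (fderiv (fderiv \<psi>) (t, y) (0, \<xi>) (0, \<eta>)) \<le> \<kappa> * tame_bound (norm y) \<xi> \<eta>)"
    if "\<bar>t - t0\<bar> < d" "norm (\<iota> y - x0) < d" for t y
  proof -
    have yW: "(t, \<iota> y) \<in> W" using d that by blast
    then have yO: "(t, \<iota> y) \<in> O1" using W by blast
    have "second_fderiv (\<lambda>x. \<phi> (t, x)) (\<iota> y) (\<iota> \<xi>) (\<iota> \<eta>) = \<iota> (fderiv (fderiv \<psi>) (t, y) (0, \<xi>) (0, \<eta>))" for \<xi> \<eta>
      unfolding incl_fderiv_\<psi>(2)[OF yO] second_fderiv_slice[OF C2_\<phi> open_O1 yO] by simp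
    then have "inv \<iota> (second_fderiv (\<lambda>x. \<phi> (t, x)) (\<iota> y) (\<iota> \<xi>) (\<iota> \<eta>)) = fderiv (fderiv \<psi>) (t, y) (0, \<xi>) (0, \<eta>)" for \<xi> \<eta>
      using inj_incl by simp
    moreover have "(t, y) \<in> restr_dom \<iota> W" using yW by (simp add: restr_dom_def)
    ultimately show ?thesis using est yO unfolding tame_bound_def by fastforce
  qed
  then show ?thesis using d(1) \<kappa> by blast
qed

lemma slice_derivative_\<psi>:
  assumes "(t, \<iota> w) \<in> O1"
  shows "((\<lambda>w. \<psi> (t, w)) has_derivative (\<lambda>h. fderiv \<psi> (t, w) (0, h))) (at w)"
    and "((\<lambda>w. fderiv \<psi> (t, w) k) has_derivative (\<lambda>h. fderiv (fderiv \<psi>) (t, w) (0, h) k)) (at w)"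
proof -
  have i: "((\<lambda>w. (t, w)) has_derivative (\<lambda>h. (0, h))) (at w)"
    by (auto intro!: derivative_eq_intros)
  have w: "(t, w) \<in> O2" using assms by simp
  show "((\<lambda>w. \<psi> (t, w)) has_derivative (\<lambda>h. fderiv \<psi> (t, w) (0, h))) (at w)"
    by (rule has_derivative_compose[OF i C1_onD[OF C1(3) w]])
  have "((\<lambda>w. fderiv \<psi> (t, w)) has_derivative (\<lambda>h. fderiv (fderiv \<psi>) (t, w) (0, h))) (at w)"
    by (rule has_derivative_compose[OF i C1_onD[OF C1(4) w]])
  then show "((\<lambda>w. fderiv \<psi> (t, w) k) has_derivative (\<lambda>h. fderiv (fderiv \<psi>) (t, w) (0, h) k)) (at w)"
    by (rule bounded_linear.has_derivative[OF blinfun.bounded_linear_left])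
qed

text \<open>Consequences of the tame estimate for orders zero and one. \<open>K\<close> is meant to
  be uniform over a ball of H1, which is unbounded in H2; so H2 norms stay explicit, and every
  product contains at most one of them.\<close>

definition tame_estimates :: "real \<Rightarrow> real \<Rightarrow> 'b \<Rightarrow> 'b \<Rightarrow> bool" where
  "tame_estimates K t y z \<longleftrightarrow>
     norm (\<psi> (t, y)) \<le> K * (1 + norm y) \<and>
     (\<forall>\<eta>. norm (fderiv \<psi> (t, y) (0, \<eta>)) \<le> K * (norm \<eta> + norm y * norm (\<iota> \<eta>)) \<and>
        norm (fderiv \<psi> (t, y) (0, \<eta>) - fderiv \<psi> (t, z) (0, \<eta>))
          \<le> K * tame_bound (norm y + norm z) (y - z) \<eta>)"

text \<open>Integrating the tame estimate along segments controls differences of first derivatives.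
  To control the derivative and the map themselves one needs a starting point in H2; a point
  \<open>y0\<close> close to \<open>x0\<close> in H1 is fixed, and its H2 norm is absorbed into the
  constants.\<close>

lemma tame_estimates_local:
  assumes tx: "(t0, x0) \<in> O1"
  shows "\<exists>d>0. \<exists>K. \<forall>t y z. \<bar>t - t0\<bar> < d \<longrightarrow> norm (\<iota> y - x0) < d \<longrightarrow> norm (\<iota> z - x0) < d \<longrightarrow>
    tame_estimates K t y z"
proof -
  obtain d \<kappa> where d: "d > 0" and \<kappa>: "\<kappa> > 0"
    and dom: "\<And>t y. \<bar>t - t0\<bar> < d \<Longrightarrow> norm (\<iota> y - x0) < d \<Longrightarrow> (t, \<iota> y) \<in> O1"
    and est: "\<And>t y \<xi> \<eta>. \<bar>t - t0\<bar> < d \<Longrightarrow> norm (\<iota> y - x0) < d \<Longrightarrow>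
      norm (fderiv (fderiv \<psi>) (t, y) (0, \<xi>) (0, \<eta>)) \<le> \<kappa> * tame_bound (norm y) \<xi> \<eta>"
    using tame_local[OF tx] by metis
  \<comment> \<open>A segment taken in H2 stays in the region of the estimate, because its linear
    image is a segment in a ball of H1, however long it is in H2.\<close>
  have seg: "norm (\<iota> w - x0) < d"
    if "norm (\<iota> y - x0) < d" "norm (\<iota> z - x0) < d" "w \<in> closed_segment z y" for w y z
  proof -
    have "closed_segment (\<iota> z) (\<iota> y) \<subseteq> ball x0 d"
      using that by (intro closed_segment_subset convex_ball) (auto simp: dist_norm norm_minus_commute)
    moreover have "\<iota> w \<in> closed_segment (\<iota> z) (\<iota> y)"
      using closed_segment_linear_image[OF incl.linear_axioms, of z y] that(3) by auto
    ultimately show ?thesis by (auto simp: dist_norm norm_minus_commute)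
  qed
  have diff: "norm (fderiv \<psi> (t, y) (0, \<eta>) - fderiv \<psi> (t, z) (0, \<eta>)) \<le> \<kappa> * tame_bound (norm y + norm z) (y - z) \<eta>"
    if "\<bar>t - t0\<bar> < d" "norm (\<iota> y - x0) < d" "norm (\<iota> z - x0) < d" for t y z \<eta>
  proof (rule norm_diff_le_segment[where f="\<lambda>w. fderiv \<psi> (t, w) (0, \<eta>)"])
    fix w assume w: "w \<in> closed_segment z y"
    note wd = seg[OF that(2,3) w]
    show "((\<lambda>w. fderiv \<psi> (t, w) (0, \<eta>)) has_derivative (\<lambda>h. fderiv (fderiv \<psi>) (t, w) (0, h) (0, \<eta>))) (at w)"
      by (rule slice_derivative_\<psi>(2)[OF dom[OF that(1) wd]])
    show "norm (fderiv (fderiv \<psi>) (t, w) (0, y - z) (0, \<eta>)) \<le> \<kappa> * tame_bound (norm y + norm z) (y - z) \<eta>"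
      by (rule order_trans[OF est[OF that(1) wd] mult_left_mono[OF tame_bound_mono[OF norm_le_on_segment[OF w]]]])
        (use \<kappa> in simp)
  qed
  \<comment> \<open>Density enters here: \<open>x0\<close> itself may lie outside H2.\<close>
  have "x0 \<in> closure (range \<iota>)" using dense_incl by simp
  then obtain y0 where y0: "norm (\<iota> y0 - x0) < d"
    using d by (auto simp: closure_approachable dist_norm)
  have y0O: "(t0, y0) \<in> O2" using dom[of t0 y0] d y0 by simp
  obtain r1 where r1: "r1 > 0" "\<And>p. p \<in> ball (t0, y0) r1 \<Longrightarrow> norm (fderiv \<psi> p - fderiv \<psi> (t0, y0)) < 1"
    using C1_on_fderiv_near[OF C1(3) open_O2 y0O zero_less_one] by auto
  have "isCont \<psi> (t0, y0)"
    using C1_onD[OF C1(3) y0O] has_derivative_continuous by blast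
  then obtain r2 where r2: "r2 > 0" "\<And>p. dist p (t0, y0) < r2 \<Longrightarrow> norm (\<psi> p - \<psi> (t0, y0)) < 1"
    unfolding continuous_at_eps_delta by (metis dist_norm zero_less_one)
  \<comment> \<open>Bounds the map and its derivative at the fixed point \<open>y0\<close> for all
    times near \<open>t0\<close>, by continuity in H2.\<close>
  define C where "C = norm (fderiv \<psi> (t0, y0)) + norm (\<psi> (t0, y0)) + 1"
  define d' where "d' = min d (min r1 r2)"
  have C: "norm (fderiv \<psi> (t, y0)) \<le> C" "norm (\<psi> (t, y0)) \<le> C" if "\<bar>t - t0\<bar> < d'" for t
  proof -
    have "dist (t, y0) (t0, y0) = \<bar>t - t0\<bar>" by (simp add: dist_Pair_Pair dist_real_def)
    then have "norm (fderiv \<psi> (t, y0) - fderiv \<psi> (t0, y0)) < 1" "norm (\<psi> (t, y0) - \<psi> (t0, y0)) < 1"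
      using r1 r2 that by (auto simp: d'_def dist_commute)
    then show "norm (fderiv \<psi> (t, y0)) \<le> C" "norm (\<psi> (t, y0)) \<le> C"
      unfolding C_def
      using norm_triangle_ineq2[of "fderiv \<psi> (t, y0)" "fderiv \<psi> (t0, y0)"]
        norm_triangle_ineq2[of "\<psi> (t, y0)" "\<psi> (t0, y0)"]
        norm_ge_zero[of "fderiv \<psi> (t0, y0)"] norm_ge_zero[of "\<psi> (t0, y0)"] by linarith+
  qed
  have C0: "0 \<le> C" by (simp add: C_def add_nonneg_nonneg)
  define n0 where "n0 = norm y0"
  have n0: "0 \<le> n0" by (simp add: n0_def)
  have i_diff: "norm (\<iota> (y - y0)) \<le> 2 * d" if "norm (\<iota> y - x0) < d" for y
  proof -
    have "norm (\<iota> (y - y0)) \<le> norm (\<iota> y - x0) + norm (\<iota> y0 - x0)"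
      unfolding incl.diff using norm_triangle_ineq4[of "\<iota> y - x0" "\<iota> y0 - x0"] by simp
    then show ?thesis using that y0 by simp
  qed
  have n_diff: "norm (y - y0) \<le> norm y + n0" for y
    unfolding n0_def by (rule norm_triangle_ineq4)
  \<comment> \<open>\<open>C\<close> is the contribution of \<open>y0\<close>; the rest is the tame
    bound for the step from \<open>y0\<close> to \<open>y\<close>, whose H1 norm is at most
    \<open>2 * d\<close> and whose H2 norm is at most \<open>norm y + n0\<close>.\<close>
  define K1 where "K1 = C + \<kappa> * (2 * d + (1 + n0) * (1 + 2 * d))"
  have K1: "0 \<le> K1" using C0 \<kappa> d n0 by (auto simp: K1_def)
  have b1: "norm (fderiv \<psi> (t, y) (0, \<eta>)) \<le> K1 * (norm \<eta> + norm y * norm (\<iota> \<eta>))"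
    if t: "\<bar>t - t0\<bar> < d'" and y: "norm (\<iota> y - x0) < d" for t y \<eta>
  proof -
    have td: "\<bar>t - t0\<bar> < d" using t by (simp add: d'_def)
    have "norm (fderiv \<psi> (t, y0) (0, \<eta>)) \<le> norm (fderiv \<psi> (t, y0)) * norm (0::real, \<eta>)"
      by (rule norm_blinfun)
    also have "\<dots> \<le> C * norm \<eta>"
      using C(1)[OF t] by (simp add: norm_Pair mult_right_mono)
    finally have 1: "norm (fderiv \<psi> (t, y0) (0, \<eta>)) \<le> C * norm \<eta>" .
    have "tame_bound (norm y + n0) (y - y0) \<eta> \<le>
      2 * d * norm \<eta> + (norm y + n0) * norm (\<iota> \<eta>) + (norm y + n0) * (2 * d) * norm (\<iota> \<eta>)"
      unfolding tame_bound_def using d n0 i_diff[OF y] n_diff[of y]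
      by (intro add_mono mult_right_mono mult_left_mono) auto
    also have "\<dots> = 2 * d * norm \<eta> + (n0 * (1 + 2 * d)) * norm (\<iota> \<eta>) + (1 + 2 * d) * (norm y * norm (\<iota> \<eta>))"
      by (simp add: algebra_simps)
    also have "\<dots> \<le> 2 * d * norm \<eta> + (n0 * (1 + 2 * d)) * norm \<eta> + (1 + 2 * d) * (norm y * norm (\<iota> \<eta>))"
      using d n0 norm_incl_le[of \<eta>] by (intro add_mono mult_left_mono) auto
    also have "\<dots> \<le> (2 * d + (1 + n0) * (1 + 2 * d)) * (norm \<eta> + norm y * norm (\<iota> \<eta>))"
      using d n0 by (simp add: algebra_simps)
    finally have 2: "\<kappa> * tame_bound (norm y + n0) (y - y0) \<eta> \<le>
      \<kappa> * ((2 * d + (1 + n0) * (1 + 2 * d)) * (norm \<eta> + norm y * norm (\<iota> \<eta>)))"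
      using \<kappa> by (intro mult_left_mono) auto
    have "norm (fderiv \<psi> (t, y) (0, \<eta>)) \<le> norm (fderiv \<psi> (t, y0) (0, \<eta>))
      + norm (fderiv \<psi> (t, y) (0, \<eta>) - fderiv \<psi> (t, y0) (0, \<eta>))"
      by (rule norm_triangle_sub)
    also have "\<dots> \<le> C * norm \<eta> + \<kappa> * ((2 * d + (1 + n0) * (1 + 2 * d)) * (norm \<eta> + norm y * norm (\<iota> \<eta>)))"
      using 1 2 diff[OF td y y0, of \<eta>] by (auto simp: n0_def)
    also have "C * norm \<eta> \<le> C * (norm \<eta> + norm y * norm (\<iota> \<eta>))"
      using C0 by (intro mult_left_mono) auto
    finally show ?thesis by (simp add: K1_def distrib_right mult.assoc)
  qed
  \<comment> \<open>\<open>C\<close> again comes from \<open>y0\<close>; the second summand results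
    from integrating the first order bound \<open>b1\<close> along the segment from
    \<open>y0\<close>.\<close>
  define K2 where "K2 = C + K1 * ((1 + n0) * (1 + 2 * d))"
  have b2: "norm (\<psi> (t, y)) \<le> K2 * (1 + norm y)"
    if t: "\<bar>t - t0\<bar> < d'" and y: "norm (\<iota> y - x0) < d" for t y
  proof -
    have td: "\<bar>t - t0\<bar> < d" using t by (simp add: d'_def)
    have "norm (\<psi> (t, y) - \<psi> (t, y0)) \<le> K1 * ((norm y + n0) * (1 + 2 * d))"
    proof (rule norm_diff_le_segment[where f="\<lambda>w. \<psi> (t, w)"])
      fix w assume w: "w \<in> closed_segment y0 y"
      note wd = seg[OF y y0 w]
      show "((\<lambda>w. \<psi> (t, w)) has_derivative (\<lambda>h. fderiv \<psi> (t, w) (0, h))) (at w)"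
        by (rule slice_derivative_\<psi>(1)[OF dom[OF td wd]])
      have "norm w \<le> norm y + n0" using norm_le_on_segment[OF w] by (simp add: n0_def)
      then have "norm (y - y0) + norm w * norm (\<iota> (y - y0)) \<le> (norm y + n0) + (norm y + n0) * (2 * d)"
        using d n0 i_diff[OF y] n_diff[of y] by (intro add_mono mult_mono) auto
      also have "\<dots> = (norm y + n0) * (1 + 2 * d)" by (simp add: algebra_simps)
      finally show "norm (fderiv \<psi> (t, w) (0, y - y0)) \<le> K1 * ((norm y + n0) * (1 + 2 * d))"
        using K1 b1[OF t wd, of "y - y0"] by (meson mult_left_mono order_trans)
    qed
    also have "\<dots> \<le> K1 * (((1 + n0) * (1 + 2 * d)) * (1 + norm y))"
    proof (rule mult_left_mono[OF _ K1])
      have "(norm y + n0) * (1 + 2 * d) \<le> ((1 + n0) * (1 + norm y)) * (1 + 2 * d)"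
        using d n0 by (intro mult_right_mono) (auto simp: algebra_simps)
      then show "(norm y + n0) * (1 + 2 * d) \<le> ((1 + n0) * (1 + 2 * d)) * (1 + norm y)"
        by (simp only: mult_ac)
    qed
    finally have "norm (\<psi> (t, y)) \<le> C + K1 * (((1 + n0) * (1 + 2 * d)) * (1 + norm y))"
      using C(2)[OF t] norm_triangle_sub[of "\<psi> (t, y)" "\<psi> (t, y0)"] by linarith
    also have "C \<le> C * (1 + norm y)" using C0 by (simp add: algebra_simps)
    finally show ?thesis by (simp add: K2_def distrib_right mult.assoc)
  qed
  define K where "K = max \<kappa> (max K1 K2)"
  have "tame_estimates K t y z"
    if t: "\<bar>t - t0\<bar> < d'" and y: "norm (\<iota> y - x0) < d'" and z: "norm (\<iota> z - x0) < d'" for t y z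
    unfolding tame_estimates_def
  proof (intro conjI allI)
    have tyz: "\<bar>t - t0\<bar> < d" "norm (\<iota> y - x0) < d" "norm (\<iota> z - x0) < d"
      using t y z by (auto simp: d'_def)
    show "norm (\<psi> (t, y)) \<le> K * (1 + norm y)"
      by (rule order_trans[OF b2[OF t tyz(2)] mult_right_mono]) (auto simp: K_def)
    fix \<eta>
    show "norm (fderiv \<psi> (t, y) (0, \<eta>)) \<le> K * (norm \<eta> + norm y * norm (\<iota> \<eta>))"
      by (rule order_trans[OF b1[OF t tyz(2)] mult_right_mono]) (auto simp: K_def)
    show "norm (fderiv \<psi> (t, y) (0, \<eta>) - fderiv \<psi> (t, z) (0, \<eta>)) \<le> K * tame_bound (norm y + norm z) (y - z) \<eta>"
      by (rule order_trans[OF diff[OF tyz] mult_right_mono]) (auto simp: K_def intro: tame_bound_nonneg)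
  qed
  moreover have "d' > 0" using d r1 r2 by (simp add: d'_def)
  ultimately show ?thesis by blast
qed

end

lemma primitive_of_C1_compose:
  fixes p :: "real \<Rightarrow> 'x::{banach, second_countable_topology}"
    and f :: "'x \<Rightarrow> 'y::{banach, second_countable_topology}"
  assumes f: "C1_on S f" "open S" and p: "primitive_of p q" and pS: "\<And>s. p s \<in> S"
  shows "primitive_of (\<lambda>s. f (p s)) (\<lambda>s. fderiv f (p s) (q s))"
proof (rule primitive_of_compose[OF p f(2) pS, where f'="\<lambda>x. blinfun_apply (fderiv f x)"])
  fix x assume x: "x \<in> S"
  show "(f has_derivative blinfun_apply (fderiv f x)) (at x)" by (rule C1_onD[OF f(1) x])
  fix e :: real assume "e > 0"
  from C1_on_fderiv_near[OF f x this] obtain r where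
    r: "r > 0" "\<And>y. y \<in> ball x r \<Longrightarrow> norm (fderiv f y - fderiv f x) < e" by auto
  have "norm (fderiv f y h - fderiv f x h) \<le> e * norm h" if "dist y x < r" for y h
  proof -
    have "norm (blinfun_apply (fderiv f y - fderiv f x) h) \<le> norm (fderiv f y - fderiv f x) * norm h"
      by (rule norm_blinfun)
    also have "\<dots> \<le> e * norm h"
      using r(2)[of y] that by (intro mult_right_mono) (auto simp: dist_commute)
    finally show ?thesis by (simp add: blinfun.diff_left)
  qed
  then show "\<exists>d>0. \<forall>y\<in>S. dist y x < d \<longrightarrow> (\<forall>h. norm (fderiv f y h - fderiv f x h) \<le> e * norm h)"
    using r(1) by blast
qed

text \<open>The chain rule for the map sending \<open>(x, h)\<close> to \<open>fderiv f x h\<close>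
  on the product space, which is once differentiable because \<open>f\<close> is twice. It supplies
  the velocity of the derivative of the induced map.\<close>

lemma primitive_of_fderiv_apply:
  fixes p :: "real \<Rightarrow> 'x::{banach, second_countable_topology}"
    and f :: "'x \<Rightarrow> 'y::{banach, second_countable_topology}"
  assumes f: "C2_on S f" and S: "open S" and p: "primitive_of p q" and pS: "\<And>s. p s \<in> S"
    and k: "primitive_of k l"
  shows "primitive_of (\<lambda>s. fderiv f (p s) (k s))
    (\<lambda>s. fderiv (fderiv f) (p s) (q s) (k s) + fderiv f (p s) (l s))"
proof -
  let ?F = "\<lambda>z. fderiv f (fst z) (snd z)"
  let ?F' = "\<lambda>z h. fderiv (fderiv f) (fst z) (fst h) (snd z) + fderiv f (fst z) (snd h)"
  have C1: "C1_on S f" "C1_on S (fderiv f)" using f by (auto simp: C2_on_def)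
  have "primitive_of (\<lambda>s. ?F (p s, k s)) (\<lambda>s. ?F' (p s, k s) (q s, l s))"
  proof (rule primitive_of_compose[OF primitive_of_Pair[OF p k], of "S \<times> UNIV"])
    show "open (S \<times> (UNIV :: 'x set))" using S by (simp add: open_Times)
    show "(p s, k s) \<in> S \<times> UNIV" for s using pS by simp
    fix z :: "'x \<times> 'x" assume z: "z \<in> S \<times> UNIV"
    then have z1: "fst z \<in> S" by auto
    have "(fst has_derivative fst) (at z)" by (auto intro!: derivative_eq_intros)
    from has_derivative_compose[OF this C1_onD[OF C1(2) z1]]
    have "((\<lambda>z. fderiv f (fst z)) has_derivative (\<lambda>h. fderiv (fderiv f) (fst z) (fst h))) (at z)" .
    moreover have "(snd has_derivative snd) (at z)" by (auto intro!: derivative_eq_intros)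
    ultimately show "(?F has_derivative ?F' z) (at z)"
      by (rule blinfun.FDERIV[THEN has_derivative_eq_rhs]) (auto simp: add.commute)
    fix e :: real assume e: "e > 0"
    define B where "B = norm (snd z) + 1 + norm (fderiv (fderiv f) (fst z)) + 1"
    have B: "B > 0" by (simp add: B_def add_nonneg_pos add_pos_nonneg)
    \<comment> \<open>The variation of the derivative splits into three terms, each allotted
      \<open>e / 3\<close>. In two of them a quantity at most \<open>c\<close> meets a factor
      bounded by \<open>B\<close>.\<close>
    define c where "c = e / 3 / B"
    have c: "c > 0" "c * B = e / 3" using e B by (auto simp: c_def)
    obtain r1 where r1: "r1 > 0"
      "\<And>y. y \<in> ball (fst z) r1 \<Longrightarrow> norm (fderiv f y - fderiv f (fst z)) < e / 3"
      using C1_on_fderiv_near[OF C1(1) S z1, of "e / 3"] e by auto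
    obtain r2 where r2: "r2 > 0"
      "\<And>y. y \<in> ball (fst z) r2 \<Longrightarrow> norm (fderiv (fderiv f) y - fderiv (fderiv f) (fst z)) < c"
      using C1_on_fderiv_near[OF C1(2) S z1 c(1)] by auto
    define r where "r = min (min r1 r2) (min c 1)"
    have "norm (?F' y h - ?F' z h) \<le> e * norm h" if y: "dist y z < r" for y h
    proof -
      have d1: "dist (fst y) (fst z) < r" and d2: "norm (snd y - snd z) < r"
        using y dist_fst_le[of y z] dist_snd_le[of y z] by (auto simp: dist_norm)
      define A A0 L L0 where "A = fderiv (fderiv f) (fst y)" and "A0 = fderiv (fderiv f) (fst z)"
        and "L = fderiv f (fst y)" and "L0 = fderiv f (fst z)"
      have b1: "fst y \<in> ball (fst z) r1" and b2: "fst y \<in> ball (fst z) r2"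
        using d1 by (auto simp: r_def dist_commute)
      have A: "norm (A - A0) \<le> c" "norm (L - L0) \<le> e / 3"
        unfolding A_def A0_def L_def L0_def
        by (rule less_imp_le[OF r2(2)[OF b2]], rule less_imp_le[OF r1(2)[OF b1]])
      have s: "norm (snd y) \<le> B" "norm A0 \<le> B" "norm (snd y - snd z) \<le> c"
        using d2 norm_triangle_ineq2[of "snd y" "snd z"] norm_ge_zero[of A0] norm_ge_zero[of "snd z"]
        unfolding B_def r_def A0_def by linarith+
      have "?F' y h - ?F' z h = (A - A0) (fst h) (snd y) + A0 (fst h) (snd y - snd z) + (L - L0) (snd h)"
        by (simp add: blinfun.diff_left blinfun.diff_right A_def A0_def L_def L0_def)
      also have "norm \<dots> \<le> norm (A - A0) * norm (fst h) * norm (snd y)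
          + norm A0 * norm (fst h) * norm (snd y - snd z) + norm (L - L0) * norm (snd h)"
        by (intro norm_triangle_mono norm_blinfun order_trans[OF norm_blinfun mult_right_mono[OF norm_blinfun]]) auto
      also have "\<dots> \<le> c * norm h * B + B * norm h * c + e / 3 * norm h"
        using A s B c e by (intro add_mono mult_mono norm_component_le) auto
      also have "\<dots> = (c * B + c * B + e / 3) * norm h" by (simp add: algebra_simps)
      also have "\<dots> = e * norm h" unfolding c(2) by simp
      finally show ?thesis .
    qed
    then show "\<exists>d>0. \<forall>y\<in>S \<times> UNIV. dist y z < d \<longrightarrow> (\<forall>h. norm (?F' y h - ?F' z h) \<le> e * norm h)"
      using r1(1) r2(1) c(1) by (intro exI[of _ r]) (auto simp: r_def)
  qed
  then show ?thesis by simp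
qed

section \<open>Uniform bounds in a tube around a path\<close>

context tame_path_map
begin

text \<open>\<open>y\<close> and \<open>z\<close> range over H1, where the tube lives; the tame
  estimates apply only to points coming from H2. Two points are needed since the last tame estimate
  compares derivatives at different points.\<close>

definition good :: "real \<Rightarrow> real \<Rightarrow> 'a \<Rightarrow> 'a \<Rightarrow> bool" where
  "good K s y z \<longleftrightarrow> (s, y) \<in> O1 \<and> (s, z) \<in> O1 \<and> norm (D (s, y)) \<le> K \<and> norm (D2 (s, y)) \<le> K \<and>
     (\<forall>y' z'. \<iota> y' = y \<longrightarrow> \<iota> z' = z \<longrightarrow> tame_estimates K s y' z')"

lemma tame_estimates_mono:
  assumes "tame_estimates K t y z" "K \<le> K'"
  shows "tame_estimates K' t y z"
  unfolding tame_estimates_def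
proof (intro conjI allI)
  note le = order_trans[OF _ mult_right_mono[OF assms(2)]]
  show "norm (\<psi> (t, y)) \<le> K' * (1 + norm y)"
    by (rule le) (use assms(1) in \<open>auto simp: tame_estimates_def\<close>)
  fix \<eta>
  show "norm (fderiv \<psi> (t, y) (0, \<eta>)) \<le> K' * (norm \<eta> + norm y * norm (\<iota> \<eta>))"
    by (rule le) (use assms(1) in \<open>auto simp: tame_estimates_def\<close>)
  show "norm (fderiv \<psi> (t, y) (0, \<eta>) - fderiv \<psi> (t, z) (0, \<eta>)) \<le> K' * tame_bound (norm y + norm z) (y - z) \<eta>"
    by (rule le) (use assms(1) tame_bound_nonneg in \<open>auto simp: tame_estimates_def\<close>)
qed

lemma good_mono: "good K s y z \<Longrightarrow> K \<le> K' \<Longrightarrow> good K' s y z"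
  by (auto simp: good_def intro: tame_estimates_mono)

lemma good_local:
  assumes tx: "(t0, x0) \<in> O1"
  shows "\<exists>d>0. \<exists>K. \<forall>t y z. \<bar>t - t0\<bar> < d \<longrightarrow> norm (y - x0) < d \<longrightarrow> norm (z - x0) < d \<longrightarrow> good K t y z"
proof -
  obtain d1 K1 where d1: "d1 > 0"
    "\<And>t y z. \<bar>t - t0\<bar> < d1 \<Longrightarrow> norm (\<iota> y - x0) < d1 \<Longrightarrow> norm (\<iota> z - x0) < d1 \<Longrightarrow> tame_estimates K1 t y z"
    using tame_estimates_local[OF tx] by metis
  obtain r1 where r1: "r1 > 0" "ball (t0, x0) r1 \<subseteq> O1"
      "\<And>y. y \<in> ball (t0, x0) r1 \<Longrightarrow> norm (D y - D (t0, x0)) < 1"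
    using C1_on_fderiv_near[OF C1(1) open_O1 tx zero_less_one] by auto
  obtain r2 where r2: "r2 > 0"
      "\<And>y. y \<in> ball (t0, x0) r2 \<Longrightarrow> norm (D2 y - D2 (t0, x0)) < 1"
    using C1_on_fderiv_near[OF C1(2) open_O1 tx zero_less_one] by auto
  have "(t0, x0) \<in> ball (t0, x0) (min r1 r2)" using r1 r2 by simp
  from box_in_open[OF open_ball this] obtain d2 where d2: "d2 > 0"
    "\<And>t y. \<bar>t - t0\<bar> < d2 \<Longrightarrow> norm (y - x0) < d2 \<Longrightarrow> (t, y) \<in> ball (t0, x0) (min r1 r2)"
    by metis
  define K where "K = max K1 (norm (D (t0, x0)) + norm (D2 (t0, x0)) + 1)"
  have "good K t y z" if "\<bar>t - t0\<bar> < min d1 d2" "norm (y - x0) < min d1 d2" "norm (z - x0) < min d1 d2" for t y z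
    unfolding good_def
  proof (intro conjI allI impI)
    have y: "(t, y) \<in> ball (t0, x0) (min r1 r2)" and z: "(t, z) \<in> ball (t0, x0) (min r1 r2)"
      using d2 that by auto
    show "(t, y) \<in> O1" "(t, z) \<in> O1" using y z r1(2) by auto
    show "norm (D (t, y)) \<le> K" "norm (D2 (t, y)) \<le> K"
      unfolding K_def
      using r1(3)[of "(t, y)"] r2(2)[of "(t, y)"] y norm_triangle_ineq2[of "D (t, y)" "D (t0, x0)"]
        norm_triangle_ineq2[of "D2 (t, y)" "D2 (t0, x0)"]
      by (auto intro!: max.coboundedI2 intro: add_nonneg_nonneg)
        (smt (verit) norm_ge_zero)+
    show "tame_estimates K t y' z'" if "\<iota> y' = y" "\<iota> z' = z" for y' z'
      by (rule tame_estimates_mono[OF d1(2)])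
        (use that \<open>\<bar>t - t0\<bar> < min d1 d2\<close> \<open>norm (y - x0) < min d1 d2\<close> \<open>norm (z - x0) < min d1 d2\<close>
          in \<open>auto simp: K_def\<close>)
  qed
  then show ?thesis using d1(1) d2(1) by (intro exI[of _ "min d1 d2"]) auto
qed

lemma good_shift:
  assumes "same_end s s'" "good K s y z"
  shows "good K s' y z"
proof -
  have y: "(s, y) \<in> O1" and z: "(s, z) \<in> O1" using assms by (auto simp: good_def)
  note [simp] = same_end_fderiv[OF assms(1) y]
  have "tame_estimates K s' y' z'" if "\<iota> y' = y" "\<iota> z' = z" for y' z'
    using assms y z that same_end_\<psi>[OF assms(1), of y'] same_end_\<psi>[OF assms(1), of z']
    by (auto simp: good_def tame_estimates_def)
  then show ?thesis
    using assms y z same_end_shift(1)[OF assms(1)] by (auto simp: good_def)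
qed

text \<open>Local properties hold uniformly along a path: compactness takes care of a bounded time
  interval, and outside of it the path is close to \<open>0\<close> while the map does not depend on time.\<close>

lemma tube:
  fixes P :: "real \<Rightarrow> real \<Rightarrow> 'a \<Rightarrow> 'a \<Rightarrow> bool"
  assumes u: "is_path \<iota> u v f" and adm: "\<And>s. (s, u s) \<in> O1"
    and loc: "\<And>t x. (t, x) \<in> O1 \<Longrightarrow> \<exists>d>0. \<exists>K. \<forall>s y z.
      \<bar>s - t\<bar> < d \<longrightarrow> norm (y - x) < d \<longrightarrow> norm (z - x) < d \<longrightarrow> P K s y z"
    and mono: "\<And>K K' s y z. P K s y z \<Longrightarrow> K \<le> K' \<Longrightarrow> P K' s y z"
    and shift: "\<And>K s s' y z. same_end s s' \<Longrightarrow> P K s y z \<Longrightarrow> P K s' y z"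
  shows "\<exists>r>0. \<exists>K>0. \<forall>s y z. norm (y - u s) < r \<longrightarrow> norm (z - u s) < r \<longrightarrow> P K s y z"
proof -
  have uc: "continuous_on UNIV u" using u by (auto simp: is_path_def dest: primitive_ofD)
  have "(T + 1, 0) \<in> O1" "(- T - 1, 0) \<in> O1"
    using zero_ends[of "T + 1"] zero_ends[of "- T - 1"] T_pos by (auto simp: slice_def)
  from loc[OF this(1)] loc[OF this(2)] obtain d1 K1 d2 K2 where
    d1: "d1 > 0" "\<And>y z. norm y < d1 \<Longrightarrow> norm z < d1 \<Longrightarrow> P K1 (T + 1) y z" and
    d2: "d2 > 0" "\<And>y z. norm y < d2 \<Longrightarrow> norm z < d2 \<Longrightarrow> P K2 (- T - 1) y z"
    by (metis abs_zero diff_self diff_zero)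
  \<comment> \<open>Halved because \<open>y\<close> is within \<open>d\<close> of
    \<open>u s\<close>, which at late times is itself within \<open>d\<close> of 0. The time
    \<open>S\<close> below exceeds \<open>T\<close>, so that all such times share an end with
    \<open>T + 1\<close> or \<open>- T - 1\<close>.\<close>
  define d where "d = min d1 d2 / 2"
  have d: "d > 0" using d1 d2 by (simp add: d_def)
  obtain S0 where S0: "S0 > 0" "\<And>s. S0 \<le> \<bar>s\<bar> \<Longrightarrow> norm (u s) < d"
    using is_path_vanishes_at_infinity[OF u d] by blast
  define S where "S = max S0 (T + 1)"
  have ends: "P (max K1 K2) s y z" if s: "S \<le> \<bar>s\<bar>" and y: "norm (y - u s) < d" and z: "norm (z - u s) < d" for s y z
  proof -
    have us: "norm (u s) < d" using S0(2)[of s] s by (simp add: S_def)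
    have small: "norm y < 2 * d" "norm z < 2 * d"
      using us y z norm_triangle_sub[of y "u s"] norm_triangle_sub[of z "u s"] by auto
    show ?thesis
    proof (cases "s > 0")
      case True
      then have "same_end (T + 1) s" using s T_pos by (auto simp: same_end_def S_def)
      moreover have "P (max K1 K2) (T + 1) y z"
        by (rule mono[OF d1(2)]) (use small in \<open>auto simp: d_def\<close>)
      ultimately show ?thesis by (rule shift)
    next
      case False
      then have "same_end (- T - 1) s" using s T_pos by (auto simp: same_end_def S_def)
      moreover have "P (max K1 K2) (- T - 1) y z"
        by (rule mono[OF d2(2)]) (use small in \<open>auto simp: d_def\<close>)
      ultimately show ?thesis by (rule shift)
    qed
  qed
  have "- S \<le> S" using T_pos by (simp add: S_def)
  then have "\<exists>r>0. \<exists>K. \<forall>s\<in>{-S..S}. \<forall>y z. norm (y - u s) < r \<longrightarrow> norm (z - u s) < r \<longrightarrow> P K s y z"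
  proof (induction rule: Bolzano)
    case (trans a b c)
    then obtain r1 K1 r2 K2 where
      1: "r1 > 0" "\<And>s y z. s \<in> {a..b} \<Longrightarrow> norm (y - u s) < r1 \<Longrightarrow> norm (z - u s) < r1 \<Longrightarrow> P K1 s y z" and
      2: "r2 > 0" "\<And>s y z. s \<in> {b..c} \<Longrightarrow> norm (y - u s) < r2 \<Longrightarrow> norm (z - u s) < r2 \<Longrightarrow> P K2 s y z"
      by metis
    have "P (max K1 K2) s y z" if "s \<in> {a..c}" "norm (y - u s) < min r1 r2" "norm (z - u s) < min r1 r2" for s y z
    proof (cases "s \<le> b")
      case True
      then show ?thesis using that by (intro mono[OF 1(2)[of s y z]]) auto
    next
      case False
      then show ?thesis using that by (intro mono[OF 2(2)[of s y z]]) auto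
    qed
    then have "\<forall>s\<in>{a..c}. \<forall>y z. norm (y - u s) < min r1 r2 \<longrightarrow> norm (z - u s) < min r1 r2 \<longrightarrow>
      P (max K1 K2) s y z" by blast
    moreover have "min r1 r2 > 0" using 1(1) 2(1) by simp
    ultimately show ?case by blast
  next
    case (local x)
    obtain d K where d: "d > 0"
      "\<And>s y z. \<bar>s - x\<bar> < d \<Longrightarrow> norm (y - u x) < d \<Longrightarrow> norm (z - u x) < d \<Longrightarrow> P K s y z"
      using loc[OF adm[of x]] by metis
    obtain d' where d': "d' > 0" "\<And>s. \<bar>s - x\<bar> < d' \<Longrightarrow> norm (u s - u x) < d / 2"
      using uc half_gt_zero[OF d(1)] unfolding continuous_on_iff dist_norm real_norm_def by (metis UNIV_I)
    have *: "P K s y z" if "\<bar>s - x\<bar> < min d d'" "norm (y - u s) < d / 2" "norm (z - u s) < d / 2" for s y z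
    proof (rule d(2))
      have us: "norm (u s - u x) < d / 2" using d'(2) that by simp
      show "\<bar>s - x\<bar> < d" using that by simp
      show "norm (y - u x) < d" "norm (z - u x) < d"
        using norm_triangle_lt[of "y - u s" "u s - u x" d] norm_triangle_lt[of "z - u s" "u s - u x" d] us that
        by simp_all
    qed
    have "\<forall>s\<in>{a..b}. \<forall>y z. norm (y - u s) < d / 2 \<longrightarrow> norm (z - u s) < d / 2 \<longrightarrow> P K s y z"
      if "a \<le> x \<and> x \<le> b \<and> b - a < min d d'" for a b
    proof (intro ballI allI impI *)
      show "\<bar>s - x\<bar> < min d d'" if "s \<in> {a..b}" for s
        using that \<open>a \<le> x \<and> x \<le> b \<and> b - a < min d d'\<close> by (simp only: abs_less_iff) auto
    qed
    moreover have "min d d' > 0" "d / 2 > 0" using d(1) d'(1) by simp_all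
    ultimately show ?case by blast
  qed
  then obtain r K where r: "r > 0"
    "\<And>s y z. s \<in> {-S..S} \<Longrightarrow> norm (y - u s) < r \<Longrightarrow> norm (z - u s) < r \<Longrightarrow> P K s y z"
    by metis
  define L where "L = max K (max (max K1 K2) 1)"
  have "P L s y z" if "norm (y - u s) < min r d" "norm (z - u s) < min r d" for s y z
  proof (cases "S \<le> \<bar>s\<bar>")
    case True
    then show ?thesis using that by (intro mono[OF ends[of s y z]]) (auto simp: L_def)
  next
    case False
    then show ?thesis using that by (intro mono[OF r(2)[of s y z]]) (auto simp: L_def)
  qed
  moreover have "L > 0" by (simp add: L_def)
  moreover have "min r d > 0" using r(1) d by simp
  ultimately show ?thesis by blast
qed

lemma tube_good:
  assumes "is_path \<iota> u v f" "\<And>s. (s, u s) \<in> O1"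
  shows "\<exists>r>0. \<exists>K>0. \<forall>s y z. norm (y - u s) < r \<longrightarrow> norm (z - u s) < r \<longrightarrow> good K s y z"
  by (rule tube[OF assms good_local]) (auto intro: good_mono good_shift)

text \<open>Continuity of \<open>D2\<close> becomes uniform along the path. For \<open>tube\<close>
  the closeness is stated symmetrically for two points near a common centre, each within
  \<open>e / 2\<close> of it; afterwards \<open>z\<close> is specialized to \<open>u s\<close>. The
  parameter \<open>K\<close> of \<open>P\<close> is a dummy.\<close>

lemma tube_close:
  assumes u: "is_path \<iota> u v f" "\<And>s. (s, u s) \<in> O1" and e: "e > 0"
  shows "\<exists>r>0. \<forall>s y. norm (y - u s) < r \<longrightarrow> (s, y) \<in> O1 \<and> norm (D2 (s, y) - D2 (s, u s)) \<le> e"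
proof -
  define P where "P K s y z \<longleftrightarrow> (s, y) \<in> O1 \<and> (s, z) \<in> O1 \<and> norm (D2 (s, y) - D2 (s, z)) \<le> e"
    for K :: real and s y z
  have "\<exists>r>0. \<exists>K>0. \<forall>s y z. norm (y - u s) < r \<longrightarrow> norm (z - u s) < r \<longrightarrow> P K s y z"
  proof (rule tube[OF u])
    fix t x assume tx: "(t, x) \<in> O1"
    obtain r where r: "r > 0" "ball (t, x) r \<subseteq> O1" "\<And>p. p \<in> ball (t, x) r \<Longrightarrow> norm (D2 p - D2 (t, x)) < e / 2"
      using C1_on_fderiv_near[OF C1(2) open_O1 tx half_gt_zero[OF e]] by auto
    have "(t, x) \<in> ball (t, x) r" using r by simp
    from box_in_open[OF open_ball this] obtain d where d: "d > 0"
      "\<And>s y. \<bar>s - t\<bar> < d \<Longrightarrow> norm (y - x) < d \<Longrightarrow> (s, y) \<in> ball (t, x) r" by metis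
    have "P 0 s y z" if "\<bar>s - t\<bar> < d" "norm (y - x) < d" "norm (z - x) < d" for s y z
    proof -
      have "(s, y) \<in> ball (t, x) r" "(s, z) \<in> ball (t, x) r" using d that by auto
      then show ?thesis
        using r(2) r(3)[of "(s, y)"] r(3)[of "(s, z)"]
          norm_triangle_ineq4[of "D2 (s, y) - D2 (t, x)" "D2 (s, z) - D2 (t, x)"]
        by (auto simp: P_def)
    qed
    then show "\<exists>d>0. \<exists>K. \<forall>s y z. \<bar>s - t\<bar> < d \<longrightarrow> norm (y - x) < d \<longrightarrow> norm (z - x) < d \<longrightarrow> P K s y z"
      using d(1) by blast
  next
    fix K s s' y z assume "same_end s s'" "P K s y z"
    then show "P K s' y z"
      using same_end_shift(1)[of s s'] same_end_fderiv(2)[of s s'] by (auto simp: P_def)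
  qed (auto simp: P_def)
  then obtain r where "r > 0" "\<And>s y z. norm (y - u s) < r \<Longrightarrow> norm (z - u s) < r \<Longrightarrow> P 1 s y z"
    unfolding P_def by metis
  then show ?thesis unfolding P_def by (metis cancel_comm_monoid_add_class.diff_cancel norm_zero)
qed

lemma slice_derivative_D:
  assumes "(t, w) \<in> O1"
  shows "((\<lambda>w. D (t, w)) has_derivative (\<lambda>h. D2 (t, w) (0, h))) (at w)"
proof -
  have "((\<lambda>w. (t, w)) has_derivative (\<lambda>h. (0, h))) (at w)"
    by (auto intro!: derivative_eq_intros)
  from has_derivative_compose[OF this C1_onD[OF C1(2) assms]] show ?thesis .
qed

lemma fderiv_linear_approx:
  assumes B: "convex B" "y \<in> B" "z \<in> B" and e: "0 \<le> e" and L: "bounded_linear L"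
    and le: "\<And>w. w \<in> B \<Longrightarrow> (s, w) \<in> O1 \<and> (\<forall>h. norm (D2 (s, w) (0, h) - L h) \<le> e * norm h)"
  shows "norm (D (s, y) - D (s, z) - L (y - z)) \<le> e * norm (y - z)"
  by (rule strict_linear_approximation[OF B e _ L, where f="\<lambda>w. D (s, w)" and f'="\<lambda>w h. D2 (s, w) (0, h)"])
    (use le slice_derivative_D in auto)

lemma norm_apply_Pair_le: "norm (blinfun_apply A (0, h :: 'a)) \<le> norm A * norm h"
  using norm_blinfun[of A "(0, h)"] by (simp add: norm_Pair)

text \<open>At the ends \<open>\<phi> (s, 0) = 0\<close>, hence \<open>\<psi> (s, 0) = 0\<close>,
  and integrating the first order bound from 0 gives a linear bound in place of
  \<open>1 + norm y\<close>. The product \<open>norm w * norm (\<iota> y)\<close> is linear too, as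
  its H1 factor is below \<open>d\<close>. One time per end suffices, by constancy.\<close>

lemma \<psi>_linear_at_ends:
  "\<exists>d>0. \<exists>K. \<forall>s y. T < \<bar>s\<bar> \<longrightarrow> norm (\<iota> y) < d \<longrightarrow> norm (\<psi> (s, y)) \<le> K * norm y"
proof -
  have one: "\<exists>d>0. \<exists>K. \<forall>y. norm (\<iota> y) < d \<longrightarrow> (t, \<iota> y) \<in> O1 \<and> norm (\<psi> (t, y)) \<le> K * norm y"
    if t: "T < \<bar>t\<bar>" for t
  proof -
    have t0: "(t, 0) \<in> O1" "\<phi> (t, 0) = 0" using zero_ends[of t] t by (auto simp: slice_def)
    obtain d K where d: "d > 0" "\<And>y z. norm y < d \<Longrightarrow> norm z < d \<Longrightarrow> good K t y z"
      using good_local[OF t0(1)] by (metis abs_zero diff_self diff_zero)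
    have "\<iota> (\<psi> (t, 0)) = \<iota> 0" using incl_\<psi>[of t 0] t0 by simp
    then have z: "\<psi> (t, 0) = 0" using inj_incl by (metis injD)
    have "(t, \<iota> y) \<in> O1 \<and> norm (\<psi> (t, y)) \<le> (\<bar>K\<bar> * (1 + d)) * norm y" if y: "norm (\<iota> y) < d" for y
    proof
      show "(t, \<iota> y) \<in> O1" using d(2)[OF y y] by (simp add: good_def)
      have "norm (\<psi> (t, y) - \<psi> (t, 0)) \<le> (\<bar>K\<bar> * (1 + d)) * norm y"
      proof (rule norm_diff_le_segment[where f="\<lambda>w. \<psi> (t, w)"])
        fix w assume "w \<in> closed_segment 0 y"
        then obtain c where c: "0 \<le> c" "c \<le> 1" "w = c *\<^sub>R y" by (auto simp: closed_segment_def)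
        have w: "norm w \<le> norm y" using c by (simp add: mult_left_le_one_le)
        have "norm (\<iota> w) \<le> norm (\<iota> y)" using c by (simp add: incl.scaleR mult_left_le_one_le)
        then have iw: "norm (\<iota> w) < d" using y by simp
        then have g: "good K t (\<iota> w) (\<iota> w)" by (rule d(2)[OF _ iw])
        then show "((\<lambda>w. \<psi> (t, w)) has_derivative (\<lambda>h. fderiv \<psi> (t, w) (0, h))) (at w)"
          by (intro slice_derivative_\<psi>) (simp add: good_def)
        have "norm (fderiv \<psi> (t, w) (0, y - 0)) \<le> K * (norm y + norm w * norm (\<iota> y))"
          using g by (auto simp: good_def tame_estimates_def)
        also have "\<dots> \<le> \<bar>K\<bar> * (norm y + norm y * d)"
          using w y by (intro mult_mono add_mono) auto
        finally show "norm (fderiv \<psi> (t, w) (0, y - 0)) \<le> (\<bar>K\<bar> * (1 + d)) * norm y"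
          by (simp add: algebra_simps)
      qed
      then show "norm (\<psi> (t, y)) \<le> (\<bar>K\<bar> * (1 + d)) * norm y" by (simp add: z)
    qed
    then show ?thesis using d(1) by blast
  qed
  obtain d1 K1 where 1: "d1 > 0" "\<And>y. norm (\<iota> y) < d1 \<Longrightarrow> (T + 1, \<iota> y) \<in> O1 \<and> norm (\<psi> (T + 1, y)) \<le> K1 * norm y"
    using one[of "T + 1"] T_pos by auto
  obtain d2 K2 where 2: "d2 > 0" "\<And>y. norm (\<iota> y) < d2 \<Longrightarrow> (- T - 1, \<iota> y) \<in> O1 \<and> norm (\<psi> (- T - 1, y)) \<le> K2 * norm y"
    using one[of "- T - 1"] T_pos by auto
  have "norm (\<psi> (s, y)) \<le> max K1 K2 * norm y" if s: "T < \<bar>s\<bar>" and y: "norm (\<iota> y) < min d1 d2" for s y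
  proof (cases "s > 0")
    case True
    then have "same_end (T + 1) s" using s T_pos by (auto simp: same_end_def)
    then have "\<psi> (s, y) = \<psi> (T + 1, y)" using same_end_\<psi>(1) 1(2)[of y] y by simp
    then show ?thesis
      using 1(2)[of y] y mult_right_mono[of K1 "max K1 K2" "norm y"] by auto
  next
    case False
    then have "same_end (- T - 1) s" using s T_pos by (auto simp: same_end_def)
    then have "\<psi> (s, y) = \<psi> (- T - 1, y)" using same_end_\<psi>(1) 2(2)[of y] y by simp
    then show ?thesis
      using 2(2)[of y] y mult_right_mono[of K2 "max K1 K2" "norm y"] by auto
  qed
  then show ?thesis using 1(1) 2(1) by (intro exI[of _ "min d1 d2"]) auto
qed

end

section \<open>The induced map and its derivative\<close>

lemma power2_sum4_le:
  fixes p q r t :: real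
  shows "(p + q + r + t)\<^sup>2 \<le> 4 * (p\<^sup>2 + q\<^sup>2 + r\<^sup>2 + t\<^sup>2)"
proof -
  have "4 * (p\<^sup>2 + q\<^sup>2 + r\<^sup>2 + t\<^sup>2) - (p + q + r + t)\<^sup>2 =
    (p - q)\<^sup>2 + (p - r)\<^sup>2 + (p - t)\<^sup>2 + (q - r)\<^sup>2 + (q - t)\<^sup>2 + (r - t)\<^sup>2"
    by (simp add: power2_eq_square algebra_simps)
  moreover have "\<dots> \<ge> 0" by (intro add_nonneg_nonneg) auto
  ultimately show ?thesis by linarith
qed

lemma sum4_power2_le:
  fixes p q r t :: real
  assumes "0 \<le> p" "0 \<le> q" "0 \<le> r" "0 \<le> t"
  shows "p\<^sup>2 + q\<^sup>2 + r\<^sup>2 + t\<^sup>2 \<le> (p + q + r + t)\<^sup>2"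
proof -
  have "(p + q + r + t)\<^sup>2 - (p\<^sup>2 + q\<^sup>2 + r\<^sup>2 + t\<^sup>2) =
    2 * (p * q + p * r + p * t + q * r + q * t + r * t)"
    by (simp add: power2_eq_square algebra_simps)
  moreover have "\<dots> \<ge> 0" using assms by (intro mult_nonneg_nonneg add_nonneg_nonneg) auto
  ultimately show ?thesis by linarith
qed

lemma blinfun_apply_Pair_split:
  "blinfun_apply A (c, x) = blinfun_apply A (c, 0) + blinfun_apply A (0, x)"
  by (simp flip: blinfun.add_right)

context tame_path_map
begin

lemma tame_bound_le:
  assumes "c \<le> c'" "0 \<le> c'" "norm (\<iota> \<xi>) \<le> A" "norm \<xi> \<le> X" "norm (\<iota> \<eta>) \<le> B"
  shows "tame_bound c \<xi> \<eta> \<le> A * norm \<eta> + X * B + c' * A * B"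
proof -
  have nn: "0 \<le> A" "0 \<le> X" "0 \<le> B" using assms norm_ge_zero order_trans by blast+
  have "tame_bound c \<xi> \<eta> \<le> tame_bound c' \<xi> \<eta>" by (rule tame_bound_mono) fact
  also have "\<dots> \<le> A * norm \<eta> + X * B + c' * A * B"
    unfolding tame_bound_def using assms nn by (intro add_mono mult_mono mult_nonneg_nonneg) auto
  finally show ?thesis .
qed

text \<open>Takes the place of the constant 1 coming from the unit time direction, whose effect
  vanishes beyond \<open>T\<close>; unlike the constant, it is square integrable.\<close>

definition core :: "real \<Rightarrow> real" where "core = indicator {-T..T}"

lemma core_facts:
  "0 \<le> core s" "(core s)\<^sup>2 = core s" "\<bar>s\<bar> \<le> T \<Longrightarrow> core s = 1" "T < \<bar>s\<bar> \<Longrightarrow> core s = 0"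
  "integrable lborel core" "integral\<^sup>L lborel core = 2 * T"
  using T_pos by (auto simp: core_def indicator_def power2_eq_square split: if_splits)

lemma square_integrable_combination:
  fixes r :: "real \<Rightarrow> 'x::{banach, second_countable_topology}"
    and x :: "real \<Rightarrow> 'y::{banach, second_countable_topology}"
    and y :: "real \<Rightarrow> 'z::{banach, second_countable_topology}"
  assumes r: "r \<in> borel_measurable borel" and sq: "square_integrable x" "square_integrable y"
    and le: "AE s in lborel. norm (r s) \<le> a * (core s + norm (x s)) + b * norm (y s)"
  shows "square_integrable r"
proof (rule square_integrable_bound[OF r])
  let ?G = "\<lambda>s. 4 * (a\<^sup>2 * core s + a\<^sup>2 * (norm (x s))\<^sup>2 + b\<^sup>2 * (norm (y s))\<^sup>2)"
  show "integrable lborel ?G"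
    using sq core_facts(5) by (simp add: square_integrable_def)
  show "AE s in lborel. (norm (r s))\<^sup>2 \<le> ?G s"
    using le
  proof eventually_elim
    case (elim s)
    have "(norm (r s))\<^sup>2 \<le> (a * core s + a * norm (x s) + b * norm (y s) + 0)\<^sup>2"
      using elim by (intro power_mono) (auto simp: distrib_left)
    also have "\<dots> \<le> 4 * ((a * core s)\<^sup>2 + (a * norm (x s))\<^sup>2 + (b * norm (y s))\<^sup>2 + 0\<^sup>2)"
      by (rule power2_sum4_le)
    finally show ?case by (simp add: power_mult_distrib core_facts(2))
  qed
qed

lemma path_norm_power2:
  assumes "is_path \<iota> \<xi> v f"
  shows "(LINT s|lborel. (norm (v s))\<^sup>2 + (norm (f s))\<^sup>2) = (pnorm \<xi>)\<^sup>2"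
proof -
  have i: "integrable lborel (\<lambda>s. (norm (v s))\<^sup>2)" "integrable lborel (\<lambda>s. (norm (f s))\<^sup>2)"
    using assms by (auto simp: is_path_def square_integrable_def)
  have "0 \<le> (LINT s|lborel. (norm (v s))\<^sup>2) + (LINT s|lborel. (norm (f s))\<^sup>2)"
    by (intro add_nonneg_nonneg integral_nonneg_AE) auto
  then show ?thesis using i by (simp add: path_norm_eq[OF assms])
qed

text \<open>Turns pointwise bounds on the velocity and the H2 version into a bound on the path norm.
  Squaring a sum of four terms costs a factor 4, hence the 2 after the root;
  \<open>sqrt (2 * T)\<close> is the norm of \<open>core\<close>. Velocity and H2 version of each
  path share a coefficient so that their integrals combine to its squared norm.\<close>

lemma path_norm_combination:
  assumes R: "is_path \<iota> R rv rf" and u: "is_path \<iota> u v f" and k: "is_path \<iota> k w g"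
    and h: "is_path \<iota> h l g'"
    and rv: "AE s in lborel. norm (rv s) \<le> a * (core s + norm (v s)) + b * norm (w s) + c * norm (l s)"
    and rf: "AE s in lborel. norm (rf s) \<le> a * norm (f s) + b * norm (g s) + c * norm (g' s)"
    and abc: "0 \<le> a" "0 \<le> b" "0 \<le> c"
  shows "pnorm R \<le>
    2 * (a * (sqrt (2 * T) + pnorm u) + b * pnorm k + c * pnorm h)"
proof (rule path_norm_le[OF R])
  let ?E = "\<lambda>v f s. (norm (v s))\<^sup>2 + (norm (f s))\<^sup>2"
  let ?G = "\<lambda>s. 4 * (a\<^sup>2 * core s + a\<^sup>2 * ?E v f s + b\<^sup>2 * ?E w g s + c\<^sup>2 * ?E l g' s)"
  have i: "integrable lborel (?E v f)" "integrable lborel (?E w g)" "integrable lborel (?E l g')"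
    using u k h by (auto simp: is_path_def square_integrable_def)
  show "integrable lborel ?G" using i core_facts(5) by (intro integrable_mult_right integrable_add) auto
  show "AE s in lborel. (norm (rv s))\<^sup>2 + (norm (rf s))\<^sup>2 \<le> ?G s"
    using rv rf
  proof eventually_elim
    case (elim s)
    have "(norm (rv s))\<^sup>2 \<le> (a * core s + a * norm (v s) + b * norm (w s) + c * norm (l s))\<^sup>2"
      using elim(1) by (intro power_mono) (auto simp: distrib_left)
    also have "\<dots> \<le> 4 * ((a * core s)\<^sup>2 + (a * norm (v s))\<^sup>2 + (b * norm (w s))\<^sup>2 + (c * norm (l s))\<^sup>2)"
      by (rule power2_sum4_le)
    finally have 1: "(norm (rv s))\<^sup>2 \<le>
      4 * ((a * core s)\<^sup>2 + (a * norm (v s))\<^sup>2 + (b * norm (w s))\<^sup>2 + (c * norm (l s))\<^sup>2)" .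
    have "(norm (rf s))\<^sup>2 \<le> (0 + a * norm (f s) + b * norm (g s) + c * norm (g' s))\<^sup>2"
      using elim(2) by (intro power_mono) auto
    also have "\<dots> \<le> 4 * (0\<^sup>2 + (a * norm (f s))\<^sup>2 + (b * norm (g s))\<^sup>2 + (c * norm (g' s))\<^sup>2)"
      by (rule power2_sum4_le)
    finally have 2: "(norm (rf s))\<^sup>2 \<le>
      4 * (0\<^sup>2 + (a * norm (f s))\<^sup>2 + (b * norm (g s))\<^sup>2 + (c * norm (g' s))\<^sup>2)" .
    show ?case using add_mono[OF 1 2] by (simp add: power_mult_distrib core_facts(2) algebra_simps)
  qed
  let ?n = "pnorm"
  have "integral\<^sup>L lborel ?G = 4 * (a\<^sup>2 * (2 * T) + a\<^sup>2 * (?n u)\<^sup>2 + b\<^sup>2 * (?n k)\<^sup>2 + c\<^sup>2 * (?n h)\<^sup>2)"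
    unfolding path_norm_power2[OF u, symmetric] path_norm_power2[OF k, symmetric]
      path_norm_power2[OF h, symmetric] core_facts(6)[symmetric]
    using i core_facts(5) by simp
  also have "\<dots> = 4 * ((a * sqrt (2 * T))\<^sup>2 + (a * ?n u)\<^sup>2 + (b * ?n k)\<^sup>2 + (c * ?n h)\<^sup>2)"
    using T_pos by (simp add: power_mult_distrib)
  also have "\<dots> \<le> 4 * (a * sqrt (2 * T) + a * ?n u + b * ?n k + c * ?n h)\<^sup>2"
    using abc T_pos path_norm_bounds(1)[OF u] path_norm_bounds(1)[OF k] path_norm_bounds(1)[OF h]
    by (intro mult_left_mono sum4_power2_le) auto
  also have "\<dots> = (2 * (a * (sqrt (2 * T) + ?n u) + b * ?n k + c * ?n h))\<^sup>2"
    by (simp only: power_mult_distrib distrib_left[of a]) simp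
  finally show "integral\<^sup>L lborel ?G \<le> (2 * (a * (sqrt (2 * T) + ?n u) + b * ?n k + c * ?n h))\<^sup>2" .
  show "0 \<le> 2 * (a * (sqrt (2 * T) + ?n u) + b * ?n k + c * ?n h)"
    using abc T_pos path_norm_bounds(1)[OF u] path_norm_bounds(1)[OF k] path_norm_bounds(1)[OF h]
    by (intro mult_nonneg_nonneg add_nonneg_nonneg) auto
qed

text \<open>Splits off the time direction \<open>(1, 0)\<close>, on which \<open>A\<close> vanishes
  beyond \<open>T\<close>; what remains of it is absorbed by \<open>core\<close>.\<close>

lemma norm_apply_time_le:
  fixes A :: "(real \<times> 'a) \<Rightarrow>\<^sub>L 'x::real_normed_vector"
  assumes "T < \<bar>s\<bar> \<Longrightarrow> blinfun_apply A (1, 0) = 0" "norm A \<le> K"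
  shows "norm (blinfun_apply A (1, x)) \<le> K * (core s + norm x)"
proof -
  have "norm (blinfun_apply A (1, 0)) \<le> norm A * core s"
    using assms(1) norm_blinfun[of A "(1, 0)"] by (cases "T < \<bar>s\<bar>") (auto simp: core_facts norm_Pair)
  then have "norm (blinfun_apply A (1, x)) \<le> norm A * core s + norm A * norm x"
    unfolding blinfun_apply_Pair_split[of A 1 x] by (intro norm_triangle_mono norm_apply_Pair_le)
  also have "\<dots> = norm A * (core s + norm x)" by (simp add: distrib_left)
  also have "\<dots> \<le> K * (core s + norm x)"
    using assms(2) by (intro mult_right_mono add_nonneg_nonneg core_facts) auto
  finally show ?thesis .
qed

lemma norm_apply_space_le:
  fixes A :: "(real \<times> 'a) \<Rightarrow>\<^sub>L 'x::real_normed_vector"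
  shows "norm A \<le> K \<Longrightarrow> norm (blinfun_apply A (0, x)) \<le> K * norm x"
  by (rule order_trans[OF norm_apply_Pair_le mult_right_mono]) auto

lemma D2_time_le:
  assumes "(s, y) \<in> O1" "norm (D2 (s, y)) \<le> K"
  shows "norm (D2 (s, y) (1, v)) \<le> K * (core s + norm v)"
  by (rule norm_apply_time_le) (use assms ends_time_derivative in auto)

text \<open>The H2 version agrees with the path only almost everywhere, so on a null set
  \<open>(s, f s)\<close> may lie outside \<open>O2\<close>, where nothing is known about
  \<open>\<psi>\<close>. Cutting off there keeps the composition Borel measurable.\<close>

definition lift0 :: "(real \<Rightarrow> 'b) \<Rightarrow> real \<Rightarrow> 'b" where
  "lift0 f s = indicator O2 (s, f s) *\<^sub>R \<psi> (s, f s)"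

definition lift1 :: "(real \<Rightarrow> 'b) \<Rightarrow> (real \<Rightarrow> 'b) \<Rightarrow> real \<Rightarrow> 'b" where
  "lift1 f g s = indicator O2 (s, f s) *\<^sub>R fderiv \<psi> (s, f s) (0, g s)"

lemma lift_eq:
  assumes "(s, \<iota> (f s)) \<in> O1"
  shows "lift0 f s = \<psi> (s, f s)" "lift1 f g s = fderiv \<psi> (s, f s) (0, g s)"
  using assms by (auto simp: lift0_def lift1_def indicator_def)

lemma lift_measurable:
  assumes [measurable]: "f \<in> borel_measurable borel" "g \<in> borel_measurable borel"
  shows "lift0 f \<in> borel_measurable borel" "lift1 f g \<in> borel_measurable borel"
proof -
  have "continuous_on O2 \<psi>"
    by (intro differentiable_imp_continuous_on)
      (use C1(3) in \<open>auto simp: C1_on_def differentiable_on_def intro: differentiable_at_withinI\<close>)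
  then have [measurable]: "(\<lambda>z. indicator O2 z *\<^sub>R \<psi> z) \<in> borel_measurable borel"
    using open_O2 by (intro borel_measurable_continuous_on_indicator) auto
  have "(\<lambda>s. (\<lambda>z. indicator O2 z *\<^sub>R \<psi> z) (s, f s)) \<in> borel_measurable borel"
    by measurable
  then show "lift0 f \<in> borel_measurable borel" by (simp add: lift0_def[abs_def])
  let ?V = "O2 \<times> (UNIV :: 'b set)"
  have "continuous_on ?V (\<lambda>x. fderiv \<psi> (fst x) (0, snd x))"
  proof (intro blinfun.continuous_on continuous_intros)
    show "continuous_on ?V (\<lambda>x. fderiv \<psi> (fst x))"
      by (rule continuous_on_compose2[of O2 "fderiv \<psi>"])
        (use C1(3) in \<open>auto simp: C1_on_def intro!: continuous_intros\<close>)
  qed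
  then have [measurable]: "(\<lambda>x. indicator ?V x *\<^sub>R fderiv \<psi> (fst x) (0, snd x)) \<in> borel_measurable borel"
    using borel_open[OF open_Times[OF open_O2 open_UNIV]] by (intro borel_measurable_continuous_on_indicator)
  have "(\<lambda>s. (\<lambda>x. indicator ?V x *\<^sub>R fderiv \<psi> (fst x) (0, snd x)) ((s, f s), g s)) \<in> borel_measurable borel"
    by measurable
  then show "lift1 f g \<in> borel_measurable borel"
    by (simp add: lift1_def[abs_def] indicator_def)
qed

lemma primitive_of_graph:
  assumes "is_path \<iota> u v f"
  shows "primitive_of (\<lambda>s. (s, u s)) (\<lambda>s. (1, v s))"
  by (rule primitive_of_Pair, rule primitive_of_C1) (use assms in \<open>auto simp: is_path_def\<close>)

text \<open>The velocity is dominated by \<open>core\<close> plus \<open>norm (v s)\<close> since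
  time derivatives vanish at the ends. The H2 version has the growth \<open>1 + norm (f s)\<close>
  near the core and is bounded linearly at the ends.\<close>

lemma is_path_path_map:
  assumes u: "is_path \<iota> u v f" and adm: "\<And>s. (s, u s) \<in> O1"
  shows "is_path \<iota> (path_map \<phi> u) (\<lambda>s. D (s, u s) (1, v s)) (lift0 f)"
proof -
  obtain r K where r: "r > 0" and K: "K > 0" and good: "\<And>s y z. norm (y - u s) < r \<Longrightarrow> norm (z - u s) < r \<Longrightarrow> good K s y z"
    using tube_good[OF u adm] by metis
  have g: "good K s (u s) (u s)" for s using good[of "u s" s "u s"] r by simp
  obtain d M where d: "d > 0" and M: "\<And>s y. T < \<bar>s\<bar> \<Longrightarrow> norm (\<iota> y) < d \<Longrightarrow> norm (\<psi> (s, y)) \<le> M * norm y"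
    using \<psi>_linear_at_ends by metis
  have sq: "square_integrable v" "square_integrable f" using u by (auto simp: is_path_def)
  have pr: "primitive_of (\<lambda>s. \<phi> (s, u s)) (\<lambda>s. D (s, u s) (1, v s))"
    by (rule primitive_of_C1_compose[OF C1(1) open_O1 primitive_of_graph[OF u] adm])
  have ae: "AE s in lborel. \<iota> (f s) = u s" using u by (simp add: is_path_def)
  have "square_integrable (\<lambda>s. D (s, u s) (1, v s))"
  proof (rule square_integrable_combination[OF primitive_ofD(2)[OF pr] sq(1) sq(1), where a=K and b=0])
    have "norm (D (s, u s) (1, v s)) \<le> K * (core s + norm (v s))" for s
      by (rule norm_apply_time_le) (use ends_time_derivative[OF _ adm] g[of s] in \<open>auto simp: good_def\<close>)
    then show "AE s in lborel. norm (D (s, u s) (1, v s)) \<le> K * (core s + norm (v s)) + 0 * norm (v s)"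
      by simp
  qed
  moreover have "square_integrable (lift0 f)"
  proof (rule square_integrable_combination[OF _ sq(2) sq(2), where b=0])
    show "lift0 f \<in> borel_measurable borel"
      using sq(2) by (intro lift_measurable(1)) (auto simp: square_integrable_def)
    \<comment> \<open>One constant for three cases: times in the core; end times at which the linear
      bound with \<open>M\<close> applies; and end times with \<open>d \<le> norm (f s)\<close>,
      where the 1 in the growth bound is at most \<open>norm (f s) / d\<close>.\<close>
    let ?a = "K + \<bar>M\<bar> + K / d"
    show "AE s in lborel. norm (lift0 f s) \<le> ?a * (core s + norm (f s)) + 0 * norm (f s)"
      using ae
    proof eventually_elim
      case (elim s)
      have O1: "(s, \<iota> (f s)) \<in> O1" using adm[of s] elim by simp
      have est: "norm (\<psi> (s, f s)) \<le> K * (1 + norm (f s))"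
        using g[of s] elim by (auto simp: good_def tame_estimates_def)
      have a0: "0 \<le> K / d" using K d by simp
      have "norm (\<psi> (s, f s)) \<le> ?a * (core s + norm (f s))"
      proof (cases "T < \<bar>s\<bar>")
        case False
        have "K * (1 + norm (f s)) \<le> ?a * (1 + norm (f s))"
          using a0 by (intro mult_right_mono) auto
        then show ?thesis using est False core_facts(3)[of s] by simp
      next
        case True
        have "norm (\<psi> (s, f s)) \<le> ?a * norm (f s)"
        proof (cases "norm (\<iota> (f s)) < d")
          case True
          have "M * norm (f s) \<le> ?a * norm (f s)"
            using a0 K by (intro mult_right_mono) auto
          then show ?thesis using M[OF \<open>T < \<bar>s\<bar>\<close> True] by simp
        next
          case False
          then have "d \<le> norm (f s)" using norm_incl_le[of "f s"] by simp
          then have "K * 1 \<le> K * (norm (f s) / d)" using K d by (intro mult_left_mono) auto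
          then have "K * (1 + norm (f s)) \<le> (K + K / d) * norm (f s)" by (simp add: algebra_simps)
          also have "\<dots> \<le> ?a * norm (f s)" by (intro mult_right_mono) auto
          finally show ?thesis using est by simp
        qed
        then show ?thesis using core_facts(4)[OF True] by simp
      qed
      then show ?case by (simp add: lift_eq(1)[of s f, OF O1])
    qed
  qed
  moreover have "AE s in lborel. \<iota> (lift0 f s) = path_map \<phi> u s"
    using ae by eventually_elim (use adm in \<open>simp add: lift_eq(1) incl_\<psi> path_map_def\<close>)
  ultimately show ?thesis using pr by (simp add: is_path_def path_map_def[abs_def])
qed

section \<open>The candidate derivative and its operator bound\<close>

definition D_path_map :: "(real \<Rightarrow> 'a) \<Rightarrow> (real \<Rightarrow> 'a) \<Rightarrow> real \<Rightarrow> 'a" where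
  "D_path_map u h s = D (s, u s) (0, h s)"

text \<open>In the product of the base point and the direction only the base point carries an H2
  norm. The direction enters through its H1 sup bound \<open>H\<close>, so the product stays square
  integrable along a path.\<close>

lemma D_path_map_bounds:
  assumes g: "good K s y y" and f: "\<iota> f = y" and g': "\<iota> g = h" and h: "norm h \<le> H"
  shows "norm (fderiv \<psi> (s, f) (0, g)) \<le> K * H * norm f + K * norm g"
proof -
  have K: "0 \<le> K" using g norm_ge_zero order_trans unfolding good_def by blast
  have "norm (fderiv \<psi> (s, f) (0, g)) \<le> K * (norm g + norm f * norm (\<iota> g))"
    using g f by (auto simp: good_def tame_estimates_def)
  also have "\<dots> \<le> K * (norm g + norm f * H)"
    using K h g' by (intro mult_left_mono add_left_mono) auto
  finally show ?thesis by (simp add: algebra_simps)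
qed

lemma is_path_D_path_map:
  assumes u: "is_path \<iota> u v f" and adm: "\<And>s. (s, u s) \<in> O1" and h: "is_path \<iota> h w g"
    and good: "\<And>s. good K s (u s) (u s)"
  shows "is_path \<iota> (D_path_map u h) (\<lambda>s. D2 (s, u s) (1, v s) (0, h s) + D (s, u s) (0, w s)) (lift1 f g)"
    and "pnorm (D_path_map u h) \<le> 2 * (2 * K * (sqrt (2 * T) + pnorm u) + K) * pnorm h"
proof -
  let ?dv = "\<lambda>s. D2 (s, u s) (1, v s) (0, h s) + D (s, u s) (0, w s)"
  \<comment> \<open>The sup bound of \<open>h\<close> in H1; it multiplies the square integrable
    quantities \<open>v\<close> and \<open>f\<close> and yields the factor \<open>2 * K\<close> in
    the operator bound.\<close>
  define H where "H = 2 * pnorm h"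
  have hH: "norm (h s) \<le> H" for s unfolding H_def by (rule is_path_sup_le[OF h])
  have H: "0 \<le> H" using norm_ge_zero order_trans hH by blast
  have K: "0 \<le> K" using good[of 0] norm_ge_zero order_trans unfolding good_def by blast
  have sq: "square_integrable v" "square_integrable f" "square_integrable w" "square_integrable g"
    using u h by (auto simp: is_path_def)
  have "primitive_of (\<lambda>s. (0::real)) (\<lambda>s. 0)" by (rule primitive_of_C1) auto
  then have "primitive_of (\<lambda>s. (0::real, h s)) (\<lambda>s. (0, w s))"
    by (rule primitive_of_Pair) (use h in \<open>auto simp: is_path_def\<close>)
  from primitive_of_fderiv_apply[OF C2_\<phi> open_O1 primitive_of_graph[OF u] adm this]
  have pr: "primitive_of (D_path_map u h) ?dv" by (simp add: D_path_map_def[abs_def])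
  have ae: "AE s in lborel. \<iota> (f s) = u s \<and> \<iota> (g s) = h s"
    using u h by (auto simp: is_path_def)
  have dv: "norm (?dv s) \<le> K * H * (core s + norm (v s)) + K * norm (w s)" for s
  proof -
    have "norm (D2 (s, u s) (1, v s)) \<le> K * (core s + norm (v s))"
      using good[of s] by (intro D2_time_le adm) (simp add: good_def)
    then have "norm (D2 (s, u s) (1, v s) (0, h s)) \<le> K * (core s + norm (v s)) * norm (h s)"
      by (rule norm_apply_space_le)
    also have "\<dots> \<le> K * (core s + norm (v s)) * H"
      using K core_facts(1)[of s] by (intro mult_left_mono hH mult_nonneg_nonneg add_nonneg_nonneg) auto
    finally have 1: "norm (D2 (s, u s) (1, v s) (0, h s)) \<le> K * H * (core s + norm (v s))"
      by (simp only: mult_ac)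
    have 2: "norm (D (s, u s) (0, w s)) \<le> K * norm (w s)"
      using good[of s] by (intro norm_apply_space_le) (simp add: good_def)
    show ?thesis by (rule norm_triangle_mono[OF 1 2])
  qed
  have lf: "AE s in lborel. norm (lift1 f g s) \<le> K * H * norm (f s) + K * norm (g s)"
    using ae
  proof eventually_elim
    case (elim s)
    have "(s, \<iota> (f s)) \<in> O1" using adm[of s] elim by simp
    then show ?case
      using D_path_map_bounds[OF good _ _ hH, of "f s" s "g s" s] elim by (simp add: lift_eq(2))
  qed
  have "square_integrable ?dv"
    by (rule square_integrable_combination[OF primitive_ofD(2)[OF pr] sq(1) sq(3)]) (use dv in auto)
  moreover have "square_integrable (lift1 f g)"
  proof (rule square_integrable_combination[OF _ sq(2) sq(4)])
    show "lift1 f g \<in> borel_measurable borel"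
      using sq by (intro lift_measurable(2)) (auto simp: square_integrable_def)
    show "AE s in lborel. norm (lift1 f g s) \<le> K * H * (core s + norm (f s)) + K * norm (g s)"
      using lf
    proof eventually_elim
      case (elim s)
      have "0 \<le> K * H * core s" using K H core_facts(1) by simp
      then show ?case using elim by (simp add: distrib_left)
    qed
  qed
  moreover have "AE s in lborel. \<iota> (lift1 f g s) = D_path_map u h s"
    using ae by eventually_elim (use adm in \<open>simp add: lift_eq(2) incl_fderiv_\<psi>(1) D_path_map_def\<close>)
  ultimately show path: "is_path \<iota> (D_path_map u h) ?dv (lift1 f g)"
    using pr by (simp add: is_path_def)
  have "pnorm (D_path_map u h) \<le>
    2 * (K * H * (sqrt (2 * T) + pnorm u) + K * pnorm h + 0 * pnorm h)"
    by (rule path_norm_combination[OF path u h h]) (use dv lf K H in auto)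
  then show "pnorm (D_path_map u h) \<le> 2 * (2 * K * (sqrt (2 * T) + pnorm u) + K) * pnorm h"
    by (simp add: H_def algebra_simps)
qed

text \<open>Symmetry rewrites the mixed term as \<open>D2 (s, y) (0, y' - y) (1, v)\<close>. The
  remainder is then the Taylor remainder \<open>A\<close> of \<open>D\<close> applied to
  \<open>(1, v)\<close>, plus an increment of \<open>D\<close> applied to \<open>v' - v\<close>. The
  first is small through \<open>e\<close>, the variation of \<open>D2\<close> in the tube, and
  \<open>A\<close> annihilates the time direction at the ends; the second is a product of two
  increments.\<close>

lemma velocity_remainder:
  assumes ball: "\<And>w. norm (w - y) < r \<Longrightarrow>
      (s, w) \<in> O1 \<and> norm (D2 (s, w)) \<le> K \<and> norm (D2 (s, w) - D2 (s, y)) \<le> e"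
    and y': "norm (y' - y) < r" and e: "0 \<le> e"
  shows "norm (D (s, y') - D (s, y)) \<le> K * norm (y' - y)"
    and "norm (D (s, y') (1, v') - D (s, y) (1, v) - (D2 (s, y) (1, v) (0, y' - y) + D (s, y) (0, v' - v)))
      \<le> e * norm (y' - y) * (core s + norm v) + K * norm (y' - y) * norm (v' - v)"
proof -
  have r: "r > 0" using y' norm_ge_zero order.strict_trans1 by blast
  have yB: "y' \<in> ball y r" "y \<in> ball y r" using y' r by (auto simp: dist_norm norm_minus_commute)
  have B: "(s, w) \<in> O1" "norm (D2 (s, w)) \<le> K" "norm (D2 (s, w) - D2 (s, y)) \<le> e" if "w \<in> ball y r" for w
    using ball[of w] that by (auto simp: dist_norm norm_minus_commute)
  have K: "0 \<le> K" using B(2)[OF yB(2)] norm_ge_zero order_trans by blast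
  have "norm (D (s, y') - D (s, y) - 0) \<le> K * norm (y' - y)"
    by (rule fderiv_linear_approx[OF convex_ball yB K, where L="\<lambda>_. 0"])
      (use B in \<open>auto intro: norm_apply_space_le\<close>)
  then show 1: "norm (D (s, y') - D (s, y)) \<le> K * norm (y' - y)" by simp
  have 2: "norm (D (s, y') - D (s, y) - D2 (s, y) (0, y' - y)) \<le> e * norm (y' - y)"
  proof (rule fderiv_linear_approx[OF convex_ball yB e, where L="\<lambda>h. D2 (s, y) (0, h)"])
    show "bounded_linear (\<lambda>h. D2 (s, y) (0, h))"
      by (intro bounded_linear_compose[OF blinfun.bounded_linear_right] bounded_linear_Pair
        bounded_linear_zero bounded_linear_ident)
    show "(s, w) \<in> O1 \<and> (\<forall>h. norm (D2 (s, w) (0, h) - D2 (s, y) (0, h)) \<le> e * norm h)" if "w \<in> ball y r" for w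
      using B(1)[OF that] norm_apply_space_le[OF B(3)[OF that]] by (simp add: blinfun.diff_left)
  qed
  define A where "A = D (s, y') - D (s, y) - D2 (s, y) (0, y' - y)"
  have "D (s, y') (1, v') - D (s, y) (1, v) - (D2 (s, y) (1, v) (0, y' - y) + D (s, y) (0, v' - v))
    = A (1, v) + (D (s, y') - D (s, y)) (0, v' - v)"
  proof -
    have "D (s, y') (1, v') = D (s, y') (1, v) + D (s, y') (0, v' - v)"
      by (simp flip: blinfun.add_right)
    then show ?thesis
      unfolding A_def second_derivative_symmetric[OF C2_\<phi> open_O1 B(1)[OF yB(2)], of "(1, v)"]
      by (simp add: blinfun.diff_left)
  qed
  also have "norm \<dots> \<le> e * norm (y' - y) * (core s + norm v) + K * norm (y' - y) * norm (v' - v)"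
  proof (rule norm_triangle_mono)
    show "norm (A (1, v)) \<le> e * norm (y' - y) * (core s + norm v)"
      by (rule norm_apply_time_le)
        (use 2 ends_time_derivative B(1) yB in \<open>auto simp: A_def blinfun.diff_left\<close>)
    show "norm ((D (s, y') - D (s, y)) (0, v' - v)) \<le> K * norm (y' - y) * norm (v' - v)"
      by (rule norm_apply_space_le[OF 1])
  qed
  finally show "norm (D (s, y') (1, v') - D (s, y) (1, v) - (D2 (s, y) (1, v) (0, y' - y) + D (s, y) (0, v' - v)))
      \<le> e * norm (y' - y) * (core s + norm v) + K * norm (y' - y) * norm (v' - v)" .
qed

text \<open>Telescoping: the base point of \<open>D2\<close>, the velocity and the base point of
  \<open>D\<close> are exchanged one after the other. The first exchange costs \<open>e\<close>, the
  other two are linear in the increments.\<close>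

lemma velocity_difference:
  assumes ball: "\<And>w. norm (w - y) < r \<Longrightarrow>
      (s, w) \<in> O1 \<and> norm (D2 (s, w)) \<le> K \<and> norm (D2 (s, w) - D2 (s, y)) \<le> e"
    and y': "norm (y' - y) < r" and e: "0 \<le> e"
  shows "norm (D2 (s, y') (1, v') (0, h) + D (s, y') (0, l) - (D2 (s, y) (1, v) (0, h) + D (s, y) (0, l)))
      \<le> e * norm h * (core s + norm v) + K * norm h * norm (v' - v) + K * norm (y' - y) * norm l"
proof -
  have r: "r > 0" using y' norm_ge_zero order.strict_trans1 by blast
  have yO: "(s, y') \<in> O1" "(s, y) \<in> O1" using ball y' r by auto
  have "D2 (s, y') (1, v') (0, h) + D (s, y') (0, l) - (D2 (s, y) (1, v) (0, h) + D (s, y) (0, l))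
    = (D2 (s, y') - D2 (s, y)) (1, v) (0, h) + D2 (s, y') (0, v' - v) (0, h) + (D (s, y') - D (s, y)) (0, l)"
  proof -
    have "D2 (s, y') (1, v') = D2 (s, y') (1, v) + D2 (s, y') (0, v' - v)"
      by (simp flip: blinfun.add_right)
    then show ?thesis by (simp add: blinfun.diff_left blinfun.add_left)
  qed
  also have "norm \<dots> \<le> e * norm h * (core s + norm v) + K * norm h * norm (v' - v) + K * norm (y' - y) * norm l"
  proof (intro norm_triangle_mono)
    have "norm ((D2 (s, y') - D2 (s, y)) (1, v)) \<le> e * (core s + norm v)"
      by (rule norm_apply_time_le) (use ball[OF y'] ends_time_derivative yO in \<open>auto simp: blinfun.diff_left\<close>)
    from norm_apply_space_le[OF this]
    show "norm ((D2 (s, y') - D2 (s, y)) (1, v) (0, h)) \<le> e * norm h * (core s + norm v)"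
      by (simp only: mult_ac)
    have "norm (D2 (s, y') (0, v' - v)) \<le> K * norm (v' - v)"
      using ball[OF y'] by (intro norm_apply_space_le) auto
    from norm_apply_space_le[OF this]
    show "norm (D2 (s, y') (0, v' - v) (0, h)) \<le> K * norm h * norm (v' - v)"
      by (simp only: mult_ac)
    show "norm ((D (s, y') - D (s, y)) (0, l)) \<le> K * norm (y' - y) * norm l"
      by (rule norm_apply_space_le[OF velocity_remainder(1)[OF ball y' e]])
  qed
  finally show ?thesis .
qed

text \<open>The derivative of the remainder along the segment is a difference of first derivatives,
  to which the third tame estimate applies. Each resulting term is either quadratic in the H1
  increment \<open>H\<close> or carries \<open>H\<close> times the H2 increment, so after
  integration all are of second order.\<close>

lemma lift_remainder:
  assumes good: "\<And>w z. norm (w - \<iota> f) < r \<Longrightarrow> norm (z - \<iota> f) < r \<Longrightarrow> good K s w z"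
    and f': "norm (\<iota> f' - \<iota> f) < r" and H: "norm (\<iota> f' - \<iota> f) \<le> H"
  shows "norm (\<psi> (s, f') - \<psi> (s, f) - fderiv \<psi> (s, f) (0, f' - f))
    \<le> 2 * K * H\<^sup>2 * norm f + (2 * K * H + K * H\<^sup>2) * norm (f' - f)"
proof -
  have r: "r > 0" using f' norm_ge_zero order.strict_trans1 by blast
  have H0: "0 \<le> H" using H norm_ge_zero order_trans by blast
  have g0: "good K s (\<iota> f) (\<iota> f)" using good[of "\<iota> f" "\<iota> f"] r by simp
  have K: "0 \<le> K" using g0 norm_ge_zero order_trans unfolding good_def by blast
  let ?L = "\<lambda>h. fderiv \<psi> (s, f) (0, h)"
  have L: "bounded_linear ?L"
    by (intro bounded_linear_compose[OF blinfun.bounded_linear_right] bounded_linear_Pair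
        bounded_linear_zero bounded_linear_ident)
  define k where "k = f' - f"
  have ik: "norm (\<iota> k) \<le> H" using H by (simp add: k_def incl.diff)
  have "norm ((\<psi> (s, f') - ?L f') - (\<psi> (s, f) - ?L f))
    \<le> K * (2 * H * norm k + (2 * norm f + norm k) * H\<^sup>2)"
  proof (rule norm_diff_le_segment[where f="\<lambda>w. \<psi> (s, w) - ?L w"])
    fix w assume "w \<in> closed_segment f f'"
    then obtain c where c: "0 \<le> c" "c \<le> 1" "w = (1 - c) *\<^sub>R f + c *\<^sub>R f'"
      by (auto simp: closed_segment_def)
    have wf: "w - f = c *\<^sub>R k" by (simp add: c(3) k_def algebra_simps)
    have "norm (\<iota> w - \<iota> f) = c * norm (\<iota> f' - \<iota> f)"
      unfolding incl.diff[symmetric] wf using c by (simp add: incl.scaleR k_def)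
    also have "\<dots> \<le> norm (\<iota> f' - \<iota> f)" using c by (simp add: mult_left_le_one_le)
    finally have iw: "norm (\<iota> w - \<iota> f) < r" using f' by simp
    then have g: "good K s (\<iota> w) (\<iota> f)" using good r by simp
    then have wO: "(s, \<iota> w) \<in> O1" by (simp add: good_def)
    show "((\<lambda>w. \<psi> (s, w) - ?L w) has_derivative (\<lambda>h. fderiv \<psi> (s, w) (0, h) - ?L h)) (at w)"
      by (intro has_derivative_diff slice_derivative_\<psi>(1)[OF wO] bounded_linear_imp_has_derivative L)
    have nw: "norm w \<le> norm f + norm k"
    proof -
      have "w = f + c *\<^sub>R k" using wf by (simp add: algebra_simps)
      then have "norm w \<le> norm f + c * norm k"
        using c norm_triangle_ineq[of f "c *\<^sub>R k"] by simp
      also have "c * norm k \<le> norm k" using c by (simp add: mult_left_le_one_le)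
      finally show ?thesis by simp
    qed
    have cwf: "norm (w - f) \<le> norm k" "norm (\<iota> (w - f)) \<le> H"
      unfolding wf using c ik H0 mult_mono[of c 1 "norm (\<iota> k)" H]
      by (auto simp: incl.scaleR mult_left_le_one_le)
    have "norm (fderiv \<psi> (s, w) (0, k) - ?L k) \<le> K * tame_bound (norm w + norm f) (w - f) k"
      using g by (auto simp: good_def tame_estimates_def)
    also have "\<dots> \<le> K * (H * norm k + norm k * H + (2 * norm f + norm k) * H * H)"
      using nw by (intro mult_left_mono[OF _ K] tame_bound_le cwf ik) auto
    also have "\<dots> = K * (2 * H * norm k + (2 * norm f + norm k) * H\<^sup>2)"
      by (simp add: power2_eq_square algebra_simps)
    finally show "norm (fderiv \<psi> (s, w) (0, f' - f) - ?L (f' - f)) \<le>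
        K * (2 * H * norm k + (2 * norm f + norm k) * H\<^sup>2)" by (simp add: k_def)
  qed
  moreover have "(\<psi> (s, f') - ?L f') - (\<psi> (s, f) - ?L f) = \<psi> (s, f') - \<psi> (s, f) - ?L (f' - f)"
    unfolding linear_diff[OF bounded_linear.linear[OF L]] by simp
  moreover have "K * (2 * H * norm k + (2 * norm f + norm k) * H\<^sup>2) =
    2 * K * H\<^sup>2 * norm f + (2 * K * H + K * H\<^sup>2) * norm (f' - f)"
    by (simp add: k_def algebra_simps)
  ultimately show ?thesis by simp
qed

text \<open>The third tame estimate, with \<open>norm f'\<close> replaced by
  \<open>norm f + norm (f' - f)\<close>, so that the only H2 norms are those of the fixed path, the
  increment and the direction, as \<open>path_norm_combination\<close> requires.\<close>

lemma lift_difference: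
  assumes g: "good K s (\<iota> f') (\<iota> f)" and k: "norm (\<iota> f' - \<iota> f) \<le> Hk" and h: "norm (\<iota> g) \<le> Hh"
  shows "norm (fderiv \<psi> (s, f') (0, g) - fderiv \<psi> (s, f) (0, g))
    \<le> 2 * K * Hk * Hh * norm f + (K * Hh + K * Hk * Hh) * norm (f' - f) + K * Hk * norm g"
proof -
  have K: "0 \<le> K" using g norm_ge_zero order_trans unfolding good_def by blast
  have H: "0 \<le> Hk" "0 \<le> Hh" using k h norm_ge_zero order_trans by blast+
  have nf: "norm f' \<le> norm f + norm (f' - f)" by (rule norm_triangle_sub)
  have "norm (fderiv \<psi> (s, f') (0, g) - fderiv \<psi> (s, f) (0, g))
    \<le> K * tame_bound (norm f' + norm f) (f' - f) g"
    using g by (auto simp: good_def tame_estimates_def)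
  also have "\<dots> \<le> K * (Hk * norm g + norm (f' - f) * Hh + (2 * norm f + norm (f' - f)) * Hk * Hh)"
    using nf k by (intro mult_left_mono[OF _ K] tame_bound_le h) (auto simp: incl.diff)
  also have "\<dots> = 2 * K * Hk * Hh * norm f + (K * Hh + K * Hk * Hh) * norm (f' - f) + K * Hk * norm g"
    by (simp add: algebra_simps)
  finally show ?thesis .
qed

lemma admissible_iff:
  "u \<in> admissible_paths \<iota> O1 \<longleftrightarrow> (\<exists>v f. is_path \<iota> u v f) \<and> (\<forall>s. (s, u s) \<in> O1)"
  by (simp add: admissible_paths_def path_space_iff)

section \<open>Norm estimates for a path near a fixed one\<close>

context
  fixes u v f \<eta> v' f' r K e n
  assumes u: "is_path \<iota> u v f" and adm: "\<And>s. (s, u s) \<in> O1"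
    and \<eta>: "is_path \<iota> \<eta> v' f'" and adm': "\<And>s. (s, \<eta> s) \<in> O1"
    and good: "\<And>s y z. norm (y - u s) < r \<Longrightarrow> norm (z - u s) < r \<Longrightarrow> good K s y z"
    and close: "\<And>s y. norm (y - u s) < r \<Longrightarrow> norm (D2 (s, y) - D2 (s, u s)) \<le> e"
    and e: "0 \<le> e" and n: "n = pnorm (\<lambda>s. \<eta> s - u s)" and nr: "2 * n < r"
begin

lemma near_path:
  shows "is_path \<iota> (\<lambda>s. \<eta> s - u s) (\<lambda>s. v' s - v s) (\<lambda>s. f' s - f s)"
    and "0 \<le> n" "norm (\<eta> s - u s) \<le> 2 * n" "norm (\<eta> s - u s) < r"
    and "good K s (u s) (u s)" "good K s (\<eta> s) (\<eta> s)" "0 \<le> K"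
    and "norm (w - u s) < r \<Longrightarrow>
      (s, w) \<in> O1 \<and> norm (D2 (s, w)) \<le> K \<and> norm (D2 (s, w) - D2 (s, u s)) \<le> e"
    and "AE s in lborel. \<iota> (f s) = u s \<and> \<iota> (f' s) = \<eta> s \<and>
      lift0 f s = \<psi> (s, f s) \<and> lift0 f' s = \<psi> (s, f' s) \<and>
      (\<forall>g. lift1 f g s = fderiv \<psi> (s, f s) (0, g s) \<and> lift1 f' g s = fderiv \<psi> (s, f' s) (0, g s))"
proof -
  show k: "is_path \<iota> (\<lambda>s. \<eta> s - u s) (\<lambda>s. v' s - v s) (\<lambda>s. f' s - f s)"
    by (rule is_path_diff[OF \<eta> u])
  show n0: "0 \<le> n" unfolding n by (rule path_norm_bounds(1)[OF k])
  show sup: "norm (\<eta> s - u s) \<le> 2 * n" for s unfolding n by (rule is_path_sup_le[OF k])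
  then show near: "norm (\<eta> s - u s) < r" for s using nr order.strict_trans1 by blast
  show g: "good K s (u s) (u s)" using good n0 nr by simp
  show "good K s (\<eta> s) (\<eta> s)" using good near by simp
  show "0 \<le> K" using g norm_ge_zero order_trans unfolding good_def by blast
  show "(s, w) \<in> O1 \<and> norm (D2 (s, w)) \<le> K \<and> norm (D2 (s, w) - D2 (s, u s)) \<le> e" if "norm (w - u s) < r"
    using good[OF that that] close[OF that] by (simp add: good_def)
  have "AE s in lborel. \<iota> (f s) = u s" "AE s in lborel. \<iota> (f' s) = \<eta> s"
    using u \<eta> by (auto simp: is_path_def)
  then show "AE s in lborel. \<iota> (f s) = u s \<and> \<iota> (f' s) = \<eta> s \<and>
      lift0 f s = \<psi> (s, f s) \<and> lift0 f' s = \<psi> (s, f' s) \<and>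
      (\<forall>g. lift1 f g s = fderiv \<psi> (s, f s) (0, g s) \<and> lift1 f' g s = fderiv \<psi> (s, f' s) (0, g s))"
    by eventually_elim (use adm adm' in \<open>simp add: lift_eq\<close>)
qed

lemma remainder_estimate:
  "pnorm (\<lambda>s. path_map \<phi> \<eta> s - path_map \<phi> u s - D_path_map u (\<lambda>s. \<eta> s - u s) s) \<le>
    2 * ((e * (2 * n) + 2 * K * (2 * n)\<^sup>2) * (sqrt (2 * T) + pnorm u)
      + (2 * K * (2 * n) + K * (2 * n)\<^sup>2) * n)"
proof -
  note np = near_path
  \<comment> \<open>The coefficients must serve the velocity and the H2 version at once.
    \<open>e * (2 * n)\<close> comes from \<open>velocity_remainder\<close>, the quadratic summand
    from \<open>lift_remainder\<close>; \<open>2 * n\<close> is the sup bound of the increment in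
    H1.\<close>
  let ?a = "e * (2 * n) + 2 * K * (2 * n)\<^sup>2" and ?b = "2 * K * (2 * n) + K * (2 * n)\<^sup>2"
  have nn: "0 \<le> e * (2 * n)" "0 \<le> 2 * K * (2 * n)\<^sup>2" "0 \<le> 2 * K * (2 * n)" "0 \<le> K * (2 * n)\<^sup>2"
    "0 \<le> K * (2 * n)"
    using e np(2,7) by auto
  have ca: "e * (2 * n) \<le> ?a" "2 * K * (2 * n)\<^sup>2 \<le> ?a" and cb: "K * (2 * n) \<le> ?b"
    using nn by linarith+
  have "pnorm (\<lambda>s. path_map \<phi> \<eta> s - path_map \<phi> u s - D_path_map u (\<lambda>s. \<eta> s - u s) s) \<le>
    2 * (?a * (sqrt (2 * T) + pnorm u) + ?b * pnorm (\<lambda>s. \<eta> s - u s)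
      + 0 * pnorm (\<lambda>s. \<eta> s - u s))"
  proof (rule path_norm_combination[OF is_path_diff[OF is_path_diff[OF
          is_path_path_map[OF \<eta> adm'] is_path_path_map[OF u adm]]
          is_path_D_path_map(1)[OF u adm np(1) np(5)]] u np(1) np(1)])
    have "norm (D (s, \<eta> s) (1, v' s) - D (s, u s) (1, v s) -
        (D2 (s, u s) (1, v s) (0, \<eta> s - u s) + D (s, u s) (0, v' s - v s)))
      \<le> ?a * (core s + norm (v s)) + ?b * norm (v' s - v s)" for s
    proof -
      have m: "0 \<le> core s + norm (v s)" using core_facts(1)[of s] by simp
      have "norm (D (s, \<eta> s) (1, v' s) - D (s, u s) (1, v s) -
          (D2 (s, u s) (1, v s) (0, \<eta> s - u s) + D (s, u s) (0, v' s - v s)))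
        \<le> e * norm (\<eta> s - u s) * (core s + norm (v s)) + K * norm (\<eta> s - u s) * norm (v' s - v s)"
        by (rule velocity_remainder(2)[OF np(8) np(4) e])
      also have "\<dots> \<le> (e * (2 * n)) * (core s + norm (v s)) + (K * (2 * n)) * norm (v' s - v s)"
        using e np(7) m by (intro add_mono mult_right_mono mult_left_mono np(3)) auto
      also have "\<dots> \<le> ?a * (core s + norm (v s)) + ?b * norm (v' s - v s)"
        by (intro add_mono[OF mult_right_mono[OF ca(1) m] mult_right_mono[OF cb norm_ge_zero]])
      finally show ?thesis .
    qed
    then show "AE s in lborel. norm (D (s, \<eta> s) (1, v' s) - D (s, u s) (1, v s) -
        (D2 (s, u s) (1, v s) (0, \<eta> s - u s) + D (s, u s) (0, v' s - v s)))
      \<le> ?a * (core s + norm (v s)) + ?b * norm (v' s - v s) + 0 * norm (v' s - v s)"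
      by simp
    show "AE s in lborel. norm (lift0 f' s - lift0 f s - lift1 f (\<lambda>s. f' s - f s) s)
      \<le> ?a * norm (f s) + ?b * norm (f' s - f s) + 0 * norm (f' s - f s)"
      using np(9)
    proof eventually_elim
      case (elim s)
      have "norm (\<psi> (s, f' s) - \<psi> (s, f s) - fderiv \<psi> (s, f s) (0, f' s - f s)) \<le>
        2 * K * (2 * n)\<^sup>2 * norm (f s) + ?b * norm (f' s - f s)"
        by (rule lift_remainder[where r=r]) (use elim good np(3,4) in auto)
      also have "\<dots> \<le> ?a * norm (f s) + ?b * norm (f' s - f s)"
        by (intro add_right_mono mult_right_mono[OF ca(2) norm_ge_zero])
      finally show ?case using elim by simp
    qed
    show "0 \<le> ?a" by (rule add_nonneg_nonneg[OF nn(1,2)])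
    show "0 \<le> ?b" by (rule add_nonneg_nonneg[OF nn(3,4)])
  qed simp
  then show ?thesis by (simp add: n)
qed

lemma derivative_difference_estimate:
  assumes h: "is_path \<iota> h l g" and m: "m = pnorm h"
  shows "pnorm (\<lambda>s. D_path_map \<eta> h s - D_path_map u h s) \<le>
    2 * ((e * (2 * m) + 2 * K * (2 * n) * (2 * m)) * (sqrt (2 * T) + pnorm u)
      + (K * (2 * m) + K * (2 * n) * (2 * m)) * n + K * (2 * n) * m)"
proof -
  note np = near_path
  \<comment> \<open>Again one set of coefficients for both components, with the sup bounds
    \<open>2 * n\<close> of the increment and \<open>2 * m\<close> of the direction inserted into
    \<open>velocity_difference\<close> and \<open>lift_difference\<close>.\<close>
  let ?a = "e * (2 * m) + 2 * K * (2 * n) * (2 * m)" and ?b = "K * (2 * m) + K * (2 * n) * (2 * m)"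
    and ?c = "K * (2 * n)"
  have m0: "0 \<le> m" unfolding m by (rule path_norm_bounds(1)[OF h])
  have hm: "norm (h s) \<le> 2 * m" for s unfolding m by (rule is_path_sup_le[OF h])
  have nn: "0 \<le> e * (2 * m)" "0 \<le> 2 * K * (2 * n) * (2 * m)" "0 \<le> K * (2 * m)"
    "0 \<le> K * (2 * n) * (2 * m)" "0 \<le> K * (2 * n)"
    using e np(2,7) m0 by auto
  have ca: "e * (2 * m) \<le> ?a" "2 * K * (2 * n) * (2 * m) \<le> ?a" and cb: "K * (2 * m) \<le> ?b"
    using nn by linarith+
  have ih: "AE s in lborel. \<iota> (g s) = h s" using h by (simp add: is_path_def)
  have "pnorm (\<lambda>s. D_path_map \<eta> h s - D_path_map u h s) \<le>
    2 * (?a * (sqrt (2 * T) + pnorm u) + ?b * pnorm (\<lambda>s. \<eta> s - u s) + ?c * pnorm h)"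
  proof (rule path_norm_combination[OF is_path_diff[OF
          is_path_D_path_map(1)[OF \<eta> adm' h np(6)] is_path_D_path_map(1)[OF u adm h np(5)]] u np(1) h])
    have "norm (D2 (s, \<eta> s) (1, v' s) (0, h s) + D (s, \<eta> s) (0, l s) -
        (D2 (s, u s) (1, v s) (0, h s) + D (s, u s) (0, l s)))
      \<le> ?a * (core s + norm (v s)) + ?b * norm (v' s - v s) + ?c * norm (l s)" for s
    proof -
      have m': "0 \<le> core s + norm (v s)" using core_facts(1)[of s] by simp
      have "norm (D2 (s, \<eta> s) (1, v' s) (0, h s) + D (s, \<eta> s) (0, l s) -
          (D2 (s, u s) (1, v s) (0, h s) + D (s, u s) (0, l s)))
        \<le> e * norm (h s) * (core s + norm (v s)) + K * norm (h s) * norm (v' s - v s)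
          + K * norm (\<eta> s - u s) * norm (l s)"
        by (rule velocity_difference[OF np(8) np(4) e])
      also have "\<dots> \<le> (e * (2 * m)) * (core s + norm (v s)) + (K * (2 * m)) * norm (v' s - v s)
          + ?c * norm (l s)"
        using e np(7) m' by (intro add_mono mult_right_mono mult_left_mono np(3) hm) auto
      also have "\<dots> \<le> ?a * (core s + norm (v s)) + ?b * norm (v' s - v s) + ?c * norm (l s)"
        by (intro add_right_mono add_mono[OF mult_right_mono[OF ca(1) m'] mult_right_mono[OF cb norm_ge_zero]])
      finally show ?thesis .
    qed
    then show "AE s in lborel. norm (D2 (s, \<eta> s) (1, v' s) (0, h s) + D (s, \<eta> s) (0, l s) -
        (D2 (s, u s) (1, v s) (0, h s) + D (s, u s) (0, l s)))
      \<le> ?a * (core s + norm (v s)) + ?b * norm (v' s - v s) + ?c * norm (l s)"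
      by simp
    show "AE s in lborel. norm (lift1 f' g s - lift1 f g s)
      \<le> ?a * norm (f s) + ?b * norm (f' s - f s) + ?c * norm (g s)"
      using np(9) ih
    proof eventually_elim
      case (elim s)
      have "good K s (\<eta> s) (u s)" using good np(2,4) nr by simp
      then have "norm (fderiv \<psi> (s, f' s) (0, g s) - fderiv \<psi> (s, f s) (0, g s)) \<le>
        2 * K * (2 * n) * (2 * m) * norm (f s) + ?b * norm (f' s - f s) + ?c * norm (g s)"
        by (intro lift_difference) (use elim np(3) hm[of s] in auto)
      also have "\<dots> \<le> ?a * norm (f s) + ?b * norm (f' s - f s) + ?c * norm (g s)"
        by (intro add_right_mono mult_right_mono[OF ca(2) norm_ge_zero])
      finally show ?case using elim by simp
    qed
    show "0 \<le> ?a" by (rule add_nonneg_nonneg[OF nn(1,2)])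
    show "0 \<le> ?b" by (rule add_nonneg_nonneg[OF nn(3,4)])
    show "0 \<le> ?c" by (rule nn(5))
  qed
  then show ?thesis by (simp add: n m)
qed

end

section \<open>Openness of the domain and continuous differentiability\<close>

lemma admissible_tube:
  assumes u: "is_path \<iota> u v f" and adm: "\<And>s. (s, u s) \<in> O1"
  obtains r where "r > 0" "\<And>\<eta>. \<eta> \<in> path_space \<iota> \<Longrightarrow> pnorm (\<lambda>s. \<eta> s - u s) < r \<Longrightarrow>
    \<eta> \<in> admissible_paths \<iota> O1"
proof -
  obtain r where r: "r > 0" "\<And>s y. norm (y - u s) < r \<Longrightarrow> (s, y) \<in> O1"
    using tube_close[OF u adm zero_less_one] by metis
  show thesis
  proof
    \<comment> \<open>Halved because the sup norm is at most twice the path norm.\<close>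
    show "r / 2 > 0" using r by simp
    fix \<eta> assume \<eta>: "\<eta> \<in> path_space \<iota>" and near: "pnorm (\<lambda>s. \<eta> s - u s) < r / 2"
    then obtain v' f' where p: "is_path \<iota> \<eta> v' f'" by (auto simp: path_space_iff)
    have "norm (\<eta> s - u s) < r" for s
      using is_path_sup_le[OF is_path_diff[OF p u], of s] near by simp
    then show "\<eta> \<in> admissible_paths \<iota> O1" using p r(2) by (auto simp: admissible_iff)
  qed
qed

text \<open>Remainder and operator difference are treated together, since after simplification both
  have the same factor \<open>4 * e * C + Q * n\<close>, multiplying \<open>n\<close> in one case
  and \<open>pnorm h\<close> in the other.\<close>

lemma estimates_near_path:
  assumes u: "is_path \<iota> u v f" and adm: "\<And>s. (s, u s) \<in> O1" and \<epsilon>: "\<epsilon> > 0"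
  shows "\<exists>\<delta>>0. \<forall>\<eta>\<in>admissible_paths \<iota> O1. pnorm (\<lambda>s. \<eta> s - u s) < \<delta> \<longrightarrow>
      pnorm (\<lambda>s. path_map \<phi> \<eta> s - path_map \<phi> u s - D_path_map u (\<lambda>s. \<eta> s - u s) s)
        \<le> \<epsilon> * pnorm (\<lambda>s. \<eta> s - u s) \<and>
      (\<forall>h\<in>path_space \<iota>. pnorm (\<lambda>s. D_path_map \<eta> h s - D_path_map u h s) \<le> \<epsilon> * pnorm h)"
proof -
  obtain r1 K where r1: "r1 > 0" and K: "K > 0"
    and good: "\<And>s y z. norm (y - u s) < r1 \<Longrightarrow> norm (z - u s) < r1 \<Longrightarrow> good K s y z"
    using tube_good[OF u adm] by metis
  define C where "C = sqrt (2 * T) + pnorm u"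
  have C: "0 \<le> C" using T_pos path_norm_bounds(1)[OF u] by (simp add: C_def)
  \<comment> \<open>Chosen so that \<open>4 * e * C \<le> \<epsilon> / 2\<close>; the added 1 guards
    against \<open>C = 0\<close>. The tube in which \<open>D2\<close> varies by at most
    \<open>e\<close> is fixed only afterwards.\<close>
  define e where "e = \<epsilon> / 8 / (C + 1)"
  have e: "e > 0" using \<epsilon> C by (simp add: e_def)
  have eC: "4 * e * C \<le> \<epsilon> / 2"
  proof -
    have "C + 1 \<noteq> 0" using C by simp
    then have "e * (C + 1) = \<epsilon> / 8" unfolding e_def by (metis nonzero_eq_divide_eq)
    moreover have "e * C \<le> e * (C + 1)" using e by simp
    ultimately show ?thesis by simp
  qed
  obtain r2 where r2: "r2 > 0" and close: "\<And>s y. norm (y - u s) < r2 \<Longrightarrow> norm (D2 (s, y) - D2 (s, u s)) \<le> e"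
    using tube_close[OF u adm e] by metis
  define r where "r = min r1 r2"
  \<comment> \<open>Collects all terms with \<open>K\<close>: \<open>16 * K * C * n\<close>,
    \<open>8 * K * n\<close> and \<open>8 * K * n\<^sup>2\<close>, the last one reduced to first
    order by \<open>n \<le> 1\<close>. The entry \<open>\<epsilon> / (2 * Q)\<close> of
    \<open>\<delta>\<close> keeps their sum below \<open>\<epsilon> / 2\<close>.\<close>
  define Q where "Q = 16 * K * (C + 1)"
  have Q: "Q > 0" using K C by (simp add: Q_def)
  define \<delta> where "\<delta> = min 1 (min (r / 2) (\<epsilon> / (2 * Q)))"
  show ?thesis
  proof (intro exI[of _ \<delta>] conjI ballI impI)
    show "\<delta> > 0" using r1 r2 \<epsilon> Q by (simp add: \<delta>_def r_def)
    fix \<eta> assume \<eta>: "\<eta> \<in> admissible_paths \<iota> O1" and near: "pnorm (\<lambda>s. \<eta> s - u s) < \<delta>"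
    define n where "n = pnorm (\<lambda>s. \<eta> s - u s)"
    obtain v' f' where p: "is_path \<iota> \<eta> v' f'" and adm': "\<And>s. (s, \<eta> s) \<in> O1"
      using \<eta> by (auto simp: admissible_iff)
    have n0: "0 \<le> n" unfolding n_def by (rule path_norm_bounds(1)[OF is_path_diff[OF p u]])
    have n1: "n \<le> 1" and nr: "2 * n < r" and nQ: "n \<le> \<epsilon> / (2 * Q)"
      using near by (auto simp: n_def \<delta>_def)
    have nQ': "Q * n \<le> \<epsilon> / 2" using nQ Q by (simp add: field_simps)
    have good': "good K s y z" if "norm (y - u s) < r" "norm (z - u s) < r" for s y z
      using good that by (simp add: r_def)
    have close': "norm (D2 (s, y) - D2 (s, u s)) \<le> e" if "norm (y - u s) < r" for s y
      using close that by (simp add: r_def)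
    have est1: "pnorm (\<lambda>s. path_map \<phi> \<eta> s - path_map \<phi> u s - D_path_map u (\<lambda>s. \<eta> s - u s) s) \<le>
      2 * ((e * (2 * n) + 2 * K * (2 * n)\<^sup>2) * C + (2 * K * (2 * n) + K * (2 * n)\<^sup>2) * n)"
      unfolding C_def
    proof (rule remainder_estimate[OF u adm p adm' _ _ _ n_def nr])
      show "good K s y z" if "norm (y - u s) < r" "norm (z - u s) < r" for s y z
        using that by (rule good')
      show "norm (D2 (s, y) - D2 (s, u s)) \<le> e" if "norm (y - u s) < r" for s y
        using that by (rule close')
    qed (use e in simp)
    have Kn: "K * (n * n) \<le> K * n" using K n0 n1 by (simp add: mult_left_le)
    have total: "4 * e * C + Q * n \<le> \<epsilon>" using eC nQ' by simp
    have "pnorm (\<lambda>s. path_map \<phi> \<eta> s - path_map \<phi> u s - D_path_map u (\<lambda>s. \<eta> s - u s) s) \<le> \<epsilon> * n"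
    proof -
      have "2 * ((e * (2 * n) + 2 * K * (2 * n)\<^sup>2) * C + (2 * K * (2 * n) + K * (2 * n)\<^sup>2) * n)
        = (4 * e * C + 16 * K * C * n + 8 * K * n + 8 * (K * (n * n))) * n"
        by (simp add: power2_eq_square algebra_simps)
      also have "\<dots> \<le> (4 * e * C + 16 * K * C * n + 8 * K * n + 8 * (K * n)) * n"
        using Kn n0 by (intro mult_right_mono) auto
      also have "\<dots> = (4 * e * C + Q * n) * n" by (simp add: Q_def algebra_simps)
      also have "\<dots> \<le> \<epsilon> * n" using total n0 by (rule mult_right_mono)
      finally show ?thesis using est1 by linarith
    qed
    moreover have "pnorm (\<lambda>s. D_path_map \<eta> h s - D_path_map u h s) \<le> \<epsilon> * pnorm h"
      if "h \<in> path_space \<iota>" for h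
    proof -
      obtain l g where h: "is_path \<iota> h l g" using \<open>h \<in> path_space \<iota>\<close> by (auto simp: path_space_iff)
      define m where "m = pnorm h"
      have m0: "0 \<le> m" unfolding m_def by (rule path_norm_bounds(1)[OF h])
      have est2: "pnorm (\<lambda>s. D_path_map \<eta> h s - D_path_map u h s) \<le>
        2 * ((e * (2 * m) + 2 * K * (2 * n) * (2 * m)) * C
          + (K * (2 * m) + K * (2 * n) * (2 * m)) * n + K * (2 * n) * m)"
        unfolding C_def
      proof (rule derivative_difference_estimate[OF u adm p adm' _ _ _ n_def nr h m_def])
        show "good K s y z" if "norm (y - u s) < r" "norm (z - u s) < r" for s y z
          using that by (rule good')
        show "norm (D2 (s, y) - D2 (s, u s)) \<le> e" if "norm (y - u s) < r" for s y
          using that by (rule close')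
      qed (use e in simp)
      have "2 * ((e * (2 * m) + 2 * K * (2 * n) * (2 * m)) * C
          + (K * (2 * m) + K * (2 * n) * (2 * m)) * n + K * (2 * n) * m)
        = (4 * e * C + 16 * K * C * n + 8 * K * n + 8 * (K * (n * n))) * m"
        by (simp add: algebra_simps)
      also have "\<dots> \<le> (4 * e * C + 16 * K * C * n + 8 * K * n + 8 * (K * n)) * m"
        using Kn m0 by (intro mult_right_mono) auto
      also have "\<dots> = (4 * e * C + Q * n) * m" by (simp add: Q_def algebra_simps)
      also have "\<dots> \<le> \<epsilon> * m" using total m0 by (rule mult_right_mono)
      finally show ?thesis using est2 by (simp add: m_def)
    qed
    ultimately show "pnorm (\<lambda>s. path_map \<phi> \<eta> s - path_map \<phi> u s - D_path_map u (\<lambda>s. \<eta> s - u s) s)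
        \<le> \<epsilon> * pnorm (\<lambda>s. \<eta> s - u s)"
      "\<And>h. h \<in> path_space \<iota> \<Longrightarrow> pnorm (\<lambda>s. D_path_map \<eta> h s - D_path_map u h s) \<le> \<epsilon> * pnorm h"
      by (simp_all add: n_def)
  qed
qed

lemma bounded_operator_D_path_map:
  assumes u: "is_path \<iota> u v f" and adm: "\<And>s. (s, u s) \<in> O1"
  shows "bounded_operator (path_space \<iota>) pnorm (D_path_map u)"
proof -
  obtain r K where "r > 0" and good: "\<And>s y z. norm (y - u s) < r \<Longrightarrow> norm (z - u s) < r \<Longrightarrow> good K s y z"
    using tube_good[OF u adm] by metis
  then have g: "good K s (u s) (u s)" for s by simp
  have 1: "D_path_map u h \<in> path_space \<iota> \<and> pnorm (D_path_map u h) \<le>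
      2 * (2 * K * (sqrt (2 * T) + pnorm u) + K) * pnorm h" if "h \<in> path_space \<iota>" for h
  proof -
    obtain w g' where h: "is_path \<iota> h w g'" using \<open>h \<in> path_space \<iota>\<close> by (auto simp: path_space_iff)
    show ?thesis using is_path_D_path_map[OF u adm h g] by (auto simp: path_space_iff)
  qed
  have "D_path_map u (\<lambda>s. h s + k s) = (\<lambda>s. D_path_map u h s + D_path_map u k s)" for h k
    by (rule ext) (simp add: D_path_map_def flip: blinfun.add_right)
  moreover have "D_path_map u (\<lambda>s. c *\<^sub>R h s) = (\<lambda>s. c *\<^sub>R D_path_map u h s)" for c h
    by (rule ext) (simp add: D_path_map_def flip: blinfun.scaleR_right)
  ultimately show ?thesis unfolding bounded_operator_def using 1 by blast
qed

lemma path_map_in_path_space: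
  "u \<in> admissible_paths \<iota> O1 \<Longrightarrow> path_map \<phi> u \<in> path_space \<iota>"
  unfolding admissible_iff path_space_iff using is_path_path_map by blast

lemma C1_map_path_map:
  "C1_map (path_space \<iota>) pnorm (admissible_paths \<iota> O1) (path_map \<phi>)"
  unfolding C1_map_def
proof (intro conjI exI[of _ D_path_map] ballI allI impI)
  show "open_subset (path_space \<iota>) pnorm (admissible_paths \<iota> O1)"
    unfolding open_subset_def
  proof (intro conjI ballI)
    show "admissible_paths \<iota> O1 \<subseteq> path_space \<iota>" by (auto simp: admissible_paths_def)
    fix u assume "u \<in> admissible_paths \<iota> O1"
    then obtain v f where "is_path \<iota> u v f" "\<And>s. (s, u s) \<in> O1" by (auto simp: admissible_iff)
    from admissible_tube[OF this] obtain r where "r > 0"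
      "\<And>\<eta>. \<eta> \<in> path_space \<iota> \<Longrightarrow> pnorm (\<lambda>s. \<eta> s - u s) < r \<Longrightarrow> \<eta> \<in> admissible_paths \<iota> O1"
      by blast
    then show "\<exists>r>0. \<forall>\<eta>\<in>path_space \<iota>. pnorm (\<lambda>s. \<eta> s - u s) < r \<longrightarrow> \<eta> \<in> admissible_paths \<iota> O1"
      by blast
  qed
  show "path_map \<phi> u \<in> path_space \<iota>" if "u \<in> admissible_paths \<iota> O1" for u
    by (rule path_map_in_path_space[OF that])
next
  fix u assume "u \<in> admissible_paths \<iota> O1"
  then obtain v f where u: "is_path \<iota> u v f" and adm: "\<And>s. (s, u s) \<in> O1" by (auto simp: admissible_iff)
  show "has_derivative_within_space (path_space \<iota>) pnorm (admissible_paths \<iota> O1)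
      (path_map \<phi>) (D_path_map u) u"
    unfolding has_derivative_within_space_def
  proof (intro conjI allI impI)
    show "bounded_operator (path_space \<iota>) pnorm (D_path_map u)"
      by (rule bounded_operator_D_path_map[OF u adm])
    fix \<epsilon> :: real assume "\<epsilon> > 0"
    then show "\<exists>\<delta>>0. \<forall>\<eta>\<in>admissible_paths \<iota> O1. pnorm (\<lambda>s. \<eta> s - u s) < \<delta> \<longrightarrow>
      pnorm (\<lambda>s. path_map \<phi> \<eta> s - path_map \<phi> u s - D_path_map u (\<lambda>s. \<eta> s - u s) s)
        \<le> \<epsilon> * pnorm (\<lambda>s. \<eta> s - u s)"
      by (rule ex_forward[OF estimates_near_path[OF u adm]]) blast
  qed
  fix \<epsilon> :: real assume "\<epsilon> > 0"
  then show "\<exists>\<delta>>0. \<forall>\<eta>\<in>admissible_paths \<iota> O1. pnorm (\<lambda>s. \<eta> s - u s) < \<delta> \<longrightarrow>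
      (\<forall>h\<in>path_space \<iota>. pnorm (\<lambda>s. D_path_map \<eta> h s - D_path_map u h s) \<le> \<epsilon> * pnorm h)"
    by (rule ex_forward[OF estimates_near_path[OF u adm]]) blast
qed

end

theorem theorem3p5:
  fixes \<iota> :: "'b::{real_inner, banach, second_countable_topology}
                \<Rightarrow> 'a::{real_inner, banach, second_countable_topology}"
    and O1 :: "(real \<times> 'a) set"
    and \<phi> :: "real \<times> 'a \<Rightarrow> 'a"
  assumes "bounded_linear \<iota>" and "inj \<iota>" and "closure (range \<iota>) = UNIV"
    and "\<And>x. norm (\<iota> x) \<le> norm x"
    and "open O1"
    and "parametrized_tame \<iota> O1 \<phi>"
    and "asymptotically_constant O1 \<phi>"
  shows "(\<forall>\<xi> \<in> admissible_paths \<iota> O1. path_map \<phi> \<xi> \<in> path_space \<iota>) \<and>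
         C1_map (path_space \<iota>) (path_norm \<iota>) (admissible_paths \<iota> O1) (path_map \<phi>)"
proof -
  obtain T where T: "T > 0"
    "\<And>s t. T \<le> s \<and> T \<le> t \<or> s \<le> - T \<and> t \<le> - T \<Longrightarrow>
      slice O1 s = slice O1 t \<and> (\<forall>x\<in>slice O1 s. \<phi> (s, x) = \<phi> (t, x))"
    "\<And>s. T \<le> \<bar>s\<bar> \<Longrightarrow> 0 \<in> slice O1 s \<and> \<phi> (s, 0) = 0"
    using assms(7) unfolding asymptotically_constant_def by blast
  interpret tame_path_map \<iota> O1 \<phi> T
    by (intro tame_path_map.intro contractive_inclusion.intro tame_path_map_axioms.intro assms T)
  show ?thesis using path_map_in_path_space C1_map_path_map by blast
qed

end
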